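(* Let $V\in C^2(\mathbb{R})$ satisfy $V(0)=0$ and $xV'(x)>0$ for all $x\neq 0$. Assume that all solutions of $\ddot x+V'(x)=0$ are $2\pi$-periodic and that $V''$ is bounded on $\mathbb{R}$. Let $p\in L^1(\mathbb{T})$ be such that $$\inf_{(\theta,r)\in\mathcal C}|\Phi_p(\theta,r)|>0 .$$ Then the equation $\ddot x+V'(x)=\epsilon p(t)$ is resonant for small $\epsilon\neq 0$; that is, there exists $\epsilon_0>0$ such that for every $\epsilon$ with $0<|\epsilon|<\epsilon_0$ all solutions of $\ddot x+V'(x)=\epsilon p(t)$ are unbounded.
   Context: $p\in L^1(\mathbb{T})$ means that $p:\mathbb{R}\to\mathbb{R}$ is $2\pi$-periodic and locally integrable; the forced equation is understood in the Carathéodory sense, and its solutions are defined for all $t\in\mathbb{R}$. $\mathcal C=(\mathbb{R}/2\pi\mathbb{Z})\times[0,\infty)$ is the cylinder with coordinates $(\theta,r)$. For $r\ge 0$, $\varphi(t,r)$ is the solution of $\ddot x+V'(x)=0$ with $x(0)=r$, $\dot x(0)=0$, and $\psi(t,r)$ is the complex-valued solution of $\ddot y+V''(\varphi(t,r))y=0$ with $y(0)=1$, $\dot y(0)=i$. The function $\Phi_p:\mathcal C\to\mathbb{C}$ is $$\Phi_p(\theta,r)=\frac1{2\pi}\int_0^{2\pi}p(t-\theta)\,\psi(t,r)\,dt .$$ A solution $x(t)$ is called unbounded if there is a sequence of real numbers $(t_n)$ such that $|x(t_n)|+|\dot x(t_n)|\to+\infty$. *)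

theory Defs
  imports "HOL-Analysis.Analysis"
begin

definition periodic_2pi :: "(real \<Rightarrow> 'a) \<Rightarrow> bool" where
  "periodic_2pi f \<longleftrightarrow> (\<forall>t. f (t + 2 * pi) = f t)"

definition L1_torus :: "(real \<Rightarrow> real) \<Rightarrow> bool" where
  "L1_torus p \<longleftrightarrow> periodic_2pi p \<and> (\<forall>a b. p absolutely_integrable_on {a..b})"

definition C2_real :: "(real \<Rightarrow> real) \<Rightarrow> bool" where
  "C2_real V \<longleftrightarrow> V differentiable_on UNIV \<and> deriv V differentiable_on UNIV
                \<and> continuous_on UNIV (deriv (deriv V))"

text \<open>
  In the solution predicates below, \<open>v\<close> is the derivative of \<open>x\<close>, hence it is determined by \<open>x\<close>.
\<close>

definition classical_solution ::
    "(real \<Rightarrow> 'a \<Rightarrow> 'a::real_normed_vector) \<Rightarrow> (real \<Rightarrow> 'a) \<Rightarrow> (real \<Rightarrow> 'a) \<Rightarrow> bool" where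
  "classical_solution F x v \<longleftrightarrow>
     (\<forall>t. (x has_vector_derivative v t) (at t) \<and>
          (v has_vector_derivative F t (x t)) (at t))"

text \<open>
  A set \<open>D\<close> with \<open>D division_of \<Union>D\<close> is a finite family of non-overlapping nonempty compact
  intervals \<open>K = {Inf K..Sup K}\<close>, so this is the usual \<open>\<epsilon>\<close>-\<open>\<delta>\<close> definition of absolute continuity.
\<close>

definition abs_continuous_on_interval :: "real \<Rightarrow> real \<Rightarrow> (real \<Rightarrow> real) \<Rightarrow> bool" where
  "abs_continuous_on_interval a b f \<longleftrightarrow>
     (\<forall>e>0. \<exists>d>0. \<forall>D. D division_of \<Union>D \<and> \<Union>D \<subseteq> {a..b} \<and> (\<Sum>K\<in>D. Sup K - Inf K) < d
        \<longrightarrow> (\<Sum>K\<in>D. \<bar>f (Sup K) - f (Inf K)\<bar>) < e)"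

text \<open>
  Solutions of the second order equation \<open>x'' = F t x\<close> in the Caratheodory sense: \<open>x\<close> is
  continuously differentiable, \<open>x'\<close> is locally absolutely continuous, and the equation holds
  almost everywhere.
\<close>

definition caratheodory_solution ::
    "(real \<Rightarrow> real \<Rightarrow> real) \<Rightarrow> (real \<Rightarrow> real) \<Rightarrow> (real \<Rightarrow> real) \<Rightarrow> bool" where
  "caratheodory_solution F x v \<longleftrightarrow>
     (\<forall>t. (x has_real_derivative v t) (at t)) \<and>
     (\<forall>a b. abs_continuous_on_interval a b v) \<and>
     (AE t in lebesgue. (v has_real_derivative F t (x t)) (at t))"

definition unbounded_solution :: "(real \<Rightarrow> real) \<Rightarrow> (real \<Rightarrow> real) \<Rightarrow> bool" where
  "unbounded_solution x v \<longleftrightarrow>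
     (\<exists>s :: nat \<Rightarrow> real. filterlim (\<lambda>n. \<bar>x (s n)\<bar> + \<bar>v (s n)\<bar>) at_top sequentially)"

definition all_solutions_periodic :: "(real \<Rightarrow> real) \<Rightarrow> bool" where
  "all_solutions_periodic V \<longleftrightarrow>
     (\<forall>x v. classical_solution (\<lambda>t x. - deriv V x) x v \<longrightarrow> periodic_2pi x)"

definition \<phi> :: "(real \<Rightarrow> real) \<Rightarrow> real \<Rightarrow> real \<Rightarrow> real" where
  "\<phi> V t r = (THE x. \<exists>v. classical_solution (\<lambda>t x. - deriv V x) x v \<and> x 0 = r \<and> v 0 = 0) t"

definition \<psi> :: "(real \<Rightarrow> real) \<Rightarrow> real \<Rightarrow> real \<Rightarrow> complex" where
  "\<psi> V t r = (THE y. \<exists>v. classical_solution (\<lambda>t y. - (complex_of_real (deriv (deriv V) (\<phi> V t r)) * y)) y v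
                        \<and> y 0 = 1 \<and> v 0 = \<i>) t"

definition \<Phi> :: "(real \<Rightarrow> real) \<Rightarrow> (real \<Rightarrow> real) \<Rightarrow> real \<times> real \<Rightarrow> complex" where
  "\<Phi> V p = (\<lambda>(\<theta>, r). complex_of_real (1 / (2 * pi)) *
     (LINT t:{0..2 * pi}|lebesgue. complex_of_real (p (t - \<theta>)) * \<psi> V t r))"

text \<open>
  The angular coordinate of the cylinder is represented by all its real lifts;
  \<open>\<Phi> V p\<close> is \<open>2\<pi>\<close>-periodic in it when \<open>p\<close> is.
\<close>

definition cylinder :: "(real \<times> real) set" where
  "cylinder = UNIV \<times> {0..}"

definition resonant :: "(real \<Rightarrow> real) \<Rightarrow> (real \<Rightarrow> real) \<Rightarrow> bool" where
  "resonant V f \<longleftrightarrow>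
     (\<forall>x v. caratheodory_solution (\<lambda>t x. f t - deriv V x) x v \<longrightarrow> unbounded_solution x v)"

end

theory Submission
  imports Defs
begin

text \<open>
  Let \<open>z\<^sub>n\<close> be the state of a solution of the forced equation at time \<open>2\<pi>n\<close>. All solutions of the
  free equation return after time \<open>2\<pi>\<close>, so \<open>z\<^sub>n\<^sub>+\<^sub>1 = z\<^sub>n + \<epsilon> F(z\<^sub>n) + o(\<epsilon>)\<close> with \<open>F(z) = \<i> \<integral> p \<psi>\<^sub>z\<close>, where
  \<open>\<psi>\<^sub>z\<close> solves the linearised equation along the free orbit through \<open>z\<close>. Moving the origin of time to a
  turning point of that orbit turns \<open>F(z)\<close> into a value of \<open>\<Phi>\<close>, up to an invertible linear map with
  uniform bounds, hence \<open>|F|\<close> is bounded away from \<open>0\<close>. If a solution were bounded, \<open>z\<^sub>n\<close> would nearly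
  return, and joining the points \<open>z\<^sub>n\<close> by segments would give a closed curve that is everywhere almost
  tangent to the continuous nonvanishing field \<open>F\<close> on the plane. A simple subloop has nonzero turning
  number, whereas \<open>F\<close> has a continuous argument on the whole plane, a contradiction.

  The error \<open>o(\<epsilon>)\<close> and the modulus of continuity of \<open>F\<close> must be uniform in \<open>z\<close>, although \<open>V''\<close> is only
  bounded and continuous. On fast orbits the remainder of the linearisation is therefore estimated
  after an integration by parts in time, which only uses that \<open>V'\<close> is Lipschitz.
\<close>


subsection \<open>Planar curves following a nonvanishing field\<close>

text \<open>The threshold for \<epsilon> has to be fixed before the solution, hence before any
  region that might contain it, so compactness of that region cannot enter and every modulus below
  is global. The obstacle is that \<open>V'(x + w) - V'(x) - V''(x) w\<close> is not
  \<open>o(w)\<close> uniformly in \<open>x\<close>. Along a free orbit \<open>X\<close>, however,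
  its product with \<open>X'\<close> is the time derivative of the corresponding remainder of
  \<open>V\<close>, up to terms quadratic in \<open>w\<close> and \<open>w'\<close>; and on a fast
  orbit \<open>X'\<close> is small compared with the speed only for a short time. Slow orbits stay
  in one compact set, where \<open>V''\<close> is uniformly continuous. The same obstacle reverses a
  familiar order: continuity of \<psi> in the initial state is not read off from its equation but
  from the linearisation of the flow, whose error is uniform in the base point. As \<open>p\<close>
  is only integrable, the velocity is replaced by \<open>x' - \<epsilon> q\<close> with
  \<open>q\<close> a primitive of \<open>p\<close>. The turning number is studied on polygons, since
  the Poincare map yields only a discrete pseudo-orbit.\<close>

text \<open>
  As in Hopf's Umlaufsatz, the secant map is extended to the triangle \<open>0 \<le> s \<le> t \<le> T\<close>, corrected
  near the diagonal and near the corner \<open>(0, T)\<close>, where secants degenerate. It is antisymmetric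
  between the two legs of the triangle, so it makes an odd number of turns along them; along the
  diagonal it equals the field.
\<close>

lemma tangential_curve_no_simple_loop:
  fixes \<gamma> :: "real \<Rightarrow> complex" and G :: "complex \<Rightarrow> complex"
  assumes contG: "continuous_on UNIV G" and contg: "continuous_on {0..T} \<gamma>"
    and "c > 0" and low: "\<And>z. c \<le> norm (G z)" and "T \<ge> 1"
    and tang: "\<And>s t. \<lbrakk>0 \<le> s; s \<le> t; t \<le> T; t - s \<le> 1\<rbrakk>
      \<Longrightarrow> norm (\<gamma> t - \<gamma> s - (t - s) *\<^sub>R G (\<gamma> s)) \<le> (t - s) * (c / 4)"
    and osc: "\<And>s t. \<lbrakk>0 \<le> s; s \<le> T; 0 \<le> t; t \<le> T; \<bar>t - s\<bar> \<le> 1\<rbrakk> \<Longrightarrow> norm (G (\<gamma> t) - G (\<gamma> s)) \<le> c / 4"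
    and closed: "\<gamma> 0 = \<gamma> T"
    and simple: "\<And>s t. \<lbrakk>0 \<le> s; s < t; t \<le> T; \<gamma> s = \<gamma> t\<rbrakk> \<Longrightarrow> s = 0 \<and> t = T"
  shows False
proof -
  \<comment> \<open>The base point is \<open>s\<close> on the diagonal, \<open>0\<close> on the leg
    \<open>s = 0\<close> and, for \<open>s > 0\<close>, \<open>T\<close> on the leg
    \<open>t = T\<close>, so both legs see the same vector \<open>G (\<gamma> 0)\<close>. At the
    corner \<open>(0, T)\<close> the quotient is \<open>0 / 0 = 0\<close>.\<close>
  define N where "N s t = G (\<gamma> (s * T / (T - (t - s))))" for s t
  \<comment> \<open>For \<open>t - s \<le> 1/2\<close> the first two terms add up to about
    \<open>(1 - (t - s)) G\<close>, and near the corner the last two to about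
    \<open>- (1 - (T - (t - s))) G\<close>. Since \<open>T \<ge> 1\<close>, the two cutoffs are
    never positive together.\<close>
  define S where "S s t = max 0 (1 - 2 * (t - s)) *\<^sub>R N s t + (\<gamma> t - \<gamma> s)
    - max 0 (1 - 2 * (T - (t - s))) *\<^sub>R G (\<gamma> 0)" for s t
  define Tri where "Tri = {(s, t). 0 \<le> s \<and> s \<le> t \<and> t \<le> T}"
  \<comment> \<open>The bound on the oscillation lets the field be taken at any point of the arc, at
    the price of another \<open>c / 4\<close>.\<close>
  have tang': "norm (\<gamma> t - \<gamma> s - (t - s) *\<^sub>R G (\<gamma> u)) \<le> (t - s) * (c / 2)"
    if "0 \<le> s" "s \<le> t" "t \<le> T" "t - s \<le> 1" "s \<le> u" "u \<le> t" for s t u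
  proof -
    have "norm ((t - s) *\<^sub>R (G (\<gamma> s) - G (\<gamma> u))) \<le> (t - s) * (c / 4)"
      unfolding norm_scaleR using that osc[of u s] by (intro mult_mono) auto
    moreover have "\<gamma> t - \<gamma> s - (t - s) *\<^sub>R G (\<gamma> u) =
      (\<gamma> t - \<gamma> s - (t - s) *\<^sub>R G (\<gamma> s)) + (t - s) *\<^sub>R (G (\<gamma> s) - G (\<gamma> u))"
      by (simp add: algebra_simps)
    ultimately show ?thesis
      using tang[of s t] that norm_triangle_ineq[of "\<gamma> t - \<gamma> s - (t - s) *\<^sub>R G (\<gamma> s)" "(t - s) *\<^sub>R (G (\<gamma> s) - G (\<gamma> u))"]
      by (simp add: field_simps)
  qed
  have between: "s \<le> s * T / (T - (t - s))" "s * T / (T - (t - s)) \<le> t"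
    if "0 \<le> s" "s \<le> t" "t \<le> T" "t - s \<le> 1 / 2" for s t
  proof -
    have pos: "T - (t - s) > 0" using that \<open>T \<ge> 1\<close> by linarith
    have "s * (T - (t - s)) \<le> s * T" using that by (intro mult_left_mono) auto
    then show "s \<le> s * T / (T - (t - s))" using pos by (simp add: le_divide_eq)
    have "(t - s) * t \<le> (t - s) * T" using that by (intro mult_left_mono) auto
    then have "s * T \<le> t * (T - (t - s))" by (simp add: algebra_simps)
    then show "s * T / (T - (t - s)) \<le> t" using pos by (simp add: divide_le_eq)
  qed
  have nz: "S s t \<noteq> 0" if st: "0 \<le> s" "s \<le> t" "t \<le> T" for s t
  proof -
    consider "t - s \<le> 1 / 2" | "t - s > 1 / 2" "T - (t - s) \<ge> 1 / 2" | "T - (t - s) < 1 / 2" by linarith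
    then show ?thesis
    proof cases
      case 1
      define u where "u = s * T / (T - (t - s))"
      define r where "r = \<gamma> t - \<gamma> s - (t - s) *\<^sub>R G (\<gamma> u)"
      have u: "s \<le> u" "u \<le> t" using between[OF st 1] by (auto simp: u_def)
      have r: "norm r \<le> (t - s) * (c / 2)" unfolding r_def using tang'[of s t u] u st 1 by simp
      have "S s t = (1 - (t - s)) *\<^sub>R G (\<gamma> u) + r"
      proof -
        have "N s t = G (\<gamma> u)" by (simp add: N_def u_def)
        then show ?thesis using 1 \<open>T \<ge> 1\<close> by (simp add: S_def r_def scaleR_conv_of_real algebra_simps)
      qed
      moreover have "norm ((1 - (t - s)) *\<^sub>R G (\<gamma> u)) \<ge> (1 / 2) * c"
        unfolding norm_scaleR using 1 st low[of "\<gamma> u"] \<open>c > 0\<close> by (intro mult_mono) auto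
      moreover have "(t - s) * (c / 2) \<le> (1 / 2) * (c / 2)" using 1 \<open>c > 0\<close> by (intro mult_right_mono) auto
      ultimately have "0 < norm (S s t)"
        using r \<open>c > 0\<close> norm_diff_ineq[of "(1 - (t - s)) *\<^sub>R G (\<gamma> u)" r]
        by (simp only:)
      then show ?thesis by simp
    next
      \<comment> \<open>Both cutoffs vanish and the bare secant is left; this is where simplicity of
        the loop enters.\<close>
      case 2
      then have "S s t = \<gamma> t - \<gamma> s" by (simp add: S_def)
      moreover have "\<gamma> s \<noteq> \<gamma> t" using simple[of s t] 2 st by auto
      ultimately show ?thesis by simp
    next
      case 3
      \<comment> \<open>The secant is traversed backwards through the common endpoint: from
        \<open>t\<close> to \<open>T\<close>, then from \<open>0\<close> to
        \<open>s\<close>.\<close>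
      define r1 r2 where "r1 = \<gamma> s - \<gamma> 0 - (s - 0) *\<^sub>R G (\<gamma> 0)"
        and "r2 = \<gamma> T - \<gamma> t - (T - t) *\<^sub>R G (\<gamma> T)"
      have r1: "norm r1 \<le> (s - 0) * (c / 2)" unfolding r1_def using tang'[of 0 s 0] st 3 by simp
      have r2: "norm r2 \<le> (T - t) * (c / 2)" unfolding r2_def using tang'[of t T T] st 3 by simp
      have "S s t = - ((1 - (s + (T - t))) *\<^sub>R G (\<gamma> 0) + (r1 + r2))"
        using 3 \<open>T \<ge> 1\<close> closed by (simp add: S_def r1_def r2_def scaleR_conv_of_real algebra_simps)
      moreover have "norm ((1 - (s + (T - t))) *\<^sub>R G (\<gamma> 0)) \<ge> (1 / 2) * c"
        unfolding norm_scaleR using 3 st low[of "\<gamma> 0"] \<open>c > 0\<close> by (intro mult_mono) auto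
      moreover have "norm (r1 + r2) \<le> (s + (T - t)) * (c / 2)"
        using r1 r2 norm_triangle_ineq[of r1 r2] by (simp add: algebra_simps)
      moreover have "(s + (T - t)) * (c / 2) \<le> (1 / 2) * (c / 2)" using 3 \<open>c > 0\<close> by (intro mult_right_mono) auto
      ultimately have "0 < norm (S s t)"
        using \<open>c > 0\<close> norm_diff_ineq[of "(1 - (s + (T - t))) *\<^sub>R G (\<gamma> 0)" "r1 + r2"]
        by (simp only: norm_minus_cancel)
      then show ?thesis by simp
    qed
  qed
  have contS: "continuous_on Tri (\<lambda>(s, t). S s t)"
  proof -
    have g: "continuous_on A (\<lambda>p. \<gamma> (h p))" if "continuous_on A h" "h ` A \<subseteq> {0..T}"
      for h :: "real \<times> real \<Rightarrow> real" and A
      using continuous_on_compose2[OF contg that] .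
    have G: "continuous_on A (\<lambda>p. G (k p))" if "continuous_on A k" for k :: "real \<times> real \<Rightarrow> complex" and A
      using continuous_on_compose2[OF contG that] by simp
    have gt: "continuous_on Tri (\<lambda>p. \<gamma> (snd p) - \<gamma> (fst p))"
      by (intro continuous_intros g) (auto simp: Tri_def)
    \<comment> \<open>The quotient inside \<open>N\<close> is singular at \<open>(0, T)\<close>, so
      continuity is checked on two closed pieces; on \<open>B\<close> the cutoff removes
      \<open>N\<close>.\<close>
    define A B where "A = Tri \<inter> {p. snd p - fst p \<le> 1 / 2}" and "B = Tri \<inter> {p. snd p - fst p \<ge> 1 / 2}"
    have "continuous_on A (\<lambda>p. max 0 (1 - 2 * (snd p - fst p)) *\<^sub>R N (fst p) (snd p))"
      unfolding N_def
    proof (intro continuous_intros G g)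
      show "\<forall>p\<in>A. T - (snd p - fst p) \<noteq> 0" using \<open>T \<ge> 1\<close> by (auto simp: A_def)
      show "(\<lambda>p. fst p * T / (T - (snd p - fst p))) ` A \<subseteq> {0..T}"
      proof clarify
        fix s t assume "(s, t) \<in> A"
        then show "fst (s, t) * T / (T - (snd (s, t) - fst (s, t))) \<in> {0..T}"
          using between[of s t] by (auto simp: A_def Tri_def)
      qed
    qed
    moreover have "continuous_on B (\<lambda>p. max 0 (1 - 2 * (snd p - fst p)) *\<^sub>R N (fst p) (snd p))"
      by (rule continuous_on_eq[where f = "\<lambda>p. 0"]) (auto simp: B_def)
    moreover have "closedin (top_of_set Tri) A" "closedin (top_of_set Tri) B"
      unfolding A_def B_def by (auto intro!: closedin_closed_Int closed_Collect_le continuous_intros)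
    moreover have "A \<union> B = Tri" by (auto simp: A_def B_def)
    ultimately have "continuous_on Tri (\<lambda>p. max 0 (1 - 2 * (snd p - fst p)) *\<^sub>R N (fst p) (snd p))"
      using continuous_on_Un_local[of A B "\<lambda>p. max 0 (1 - 2 * (snd p - fst p)) *\<^sub>R N (fst p) (snd p)"] by metis
    then show ?thesis unfolding S_def case_prod_unfold
      by (intro continuous_on_diff continuous_on_add gt) (auto intro!: continuous_intros gt)
  qed
  have "convex Tri"
    unfolding Tri_def convex_def by (auto intro!: add_mono mult_left_mono mult_nonneg_nonneg add_nonneg_nonneg convex_bound_le)
  then have "contractible Tri" by (rule convex_imp_contractible)
  moreover have "(case p of (s, t) \<Rightarrow> S s t) \<noteq> 0" if "p \<in> Tri" for p using that nz by (auto simp: Tri_def)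
  ultimately obtain g where contg: "continuous_on Tri g" and g: "\<And>p. p \<in> Tri \<Longrightarrow> (case p of (s, t) \<Rightarrow> S s t) = exp (g p)"
    using continuous_logarithm_on_contractible[OF contS] by metis
  have "contractible (UNIV :: complex set)" by (simp add: convex_imp_contractible)
  moreover have "G z \<noteq> 0" for z using low[of z] \<open>c > 0\<close> by auto
  ultimately obtain l where contl: "continuous_on UNIV l" and l: "\<And>z. G z = exp (l z)"
    using continuous_logarithm_on_contractible[OF contG] by (metis UNIV_I)
  \<comment> \<open>Two logarithms of one number differ by a multiple of
    \<open>2 \<pi> \<i>\<close>, so \<open>h\<close> has discrete values.\<close>
  have const: "h t = h 0" if cont: "continuous_on {0..T} h" and one: "\<And>t. t \<in> {0..T} \<Longrightarrow> exp (h t) = w" and "t \<in> {0..T}"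
    for h :: "real \<Rightarrow> complex" and w t
  proof -
    have "h constant_on {0..T}"
    proof (rule continuous_discrete_range_constant[OF connected_Icc cont])
      fix t assume "t \<in> {0..T}"
      have "2 * pi \<le> norm (h u - h t)" if u: "u \<in> {0..T}" and ne: "h u \<noteq> h t" for u
      proof -
        obtain n :: int where n: "h u = h t + (of_int (2 * n) * pi) * \<i>"
          using one[OF u] one[OF \<open>t \<in> {0..T}\<close>] exp_eq[of "h u" "h t"] by auto
        with ne have "n \<noteq> 0" by auto
        then have "1 \<le> \<bar>real_of_int n\<bar>" by linarith
        moreover have "norm (h u - h t) = 2 * \<bar>real_of_int n\<bar> * pi"
          by (simp add: n norm_mult)
        ultimately show ?thesis by simp
      qed
      then show "\<exists>e>0. \<forall>u. u \<in> {0..T} \<and> h u \<noteq> h t \<longrightarrow> e \<le> norm (h u - h t)"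
        by (intro exI[of _ "2 * pi"]) auto
    qed
    then show ?thesis using \<open>t \<in> {0..T}\<close> \<open>T \<ge> 1\<close> unfolding constant_on_def
      by (metis atLeastAtMost_iff dual_order.refl dual_order.trans zero_le_one)
  qed
  have cont_Tri: "continuous_on {0..T} (\<lambda>t. g (a t, b t))"
    if "continuous_on {0..T} a" "continuous_on {0..T} b" "\<And>t. t \<in> {0..T} \<Longrightarrow> (a t, b t) \<in> Tri" for a b
    by (rule continuous_on_compose2[OF contg continuous_on_Pair[OF that(1,2)]]) (use that(3) in blast)
  \<comment> \<open>\<open>h1\<close> compares two logarithms of the field along the diagonal, which
    shows that \<open>g\<close> agrees at \<open>(0, 0)\<close> and \<open>(T, T)\<close>. Then
    \<open>h2 T = - h2 0\<close>; constancy of \<open>h2\<close> forces \<open>h2 0 = 0\<close>,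
    although \<open>h2\<close> is a logarithm of \<open>- 1\<close>.\<close>
  define h1 h2 where "h1 t = g (t, t) - l (\<gamma> t)" and "h2 t = g (t, T) - g (0, t)" for t
  have "h1 T = h1 0"
  proof (rule const)
    show "continuous_on {0..T} h1" unfolding h1_def
      by (intro continuous_intros cont_Tri continuous_on_compose2[OF contl assms(2)]) (auto simp: Tri_def)
    show "exp (h1 t) = 1" if "t \<in> {0..T}" for t
    proof -
      have "exp (g (t, t)) = G (\<gamma> t)"
        using g[of "(t, t)"] that \<open>T \<ge> 1\<close> by (simp add: Tri_def S_def N_def)
      then show ?thesis by (simp add: h1_def exp_diff l)
    qed
  qed (use \<open>T \<ge> 1\<close> in auto)
  then have "g (T, T) = g (0, 0)" using closed by (simp add: h1_def)
  have h2: "exp (h2 t) = - 1" if t: "t \<in> {0..T}" for t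
  proof -
    have "S t T = - S 0 t"
    proof -
      \<comment> \<open>At \<open>t = 0\<close> the base point of \<open>N t T\<close> is
        \<open>0 / 0 = 0\<close> instead of \<open>T\<close>, but the cutoff vanishes there.\<close>
      have "t = 0 \<or> t > 0" using t by auto
      then have "max 0 (1 - 2 * (T - t)) *\<^sub>R N t T = max 0 (1 - 2 * (T - t)) *\<^sub>R G (\<gamma> T)"
        using \<open>T \<ge> 1\<close> by (auto simp: N_def)
      then show ?thesis using closed by (simp add: S_def N_def)
    qed
    then have "exp (g (t, T)) = - exp (g (0, t))"
      using g[of "(t, T)"] g[of "(0, t)"] t by (simp add: Tri_def)
    then show ?thesis by (simp add: h2_def exp_diff)
  qed
  have "h2 T = h2 0"
    by (rule const[OF _ h2]) (use \<open>T \<ge> 1\<close> in \<open>auto simp: h2_def Tri_def intro!: continuous_intros cont_Tri\<close>)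
  then have "h2 0 = 0" using \<open>g (T, T) = g (0, 0)\<close> by (simp add: h2_def)
  then show False using h2[of 0] \<open>T \<ge> 1\<close> by simp
qed

text \<open>A shortest loop of the curve is simple and therefore excluded by the previous lemma. It
  exists because tangency forbids self-intersections at parameter distance at most \<open>1\<close>,
  which keeps the pairs of coinciding parameters away from the diagonal and makes them a compact
  set.\<close>

lemma tangential_curve_not_closed:
  fixes \<gamma> :: "real \<Rightarrow> complex" and G :: "complex \<Rightarrow> complex"
  assumes contG: "continuous_on UNIV G" and contg: "continuous_on {a..b} \<gamma>"
    and "c > 0" and low: "\<And>z. c \<le> norm (G z)" and "a < b"
    and tang: "\<And>s t. \<lbrakk>a \<le> s; s \<le> t; t \<le> b; t - s \<le> 1\<rbrakk>
      \<Longrightarrow> norm (\<gamma> t - \<gamma> s - (t - s) *\<^sub>R G (\<gamma> s)) \<le> (t - s) * (c / 4)"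
    and osc: "\<And>s t. \<lbrakk>a \<le> s; s \<le> b; a \<le> t; t \<le> b; \<bar>t - s\<bar> \<le> 1\<rbrakk> \<Longrightarrow> norm (G (\<gamma> t) - G (\<gamma> s)) \<le> c / 4"
  shows "\<gamma> a \<noteq> \<gamma> b"
proof
  assume "\<gamma> a = \<gamma> b"
  have inj: "\<gamma> s \<noteq> \<gamma> t" if "a \<le> s" "s < t" "t \<le> b" "t - s \<le> 1" for s t
  proof
    assume "\<gamma> s = \<gamma> t"
    then have "(t - s) * norm (G (\<gamma> s)) \<le> (t - s) * (c / 4)" using tang[of s t] that by simp
    then show False using low[of "\<gamma> s"] \<open>c > 0\<close> that by (auto simp: mult_le_cancel_left)
  qed
  define K where "K = {p \<in> {a..b} \<times> {a..b}. fst p + 1 \<le> snd p \<and> \<gamma> (fst p) = \<gamma> (snd p)}"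
  have "(a, b) \<in> K" using \<open>\<gamma> a = \<gamma> b\<close> inj[of a b] \<open>a < b\<close> by (force simp: K_def)
  have "compact K"
  proof -
    have c1: "continuous_on ({a..b} \<times> {a..b}) (\<lambda>p. \<gamma> (fst p))"
      "continuous_on ({a..b} \<times> {a..b}) (\<lambda>p. \<gamma> (snd p))"
      by (intro continuous_on_compose2[OF contg] continuous_intros; auto)+
    have "closed (({a..b} \<times> {a..b}) \<inter> {p. fst p + 1 \<le> snd p})"
      by (intro closed_Int closed_Times closed_Collect_le continuous_intros closed_atLeastAtMost)
    moreover have "closed {p \<in> {a..b} \<times> {a..b}. \<gamma> (fst p) - \<gamma> (snd p) = 0}"
      by (intro continuous_closed_preimage_constant closed_Times continuous_on_diff c1 closed_atLeastAtMost)
    ultimately have "closed ((({a..b} \<times> {a..b}) \<inter> {p. fst p + 1 \<le> snd p})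
        \<inter> {p \<in> {a..b} \<times> {a..b}. \<gamma> (fst p) - \<gamma> (snd p) = 0})"
      by (rule closed_Int)
    moreover have "\<dots> = K" by (auto simp: K_def)
    moreover have "bounded K"
      by (rule bounded_subset[OF bounded_Times[OF bounded_closed_interval bounded_closed_interval]]) (auto simp: K_def)
    ultimately show ?thesis by (simp add: compact_eq_bounded_closed)
  qed
  moreover have "continuous_on K (\<lambda>p. snd p - fst p)" by (intro continuous_intros)
  ultimately obtain p where p: "p \<in> K" and min: "\<And>q. q \<in> K \<Longrightarrow> snd p - fst p \<le> snd q - fst q"
    using continuous_attains_inf[of K "\<lambda>p. snd p - fst p"] \<open>(a, b) \<in> K\<close> by blast
  obtain s0 t0 where p_eq: "p = (s0, t0)" by force
  have st: "a \<le> s0" "t0 \<le> b" "1 \<le> t0 - s0" "\<gamma> s0 = \<gamma> t0" using p by (auto simp: K_def p_eq)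
  show False
  proof (rule tangential_curve_no_simple_loop[of G "t0 - s0" "\<lambda>t. \<gamma> (s0 + t)" c])
    show "continuous_on {0..t0 - s0} (\<lambda>t. \<gamma> (s0 + t))"
      by (rule continuous_on_compose2[OF contg]) (use st in \<open>auto intro!: continuous_intros\<close>)
    show "norm (\<gamma> (s0 + t) - \<gamma> (s0 + s) - (t - s) *\<^sub>R G (\<gamma> (s0 + s))) \<le> (t - s) * (c / 4)"
      if "0 \<le> s" "s \<le> t" "t \<le> t0 - s0" "t - s \<le> 1" for s t
      using tang[of "s0 + s" "s0 + t"] that st by simp
    show "norm (G (\<gamma> (s0 + t)) - G (\<gamma> (s0 + s))) \<le> c / 4"
      if "0 \<le> s" "s \<le> t0 - s0" "0 \<le> t" "t \<le> t0 - s0" "\<bar>t - s\<bar> \<le> 1" for s t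
      using osc[of "s0 + s" "s0 + t"] that st by simp
    show "s = 0 \<and> t = t0 - s0" if "0 \<le> s" "s < t" "t \<le> t0 - s0" "\<gamma> (s0 + s) = \<gamma> (s0 + t)" for s t
    proof -
      have "1 < t - s" using inj[of "s0 + s" "s0 + t"] that st by fastforce
      then have "(s0 + s, s0 + t) \<in> K" using that st by (simp add: K_def)
      from min[OF this] that show ?thesis by (simp add: p_eq)
    qed
  qed (use contG \<open>c > 0\<close> low st in auto)
qed

text \<open>The tolerance \<open>c / 4\<close> of the continuous version is spent half on the step
  error and half on the oscillation of \<open>G\<close> along an edge. The hypothesis
  \<open>M + c \<le> d\<close> makes edges short enough for that oscillation to be
  controlled.\<close>

lemma near_field_polygon_not_closed:
  fixes G :: "complex \<Rightarrow> complex" and w :: "nat \<Rightarrow> complex"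
  assumes contG: "continuous_on UNIV G" and "c > 0" and low: "\<And>z. c \<le> norm (G z)"
    and up: "\<And>z. norm (G z) \<le> M" and "M + c \<le> d"
    and osc: "\<And>z z'. norm (z' - z) \<le> d \<Longrightarrow> norm (G z' - G z) \<le> c / 8"
    and step: "\<And>i. i < N \<Longrightarrow> norm (w (Suc i) - w i - G (w i)) \<le> c / 8"
    and "N > 0"
  shows "w N \<noteq> w 0"
proof -
  define clamp where "clamp x = max 0 (min 1 x)" for x :: real
  define \<Delta> where "\<Delta> i = w (Suc i) - w i" for i
  define \<gamma> where "\<gamma> t = w 0 + (\<Sum>i<N. clamp (t - real i) *\<^sub>R \<Delta> i)" for t
  \<comment> \<open>For \<open>s \<le> t\<close> this is the length of the part of
    \<open>[s, t]\<close> inside \<open>[i, i + 1]\<close>, so an increment of the curve is a sum of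
    edges with total weight \<open>t - s\<close>.\<close>
  define wt where "wt s t i = clamp (t - real i) - clamp (s - real i)" for s t and i :: nat
  have clamp_sum: "(\<Sum>i<n. clamp (t - real i)) = t" if "0 \<le> t" "t \<le> real n" for t n
    using that
  proof (induction n)
    case (Suc n)
    show ?case
    proof (cases "t \<le> real n")
      case True
      then show ?thesis using Suc by (simp add: clamp_def)
    next
      case False
      then have "(\<Sum>i<n. clamp (t - real i)) = (\<Sum>i<n. 1)"
        by (intro sum.cong) (auto simp: clamp_def)
      then show ?thesis using False Suc.prems by (simp add: clamp_def)
    qed
  qed simp
  have diff: "\<gamma> t - \<gamma> s = (\<Sum>i<N. wt s t i *\<^sub>R \<Delta> i)" for s t
    by (simp add: \<gamma>_def wt_def sum_subtractf scaleR_diff_left)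
  have wt_nonneg: "wt s t i \<ge> 0" if "s \<le> t" for s t i
    using that by (auto simp: wt_def clamp_def)
  have wt_sum: "(\<Sum>i<N. wt s t i) = t - s" if "0 \<le> s" "s \<le> t" "t \<le> real N" for s t
    using that clamp_sum[of s N] clamp_sum[of t N] by (simp add: wt_def sum_subtractf)
  have \<gamma>_nat: "\<gamma> (real i) = w i" if "i \<le> N" for i
  proof -
    have "(\<Sum>j<N. clamp (real i - real j) *\<^sub>R \<Delta> j) = (\<Sum>j<i. \<Delta> j)"
      using that by (intro sum.mono_neutral_cong_right) (auto simp: clamp_def)
    then show ?thesis by (simp add: \<gamma>_def \<Delta>_def sum_lessThan_telescope)
  qed
  have \<Delta>_le: "norm (\<Delta> i) \<le> M + c" if "i < N" for i
  proof -
    have "norm (\<Delta> i) \<le> norm (G (w i)) + norm (w (Suc i) - w i - G (w i))"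
      using norm_triangle_ineq[of "G (w i)" "w (Suc i) - w i - G (w i)"] by (simp add: \<Delta>_def)
    then show ?thesis using step[OF that] up[of "w i"] \<open>c > 0\<close> by linarith
  qed
  have sum_le: "norm (\<Sum>i<N. wt s t i *\<^sub>R b i) \<le> (t - s) * B"
    if st: "0 \<le> s" "s \<le> t" "t \<le> real N" and b: "\<And>i. i < N \<Longrightarrow> wt s t i \<noteq> 0 \<Longrightarrow> norm (b i) \<le> B"
    for s t B and b :: "nat \<Rightarrow> complex"
  proof -
    have "norm (\<Sum>i<N. wt s t i *\<^sub>R b i) \<le> (\<Sum>i<N. wt s t i * B)"
    proof (rule sum_norm_le)
      fix i assume "i \<in> {..<N}"
      then show "norm (wt s t i *\<^sub>R b i) \<le> wt s t i * B"
        using b[of i] wt_nonneg[OF st(2), of i] by (cases "wt s t i = 0") (auto intro: mult_left_mono)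
    qed
    also have "\<dots> = (t - s) * B" using wt_sum[OF st] by (simp add: sum_distrib_right[symmetric])
    finally show ?thesis .
  qed
  have lip: "norm (\<gamma> t - \<gamma> s) \<le> (t - s) * (M + c)" if "0 \<le> s" "s \<le> t" "t \<le> real N" for s t
    unfolding diff using that \<Delta>_le by (intro sum_le) auto
  have near: "norm (\<gamma> t - \<gamma> s) \<le> d" if "0 \<le> s" "s \<le> real N" "0 \<le> t" "t \<le> real N" "\<bar>t - s\<bar> \<le> 1" for s t
  proof -
    have "M \<ge> 0" using up[of 0] norm_ge_zero order_trans by blast
    have *: "norm (\<gamma> t - \<gamma> s) \<le> d" if "0 \<le> s" "s \<le> t" "t \<le> real N" "t - s \<le> 1" for s t
    proof -
      have "(t - s) * (M + c) \<le> 1 * (M + c)" using that \<open>M \<ge> 0\<close> \<open>c > 0\<close> by (intro mult_right_mono) auto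
      then have "norm (\<gamma> t - \<gamma> s) \<le> 1 * (M + c)" by (rule order.trans[OF lip[OF that(1-3)]])
      then show ?thesis using \<open>M + c \<le> d\<close> by simp
    qed
    show ?thesis using *[of s t] *[of t s] that by (cases "s \<le> t") (auto simp: norm_minus_commute)
  qed
  have "\<gamma> 0 \<noteq> \<gamma> (real N)"
  proof (rule tangential_curve_not_closed[OF contG _ \<open>c > 0\<close> low])
    show "continuous_on {0..real N} \<gamma>"
      unfolding \<gamma>_def clamp_def by (intro continuous_intros)
    show "norm (G (\<gamma> t) - G (\<gamma> s)) \<le> c / 4"
      if "0 \<le> s" "s \<le> real N" "0 \<le> t" "t \<le> real N" "\<bar>t - s\<bar> \<le> 1" for s t
      using osc[OF near[OF that]] \<open>c > 0\<close> by linarith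
    show "norm (\<gamma> t - \<gamma> s - (t - s) *\<^sub>R G (\<gamma> s)) \<le> (t - s) * (c / 4)"
      if st: "0 \<le> s" "s \<le> t" "t \<le> real N" "t - s \<le> 1" for s t
    proof -
      have "\<gamma> t - \<gamma> s - (t - s) *\<^sub>R G (\<gamma> s) = (\<Sum>i<N. wt s t i *\<^sub>R (\<Delta> i - G (\<gamma> s)))"
        unfolding diff wt_sum[OF st(1-3), symmetric] by (simp add: scaleR_diff_right sum_subtractf scaleR_sum_left)
      also have "norm \<dots> \<le> (t - s) * (c / 4)"
      proof (rule sum_le[OF st(1-3)])
        fix i assume "i < N" "wt s t i \<noteq> 0"
        \<comment> \<open>An edge that meets \<open>[s, t]\<close> starts within parameter distance
          \<open>1\<close> of \<open>s\<close>, because \<open>t - s \<le> 1\<close>.\<close>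
        then have "\<bar>real i - s\<bar> \<le> 1" using st(2,4)
          by (auto simp: wt_def clamp_def max_def min_def split: if_splits)
        then have "norm (G (w i) - G (\<gamma> s)) \<le> c / 8"
          using osc[OF near[of s "real i"]] st \<open>i < N\<close> \<gamma>_nat[of i] by simp
        moreover have "\<Delta> i - G (\<gamma> s) = (w (Suc i) - w i - G (w i)) + (G (w i) - G (\<gamma> s))"
          by (simp add: \<Delta>_def)
        then have "norm (\<Delta> i - G (\<gamma> s)) \<le> norm (w (Suc i) - w i - G (w i)) + norm (G (w i) - G (\<gamma> s))"
          by (simp only: norm_triangle_ineq)
        ultimately show "norm (\<Delta> i - G (\<gamma> s)) \<le> c / 4"
          using step[OF \<open>i < N\<close>] by linarith
      qed
      finally show ?thesis .
    qed
  qed (use \<open>N > 0\<close> in auto)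
  then show ?thesis using \<gamma>_nat[of 0] \<gamma>_nat[of N] by simp
qed

text \<open>A bounded pseudo-orbit nearly returns, and moving its last point closes the polygon.\<close>

lemma near_field_orbit_unbounded:
  fixes G :: "complex \<Rightarrow> complex" and z :: "nat \<Rightarrow> complex"
  assumes contG: "continuous_on UNIV G" and "c > 0" and low: "\<And>z. c \<le> norm (G z)"
    and up: "\<And>z. norm (G z) \<le> M" and "M + c \<le> d"
    and osc: "\<And>z z'. norm (z' - z) \<le> d \<Longrightarrow> norm (G z' - G z) \<le> c / 8"
    and step: "\<And>i. norm (z (Suc i) - z i - G (z i)) \<le> c / 16"
  shows "\<not> bounded (range z)"
proof
  assume "bounded (range z)"
  then obtain l r where r: "strict_mono r" "(z \<circ> r) \<longlonglongrightarrow> l"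
    using bounded_imp_convergent_subsequence by blast
  then have "Cauchy (z \<circ> r)" by (simp add: LIMSEQ_imp_Cauchy)
  then obtain K where K: "\<And>m n. m \<ge> K \<Longrightarrow> n \<ge> K \<Longrightarrow> norm (z (r m) - z (r n)) < c / 16"
    using \<open>c > 0\<close> unfolding Cauchy_iff o_def by (meson divide_pos_pos zero_less_numeral)
  define n m where "n = r K" and "m = r (Suc K)"
  have "n < m" using r(1) by (simp add: n_def m_def strict_mono_Suc_iff)
  have close: "norm (z n - z m) \<le> c / 16" using K[of K "Suc K"] by (simp add: n_def m_def)
  \<comment> \<open>Replacing \<open>z m\<close> by the nearby point \<open>z n\<close> adds at most
    \<open>c / 16\<close> to the error of the last step, hence the \<open>c / 8\<close> in the lemma
    on polygons.\<close>
  define w where "w i = (if i < m - n then z (n + i) else z n)" for i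
  have "w (m - n) \<noteq> w 0"
  proof (rule near_field_polygon_not_closed[OF contG \<open>c > 0\<close> low up \<open>M + c \<le> d\<close> osc])
    fix i assume i: "i < m - n"
    show "norm (w (Suc i) - w i - G (w i)) \<le> c / 8"
    proof (cases "Suc i < m - n")
      case True
      then show ?thesis using step[of "n + i"] \<open>c > 0\<close> by (simp add: w_def)
    next
      case False
      then have "Suc (n + i) = m" using i by simp
      then have "w (Suc i) - w i - G (w i) = (z (Suc (n + i)) - z (n + i) - G (z (n + i))) + (z n - z m)"
        using False i by (simp add: w_def)
      then have "norm (w (Suc i) - w i - G (w i)) \<le> norm (z (Suc (n + i)) - z (n + i) - G (z (n + i))) + norm (z n - z m)"
        by (simp only: norm_triangle_ineq)
      then show ?thesis using step[of "n + i"] close by linarith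
    qed
  qed (use \<open>n < m\<close> in auto)
  then show False using \<open>n < m\<close> by (simp add: w_def)
qed

subsection \<open>Ordinary differential equations\<close>

lemma norm_diff_le_of_deriv_le:
  fixes h :: "real \<Rightarrow> 'a::real_normed_vector"
  assumes "a \<le> b"
    and "\<And>t. t \<in> {a..b} \<Longrightarrow> (h has_vector_derivative h' t) (at t)"
    and "\<And>t. t \<in> {a..b} \<Longrightarrow> (k has_real_derivative k' t) (at t)"
    and "\<And>t. t \<in> {a..b} \<Longrightarrow> norm (h' t) \<le> k' t"
  shows "norm (h b - h a) \<le> k b - k a"
proof (cases "a = b")
  case False
  show ?thesis
  proof (rule differentiable_bound_general[where f' = h' and \<phi>' = k'])
    show "continuous_on {a..b} h"
      using assms(2) by (intro continuous_on_vector_derivative[where f' = h']) (rule has_vector_derivative_at_within)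
    show "continuous_on {a..b} k"
      using assms(3) by (intro DERIV_continuous_on[where D = k']) (rule has_field_derivative_at_within)
  qed (use False assms in \<open>auto simp: has_real_derivative_iff_has_vector_derivative\<close>)
qed simp

lemma continuous_antiderivative:
  fixes f :: "real \<Rightarrow> 'a::banach"
  assumes "continuous_on UNIV f"
  shows "\<exists>g. g 0 = 0 \<and> (\<forall>t. (g has_vector_derivative f t) (at t))"
proof -
  \<comment> \<open>For either sign of \<open>t\<close> one of the two intervals is empty or a point
    and contributes \<open>0\<close>.\<close>
  define g where "g = (\<lambda>t. integral {0..t} f - integral {t..0} f)"
  have "g 0 = 0" by (simp add: g_def)
  moreover have "(g has_vector_derivative f t) (at t)" for t
  proof -
    define a b :: real where "a = - \<bar>t\<bar> - 1" and "b = \<bar>t\<bar> + 1"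
    have g: "g u = integral {a..u} f - integral {a..0} f" if "u \<in> {a<..<b}" for u
    proof (cases "u \<ge> 0")
      case True
      then have "integral {a..0} f + integral {0..u} f = integral {a..u} f"
        by (intro Henstock_Kurzweil_Integration.integral_combine integrable_continuous_real
            continuous_on_subset[OF assms]) (auto simp: a_def)
      then show ?thesis using True by (cases "u = 0") (auto simp: g_def algebra_simps)
    next
      case False
      then have "integral {a..u} f + integral {u..0} f = integral {a..0} f"
        using that by (intro Henstock_Kurzweil_Integration.integral_combine integrable_continuous_real
            continuous_on_subset[OF assms]) (auto simp: a_def)
      then show ?thesis using False by (auto simp: g_def algebra_simps)
    qed
    have "((\<lambda>u. integral {a..u} f) has_vector_derivative f t) (at t within {a..b})"
      by (rule integral_has_vector_derivative) (auto intro: continuous_on_subset[OF assms] simp: a_def b_def)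
    then have "((\<lambda>u. integral {a..u} f) has_vector_derivative f t) (at t)"
      by (subst (asm) at_within_interior) (auto simp: a_def b_def)
    then have "((\<lambda>u. integral {a..u} f - integral {a..0} f) has_vector_derivative f t) (at t)"
      by (auto intro!: derivative_eq_intros)
    then show "(g has_vector_derivative f t) (at t)"
      by (rule has_vector_derivative_transform_within_open[where S = "{a<..<b}"])
        (auto simp: g a_def b_def)
  qed
  ultimately show ?thesis by blast
qed

lemma has_vector_derivative_reflect:
  assumes "(g has_vector_derivative D) (at (- t))"
  shows "((\<lambda>t. g (- t)) has_vector_derivative - D) (at t)"
proof -
  have "(uminus has_vector_derivative (-1::real)) (at t)"
    by (auto intro!: derivative_eq_intros)
  from vector_diff_chain_at[OF this assms] show ?thesis by (simp add: o_def)
qed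

text \<open>The weight \<open>exp (l * \<bar>t\<bar>)\<close> turns integration into multiplication
  by \<open>1 / l\<close>; with \<open>l = 2 * L\<close>, Picard iteration gains a factor
  \<open>1 / 2\<close> on the whole line.\<close>

lemma antiderivative_exp_bound:
  fixes g :: "real \<Rightarrow> 'a::real_normed_vector"
  assumes g: "\<And>t. (g has_vector_derivative h t) (at t)" and "g 0 = 0"
    and h: "\<And>t. norm (h t) \<le> C * exp (l * \<bar>t\<bar>)" and "l > 0" "C \<ge> 0"
  shows "norm (g t) \<le> C / l * exp (l * \<bar>t\<bar>)"
proof -
  have pos: "norm (g t) \<le> C / l * exp (l * t)"
    if g: "\<And>t. (g has_vector_derivative h t) (at t)" and "g 0 = 0"
    and h: "\<And>t. norm (h t) \<le> C * exp (l * \<bar>t\<bar>)" and "t \<ge> 0"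
    for g h :: "real \<Rightarrow> 'a" and t
  proof -
    have "norm (g t - g 0) \<le> C / l * exp (l * t) - C / l * exp (l * 0)"
    proof (rule norm_diff_le_of_deriv_le[OF \<open>t \<ge> 0\<close>])
      show "((\<lambda>t. C / l * exp (l * t)) has_real_derivative C * exp (l * u)) (at u)" for u
        using \<open>l > 0\<close> by (auto intro!: derivative_eq_intros)
      show "norm (h u) \<le> C * exp (l * u)" if "u \<in> {0..t}" for u
        using h[of u] that by simp
    qed (rule g)
    moreover have "C / l \<ge> 0" using assms by auto
    ultimately show ?thesis using \<open>g 0 = 0\<close> by auto
  qed
  show ?thesis
  proof (cases "t \<ge> 0")
    case True then show ?thesis using pos[OF g _ h] assms by auto
  next
    case False
    have "((\<lambda>t. g (- t)) has_vector_derivative - h (- t)) (at t)" for t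
      by (rule has_vector_derivative_reflect[OF g])
    from pos[of "\<lambda>t. g (- t)" "\<lambda>t. - h (- t)", OF this, of "- t"] False h[of "- _"] assms
    show ?thesis by simp
  qed
qed

lemma continuous_on_vector_derivative_UNIV:
  "(\<And>t. (g has_vector_derivative h t) (at t)) \<Longrightarrow> continuous_on UNIV g"
  by (rule continuous_on_vector_derivative[where f' = h]) (rule has_vector_derivative_at_within)

text \<open>Picard iteration converges geometrically in the weighted norm \<open>sup |y t| exp (- 2 L |t|)\<close>.\<close>

lemma picard_lindelof_global:
  fixes G :: "real \<Rightarrow> 'a::banach \<Rightarrow> 'a" and y0 :: 'a
  assumes cont: "continuous_on UNIV (\<lambda>(t, y). G t y)"
    and lip: "\<And>t y z. norm (G t y - G t z) \<le> L * norm (y - z)"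
    and zero: "\<And>t. G t 0 = 0" and "L > 0"
  shows "\<exists>y. y 0 = y0 \<and> (\<forall>t. (y has_vector_derivative G t (y t)) (at t))"
proof -
  have contG: "continuous_on UNIV (\<lambda>t. G t (y t))" if "continuous_on UNIV y" for y
  proof -
    have 1: "continuous_on UNIV (\<lambda>t. (t, y t))" using that by (intro continuous_on_Pair continuous_on_id)
    have "continuous_on UNIV ((\<lambda>(t, y). G t y) \<circ> (\<lambda>t. (t, y t)))"
      by (rule continuous_on_compose[OF 1 continuous_on_subset[OF cont]]) auto
    then show ?thesis by (simp add: o_def)
  qed
  define J where "J f = (SOME g. g 0 = 0 \<and> (\<forall>t. (g has_vector_derivative f t) (at t)))"
    for f :: "real \<Rightarrow> 'a"
  have J: "J f 0 = 0 \<and> (\<forall>t. (J f has_vector_derivative f t) (at t))" if "continuous_on UNIV f" for f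
    using someI_ex[OF continuous_antiderivative[OF that]] unfolding J_def .
  define y where "y = rec_nat (\<lambda>t::real. y0) (\<lambda>n y t. y0 + J (\<lambda>s. G s (y s)) t)"
  have y_0: "y 0 = (\<lambda>t. y0)" and y_Suc: "y (Suc n) = (\<lambda>t. y0 + J (\<lambda>s. G s (y n s)) t)" for n
    by (auto simp: y_def)
  have y_cont: "continuous_on UNIV (y n)" for n
  proof (induction n)
    case (Suc n)
    then show ?case unfolding y_Suc
      by (intro continuous_intros continuous_on_vector_derivative_UNIV) (use J[OF contG] in blast)
  qed (simp add: y_0)
  note JG = J[OF contG[OF y_cont]]
  have y_init: "y n 0 = y0" for n by (cases n) (use JG in \<open>auto simp: y_0 y_Suc\<close>)
  have y_deriv: "(y (Suc n) has_vector_derivative G t (y n t)) (at t)" for n t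
    unfolding y_Suc using JG[of n] by (auto intro!: derivative_eq_intros)
  have step: "norm (y (Suc n) t - y n t) \<le> (norm y0 / 2) * (1 / 2) ^ n * exp (2 * L * \<bar>t\<bar>)" for n t
  proof (induction n arbitrary: t)
    case 0
    have "norm (G t y0) \<le> L * norm y0 * exp (2 * L * \<bar>t\<bar>)" for t
    proof -
      have "norm (G t y0) \<le> L * norm y0 * 1" using lip[of t y0 0] zero by simp
      also have "\<dots> \<le> L * norm y0 * exp (2 * L * \<bar>t\<bar>)" using \<open>L > 0\<close> by (intro mult_left_mono) auto
      finally show ?thesis .
    qed
    moreover have "((\<lambda>t. y (Suc 0) t - y0) has_vector_derivative G t y0) (at t)" for t
      using has_vector_derivative_diff[OF y_deriv[of 0] has_vector_derivative_const] by (simp add: y_0)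
    ultimately have "norm (y (Suc 0) t - y0) \<le> L * norm y0 / (2 * L) * exp (2 * L * \<bar>t\<bar>)"
      using \<open>L > 0\<close> by (intro antiderivative_exp_bound[where h = "\<lambda>t. G t y0"]) (simp_all add: y_init)
    then show ?case using \<open>L > 0\<close> by (simp add: y_0)
  next
    case (Suc n)
    let ?C = "(norm y0 / 2) * (1 / 2) ^ n"
    have "norm (G t (y (Suc n) t) - G t (y n t)) \<le> L * ?C * exp (2 * L * \<bar>t\<bar>)" for t
    proof -
      have "L * norm (y (Suc n) t - y n t) \<le> L * (?C * exp (2 * L * \<bar>t\<bar>))"
        using Suc[of t] \<open>L > 0\<close> by (intro mult_left_mono) auto
      then show ?thesis using lip[of t "y (Suc n) t" "y n t"] by (simp only: mult.assoc)
    qed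
    then have "norm (y (Suc (Suc n)) t - y (Suc n) t) \<le> L * ?C / (2 * L) * exp (2 * L * \<bar>t\<bar>)"
      using \<open>L > 0\<close>
      by (intro antiderivative_exp_bound[where h = "\<lambda>t. G t (y (Suc n) t) - G t (y n t)"]
          has_vector_derivative_diff y_deriv) (simp_all add: y_init)
    then show ?case using \<open>L > 0\<close> by (simp add: mult_ac)
  qed
  have unif: "uniformly_convergent_on {-T..T} y" for T
  proof -
    have "uniformly_convergent_on {-T..T} (\<lambda>n t. \<Sum>i<n. y (Suc i) t - y i t)"
    proof (rule Weierstrass_m_test')
      show "summable (\<lambda>n. (norm y0 / 2) * (1 / 2) ^ n * exp (2 * L * T))"
        by (intro summable_mult2 summable_mult) (auto intro: summable_geometric)
      fix n t assume "t \<in> {-T..T}"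
      then have "exp (2 * L * \<bar>t\<bar>) \<le> exp (2 * L * T)" using \<open>L > 0\<close> by auto
      then show "norm (y (Suc n) t - y n t) \<le> (norm y0 / 2) * (1 / 2) ^ n * exp (2 * L * T)"
        by (intro order.trans[OF step] mult_left_mono) auto
    qed
    then obtain l where "uniform_limit {-T..T} (\<lambda>n t. \<Sum>i<n. y (Suc i) t - y i t) l sequentially"
      unfolding uniformly_convergent_on_def by blast
    then have "uniform_limit {-T..T} (\<lambda>n t. (\<Sum>i<n. y (Suc i) t - y i t) + y0) (\<lambda>t. l t + y0) sequentially"
      by (intro uniform_limit_add uniform_limit_const)
    then have "uniformly_convergent_on {-T..T} (\<lambda>n t. (\<Sum>i<n. y (Suc i) t - y i t) + y0)"
      unfolding uniformly_convergent_on_def by blast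
    also have "(\<lambda>n t. (\<Sum>i<n. y (Suc i) t - y i t) + y0) = y"
      by (auto simp: fun_eq_iff y_0 sum_lessThan_telescope[of "\<lambda>i. y i _"])
    finally show ?thesis .
  qed
  define yl where "yl t = lim (\<lambda>n. y n t)" for t
  have ulim: "uniform_limit {-T..T} y yl sequentially" for T
    using unif[of T] unfolding yl_def uniformly_convergent_uniform_limit_iff .
  have lim: "(\<lambda>n. y n t) \<longlonglongrightarrow> yl t" for t
    by (rule tendsto_uniform_limitI[OF ulim[of "\<bar>t\<bar>"]]) auto
  have "yl 0 = y0" using lim[of 0] y_init by (simp add: LIMSEQ_const_iff)
  moreover have "(yl has_vector_derivative G t (yl t)) (at t)" for t
  proof -
    define T where "T = \<bar>t\<bar> + 1"
    let ?S = "{-T<..<T}"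
    \<comment> \<open>The index is shifted because the derivative of \<open>y (Suc n)\<close> is
      expressed by \<open>y n\<close>, which converges uniformly on bounded intervals.\<close>
    have "\<exists>g. \<forall>x\<in>?S. (\<lambda>n. y (Suc n) x) \<longlonglongrightarrow> g x \<and>
        (g has_derivative (\<lambda>h. h *\<^sub>R G x (yl x))) (at x within ?S)"
    proof (rule has_derivative_sequence[where f' = "\<lambda>n x h. h *\<^sub>R G x (y n x)"])
      show "((\<lambda>n. y (Suc n) 0) \<longlongrightarrow> y0) sequentially" by (simp add: y_init)
      show "\<And>n x. x \<in> ?S \<Longrightarrow> (y (Suc n) has_derivative (\<lambda>h. h *\<^sub>R G x (y n x))) (at x within ?S)"
        using y_deriv by (auto simp: has_vector_derivative_def intro: has_derivative_at_withinI)
      fix e :: real assume "e > 0"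
      then have "\<forall>\<^sub>F n in sequentially. \<forall>x\<in>{-T..T}. dist (y n x) (yl x) < e / L"
        using ulim[of T] \<open>L > 0\<close> by (intro uniform_limitD) auto
      then show "\<forall>\<^sub>F n in sequentially. \<forall>x\<in>?S. \<forall>h. norm (h *\<^sub>R G x (y n x) - h *\<^sub>R G x (yl x)) \<le> e * norm h"
      proof (eventually_elim, intro ballI allI)
        fix n x and h :: real
        assume "\<forall>x\<in>{-T..T}. dist (y n x) (yl x) < e / L" "x \<in> ?S"
        then have "L * norm (y n x - yl x) \<le> e" using \<open>L > 0\<close> by (auto simp: dist_norm field_simps intro: less_imp_le)
        then have "norm (G x (y n x) - G x (yl x)) \<le> e" using lip[of x "y n x" "yl x"] by linarith
        then show "norm (h *\<^sub>R G x (y n x) - h *\<^sub>R G x (yl x)) \<le> e * norm h"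
          by (simp flip: scaleR_diff_right) (metis abs_ge_zero mult.commute mult_left_mono)
      qed
    qed (auto simp: T_def)
    then obtain g where g: "\<And>x. x \<in> ?S \<Longrightarrow> (\<lambda>n. y (Suc n) x) \<longlonglongrightarrow> g x"
      "\<And>x. x \<in> ?S \<Longrightarrow> (g has_derivative (\<lambda>h. h *\<^sub>R G x (yl x))) (at x within ?S)" by blast
    have geq: "g x = yl x" if "x \<in> ?S" for x
      using LIMSEQ_unique[OF g(1)[OF that] LIMSEQ_Suc[OF lim]] .
    have t: "t \<in> ?S" by (auto simp: T_def)
    have "(g has_vector_derivative G t (yl t)) (at t)"
      using g(2)[OF t] at_within_open[OF t] by (simp add: has_vector_derivative_def)
    then show ?thesis
      by (rule has_vector_derivative_transform_within_open[where S = ?S]) (use t geq in auto)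
  qed
  ultimately show ?thesis by blast
qed

lemma classical_solution_exists:
  fixes F :: "real \<Rightarrow> 'a::banach \<Rightarrow> 'a"
  assumes cont: "continuous_on UNIV (\<lambda>(t, x). F t x)"
    and lip: "\<And>t x y. norm (F t x - F t y) \<le> L * norm (x - y)"
    and zero: "\<And>t. F t 0 = 0"
  shows "\<exists>x v. classical_solution F x v \<and> x 0 = x0 \<and> v 0 = v0"
proof -
  define G where "G t z = (snd z, F t (fst z))" for t and z :: "'a \<times> 'a"
  have "\<exists>y. y 0 = (x0, v0) \<and> (\<forall>t. (y has_vector_derivative G t (y t)) (at t))"
  proof (rule picard_lindelof_global)
    show "continuous_on UNIV (\<lambda>(t, z). G t z)"
    proof -
      have 1: "continuous_on UNIV (\<lambda>p::real \<times> 'a \<times> 'a. (fst p, fst (snd p)))" by (intro continuous_intros)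
      have "continuous_on UNIV ((\<lambda>(t, x). F t x) \<circ> (\<lambda>p::real \<times> 'a \<times> 'a. (fst p, fst (snd p))))"
        by (rule continuous_on_compose[OF 1 continuous_on_subset[OF cont]]) auto
      then have 2: "continuous_on UNIV (\<lambda>p::real \<times> 'a \<times> 'a. F (fst p) (fst (snd p)))" by (simp add: o_def)
      show ?thesis unfolding G_def case_prod_unfold
        by (rule continuous_on_Pair[OF continuous_on_snd[OF continuous_on_snd[OF continuous_on_id]] 2])
    qed
    show "norm (G t y - G t z) \<le> (1 + \<bar>L\<bar>) * norm (y - z)" for t y z
    proof -
      have "norm (G t y - G t z) \<le> norm (snd y - snd z) + norm (F t (fst y) - F t (fst z))"
        unfolding G_def by (simp add: norm_Pair_le)
      also have "norm (snd y - snd z) \<le> norm (y - z)"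
        by (metis norm_snd_le snd_diff surjective_pairing)
      also have "norm (F t (fst y) - F t (fst z)) \<le> \<bar>L\<bar> * norm (fst y - fst z)"
        using lip[of t "fst y" "fst z"] by (smt (verit) mult_right_mono norm_ge_zero)
      also have "\<bar>L\<bar> * norm (fst y - fst z) \<le> \<bar>L\<bar> * norm (y - z)"
        by (intro mult_left_mono) (auto, metis norm_fst_le fst_diff surjective_pairing)
      finally show ?thesis by (simp add: algebra_simps)
    qed
    show "G t 0 = 0" for t by (simp add: G_def zero zero_prod_def)
  qed auto
  then obtain y where y: "y 0 = (x0, v0)" "\<And>t. (y has_vector_derivative G t (y t)) (at t)" by blast
  have "((\<lambda>t. fst (y t)) has_vector_derivative snd (y t)) (at t)" for t
    using bounded_linear.has_vector_derivative[OF bounded_linear_fst y(2)[of t]] by (simp add: G_def)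
  moreover have "((\<lambda>t. snd (y t)) has_vector_derivative F t (fst (y t))) (at t)" for t
    using bounded_linear.has_vector_derivative[OF bounded_linear_snd y(2)[of t]] by (simp add: G_def)
  ultimately show ?thesis unfolding classical_solution_def using y(1)
    by (metis fst_conv snd_conv)
qed

text \<open>The system is \<open>w' = a + b\<close>, \<open>a' = d\<close> with \<open>b\<close>
  merely bounded, so that a forcing can enter through its primitive and is never differentiated.
  Squared norms keep the energy differentiable; the rate \<open>2 + L\<close> collects the
  contributions of \<open>2 w \<bullet> a\<close>, \<open>2 w \<bullet> b\<close> and
  \<open>2 a \<bullet> d\<close>.\<close>

lemma gronwall_forward:
  fixes w a b d :: "real \<Rightarrow> 'a::real_inner"
  assumes "s \<le> t"
    and w: "\<And>u. u \<in> {s..t} \<Longrightarrow> (w has_vector_derivative a u + b u) (at u)"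
    and a: "\<And>u. u \<in> {s..t} \<Longrightarrow> (a has_vector_derivative d u) (at u)"
    and d: "\<And>u. u \<in> {s..t} \<Longrightarrow> norm (d u) \<le> L * norm (w u)"
    and b: "\<And>u. u \<in> {s..t} \<Longrightarrow> norm (b u) \<le> \<beta>" and "L \<ge> 0"
  shows "(norm (w t))\<^sup>2 + (norm (a t))\<^sup>2
    \<le> ((norm (w s))\<^sup>2 + (norm (a s))\<^sup>2 + \<beta>\<^sup>2 * (t - s)) * exp ((2 + L) * (t - s))"
proof -
  define E where "E u = (norm (w u))\<^sup>2 + (norm (a u))\<^sup>2" for u
  define E' where "E' u = 2 * (w u \<bullet> (a u + b u)) + 2 * (a u \<bullet> d u)" for u
  have E: "(E has_real_derivative E' u) (at u)" if "u \<in> {s..t}" for u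
    unfolding E_def E'_def power2_norm_eq_inner has_field_derivative_def
    using w[OF that] a[OF that] unfolding has_vector_derivative_def
    by (auto intro!: derivative_eq_intros simp: fun_eq_iff inner_simps inner_commute algebra_simps)
  have E': "E' u \<le> (2 + L) * E u + \<beta>\<^sup>2" if "u \<in> {s..t}" for u
  proof -
    have "2 * (w u \<bullet> a u) \<le> (norm (w u))\<^sup>2 + (norm (a u))\<^sup>2"
      using norm_cauchy_schwarz[of "w u" "a u"] sum_squares_bound[of "norm (w u)" "norm (a u)"] by linarith
    moreover have "2 * (w u \<bullet> b u) \<le> (norm (w u))\<^sup>2 + (norm (b u))\<^sup>2"
      using norm_cauchy_schwarz[of "w u" "b u"] sum_squares_bound[of "norm (w u)" "norm (b u)"] by linarith
    moreover have "(norm (b u))\<^sup>2 \<le> \<beta>\<^sup>2" by (rule power_mono) (use b[OF that] in auto)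
    moreover have "2 * (a u \<bullet> d u) \<le> L * ((norm (w u))\<^sup>2 + (norm (a u))\<^sup>2)"
    proof -
      have "a u \<bullet> d u \<le> norm (a u) * (L * norm (w u))"
        using norm_cauchy_schwarz[of "a u" "d u"] mult_left_mono[OF d[OF that], of "norm (a u)"] by auto
      then have "2 * (a u \<bullet> d u) \<le> L * (2 * norm (w u) * norm (a u))" by (simp add: mult_ac)
      also have "\<dots> \<le> L * ((norm (w u))\<^sup>2 + (norm (a u))\<^sup>2)"
        using \<open>L \<ge> 0\<close> sum_squares_bound by (intro mult_left_mono)
      finally show ?thesis .
    qed
    moreover have "E' u = 2 * (w u \<bullet> a u) + 2 * (w u \<bullet> b u) + 2 * (a u \<bullet> d u)"
      by (simp add: E'_def inner_add_right)
    moreover have "(2 + L) * E u = 2 * E u + L * ((norm (w u))\<^sup>2 + (norm (a u))\<^sup>2)"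
      by (simp add: E_def algebra_simps)
    moreover have "0 \<le> (norm (a u))\<^sup>2" by simp
    ultimately show ?thesis using E_def[of u] by linarith
  qed
  define k where "k = 2 + L"
  \<comment> \<open>With the integrating factor at most \<open>1\<close>, the perturbation
    contributes at most \<open>\<beta>\<^sup>2\<close> per unit of time.\<close>
  have "E t * exp (- k * (t - s)) - \<beta>\<^sup>2 * (t - s) \<le> E s * exp (- k * (s - s)) - \<beta>\<^sup>2 * (s - s)"
  proof (rule DERIV_nonpos_imp_nonincreasing[OF \<open>s \<le> t\<close>])
    fix u assume u: "s \<le> u" "u \<le> t"
    have "((\<lambda>u. E u * exp (- k * (u - s)) - \<beta>\<^sup>2 * (u - s)) has_real_derivative
        (E' u - k * E u) * exp (- k * (u - s)) - \<beta>\<^sup>2) (at u)"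
      using E[of u] u by (auto intro!: derivative_eq_intros simp: algebra_simps)
    moreover have "(E' u - k * E u) * exp (- k * (u - s)) \<le> \<beta>\<^sup>2 * 1"
    proof (rule order.trans[OF mult_right_mono mult_left_mono])
      show "E' u - k * E u \<le> \<beta>\<^sup>2" using E'[of u] u by (simp add: k_def)
    qed (use u \<open>L \<ge> 0\<close> in \<open>auto simp: k_def intro!: mult_nonpos_nonneg\<close>)
    ultimately show "\<exists>y. ((\<lambda>u. E u * exp (- k * (u - s)) - \<beta>\<^sup>2 * (u - s)) has_real_derivative y) (at u) \<and> y \<le> 0"
      by fastforce
  qed
  then have "(E t * exp (- k * (t - s))) * exp (k * (t - s)) \<le> (E s + \<beta>\<^sup>2 * (t - s)) * exp (k * (t - s))"
    by (intro mult_right_mono) auto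
  moreover have "(E t * exp (- k * (t - s))) * exp (k * (t - s)) = E t"
    by (simp add: mult.assoc flip: exp_add)
  ultimately show ?thesis by (simp only: E_def k_def)
qed

text \<open>Reversing time and changing the sign of \<open>a\<close> preserves the form of the
  system.\<close>

lemma gronwall_both:
  fixes w a d :: "real \<Rightarrow> 'a::real_inner"
  assumes w: "\<And>u. (w has_vector_derivative a u) (at u)"
    and a: "\<And>u. (a has_vector_derivative d u) (at u)"
    and d: "\<And>u. norm (d u) \<le> L * norm (w u)" and "L \<ge> 0"
  shows "(norm (w t))\<^sup>2 + (norm (a t))\<^sup>2
    \<le> ((norm (w s))\<^sup>2 + (norm (a s))\<^sup>2) * exp ((2 + L) * \<bar>t - s\<bar>)"
proof (cases "s \<le> t")
  case True
  with gronwall_forward[OF True, of w a "\<lambda>_. 0" d L 0] assms show ?thesis by simp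
next
  case False
  have "((\<lambda>u. w (- u)) has_vector_derivative - a (- u)) (at u)"
    "((\<lambda>u. - a (- u)) has_vector_derivative d (- u)) (at u)" for u
    using has_vector_derivative_reflect[OF w, of u] has_vector_derivative_minus[OF has_vector_derivative_reflect[OF a, of u]]
    by auto
  with gronwall_forward[of "- s" "- t" "\<lambda>u. w (- u)" "\<lambda>u. - a (- u)" "\<lambda>_. 0" "\<lambda>u. d (- u)" L 0] assms False
  show ?thesis by simp
qed

lemma classical_solution_unique:
  fixes F :: "real \<Rightarrow> 'a::real_inner \<Rightarrow> 'a"
  assumes 1: "classical_solution F x v" and 2: "classical_solution F y u"
    and init: "x s = y s" "v s = u s"
    and lip: "\<And>t x y. norm (F t x - F t y) \<le> L * norm (x - y)" and "L \<ge> 0"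
  shows "x = y \<and> v = u"
proof -
  have "(norm (x t - y t))\<^sup>2 + (norm (v t - u t))\<^sup>2 \<le> 0" for t
  proof -
    have "((\<lambda>t. x t - y t) has_vector_derivative v r - u r) (at r)"
      "((\<lambda>t. v t - u t) has_vector_derivative F r (x r) - F r (y r)) (at r)" for r
      using 1 2 unfolding classical_solution_def by (auto intro!: has_vector_derivative_diff)
    from gronwall_both[OF this lip \<open>L \<ge> 0\<close>, of t s] init show ?thesis by simp
  qed
  then have "(norm (x t - y t))\<^sup>2 = 0 \<and> (norm (v t - u t))\<^sup>2 = 0" for t
    by (smt (verit) zero_le_power2)
  then show ?thesis by auto
qed

subsection \<open>Absolutely continuous functions and primitives\<close>

text \<open>
  Tags in the exceptional null set only see intervals inside an
  open set of small measure, where absolute continuity controls the increments.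
\<close>

lemma abs_continuous_fundamental_theorem:
  fixes F f :: "real \<Rightarrow> real"
  assumes "a \<le> b" and ac: "abs_continuous_on_interval a b F" and N: "negligible N"
    and deriv: "\<And>x. \<lbrakk>x \<in> {a..b}; x \<notin> N\<rbrakk> \<Longrightarrow> (F has_real_derivative f x) (at x)"
  shows "(f has_integral (F b - F a)) {a..b}"
proof -
  define f0 where "f0 x = (if x \<in> N then 0 else f x)" for x
  have "(f0 has_integral (F b - F a)) (cbox a b)"
    unfolding has_integral
  proof (intro allI impI)
    fix e :: real assume "e > 0"
    \<comment> \<open>The summand \<open>1\<close> in the denominator makes the total error over
      tags outside \<open>N\<close> strictly less than \<open>e / 2\<close>, also when
      \<open>a = b\<close>.\<close>
    define e' where "e' = e / 2 / (b - a + 1)"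
    have "e' > 0" using \<open>e > 0\<close> \<open>a \<le> b\<close> by (simp add: e'_def)
    have "\<exists>d>0. \<forall>y. \<bar>y - x\<bar> < d \<longrightarrow> \<bar>F y - F x - (y - x) * f x\<bar> \<le> e' * \<bar>y - x\<bar>"
      if "x \<in> {a..b}" "x \<notin> N" for x
      using deriv[OF that] \<open>e' > 0\<close> unfolding has_field_derivative_def has_derivative_at_alt
      by (auto simp: mult.commute)
    then obtain d where d: "\<And>x. \<lbrakk>x \<in> {a..b}; x \<notin> N\<rbrakk> \<Longrightarrow> d x > 0"
      "\<And>x y. \<lbrakk>x \<in> {a..b}; x \<notin> N; \<bar>y - x\<bar> < d x\<rbrakk> \<Longrightarrow> \<bar>F y - F x - (y - x) * f x\<bar> \<le> e' * \<bar>y - x\<bar>"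
      by metis
    obtain d0 where "d0 > 0" and d0: "\<And>D. \<lbrakk>D division_of \<Union>D; \<Union>D \<subseteq> {a..b}; (\<Sum>K\<in>D. Sup K - Inf K) < d0\<rbrakk>
        \<Longrightarrow> (\<Sum>K\<in>D. \<bar>F (Sup K) - F (Inf K)\<bar>) < e / 2"
      using ac \<open>e > 0\<close> unfolding abs_continuous_on_interval_def by (meson half_gt_zero)
    have Nl: "N \<in> sets lebesgue" "emeasure lebesgue N = 0"
      using N by (auto simp: negligible_iff_null_sets)
    obtain U where U: "open U" "N \<subseteq> U" "U - N \<in> lmeasurable" "emeasure lebesgue (U - N) < ennreal d0"
      using sets_lebesgue_outer_open[OF Nl(1) \<open>d0 > 0\<close>] by blast
    have Um: "U \<in> lmeasurable" "measure lebesgue U < d0"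
    proof -
      have "emeasure lebesgue U \<le> emeasure lebesgue (U - N) + emeasure lebesgue N"
        using emeasure_subadditive[of "U - N" lebesgue N] U Nl by (auto simp: Un_absorb2)
      then have *: "emeasure lebesgue U < ennreal d0" using U(4) Nl(2) by simp
      then have "emeasure lebesgue U < top" using ennreal_less_top order_less_trans by blast
      then show "U \<in> lmeasurable" using U(1) by (intro fmeasurableI) auto
      then show "measure lebesgue U < d0" using * \<open>d0 > 0\<close> by (simp add: emeasure_eq_measure2 ennreal_less_iff)
    qed
    define g where "g x = (if x \<in> N then U else ball x (if x \<in> {a..b} then d x else 1))" for x
    have "gauge g"
      unfolding gauge_def g_def using U d(1) by (auto simp: subset_iff)
    moreover have riemann: "norm ((\<Sum>(x, K)\<in>p. measure lborel K *\<^sub>R f0 x) - (F b - F a)) < e"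
      if p: "p tagged_division_of cbox a b" and fine: "g fine p" for p
    proof -
      have pfin: "finite p" using p by blast
      have pK: "\<exists>u v. K = {u..v} \<and> u \<le> x \<and> x \<le> v \<and> a \<le> u \<and> v \<le> b" if "(x, K) \<in> p" for x K
        using tagged_division_ofD(2-4)[OF p that] by fastforce
      have FF: "F b - F a = (\<Sum>(x, K)\<in>p. F (Sup K) - F (Inf K))"
        using additive_tagged_division_1[OF \<open>a \<le> b\<close>, of p F] p by simp
      define pN where "pN = {(x, K) \<in> p. x \<in> N}"
      define pG where "pG = {(x, K) \<in> p. x \<notin> N}"
      have split: "p = pN \<union> pG" "pN \<inter> pG = {}" "finite pN" "finite pG" "pN \<subseteq> p" "pG \<subseteq> p"
        using pfin by (auto simp: pN_def pG_def intro: finite_subset[of _ p])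
      have "\<bar>\<Sum>(x, K)\<in>pG. measure lborel K *\<^sub>R f0 x - (F (Sup K) - F (Inf K))\<bar> \<le> (\<Sum>(x, K)\<in>pG. e' * measure lborel K)"
      proof (rule order.trans[OF sum_abs], rule sum_mono, clarify)
        fix x K assume xK: "(x, K) \<in> pG"
        then have xp: "(x, K) \<in> p" and "x \<notin> N" by (auto simp: pG_def)
        obtain u v where K: "K = {u..v}" "u \<le> x" "x \<le> v" "a \<le> u" "v \<le> b" using pK[OF xp] by blast
        have x: "x \<in> {a..b}" using K by auto
        have "K \<subseteq> ball x (d x)" using fineD[OF fine xp] \<open>x \<notin> N\<close> x by (simp add: g_def)
        moreover have "u \<in> K" "v \<in> K" using K by auto
        ultimately have "\<bar>u - x\<bar> < d x" "\<bar>v - x\<bar> < d x" by (auto simp: dist_real_def abs_minus_commute)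
        then have "\<bar>F u - F x - (u - x) * f x\<bar> \<le> e' * (x - u)" "\<bar>F v - F x - (v - x) * f x\<bar> \<le> e' * (v - x)"
          using d(2)[OF x \<open>x \<notin> N\<close>, of u] d(2)[OF x \<open>x \<notin> N\<close>, of v] K by auto
        moreover have "(v - u) * f x = (v - x) * f x - (u - x) * f x"
          and "e' * (v - u) = e' * (x - u) + e' * (v - x)" by (simp_all add: algebra_simps)
        ultimately have "\<bar>(v - u) * f x - (F v - F u)\<bar> \<le> e' * (v - u)" by linarith
        then show "\<bar>measure lborel K *\<^sub>R f0 x - (F (Sup K) - F (Inf K))\<bar> \<le> e' * measure lborel K"
          using K \<open>x \<notin> N\<close> by (simp add: f0_def)
      qed
      also have "\<dots> \<le> (\<Sum>(x, K)\<in>p. e' * measure lborel K)"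
        using \<open>e' > 0\<close> split by (intro sum_mono2) (auto intro!: mult_nonneg_nonneg)
      also have "\<dots> = e' * (b - a)"
        using additive_content_tagged_division[OF p] \<open>a \<le> b\<close>
        by (simp add: sum_distrib_left[symmetric] case_prod_unfold)
      also have "\<dots> < e / 2" using \<open>e > 0\<close> \<open>a \<le> b\<close> by (simp add: e'_def field_simps)
      finally have G: "\<bar>\<Sum>(x, K)\<in>pG. measure lborel K *\<^sub>R f0 x - (F (Sup K) - F (Inf K))\<bar> < e / 2" .
      have "pN tagged_partial_division_of cbox a b"
        using p split(5) unfolding tagged_division_of_def by (blast intro: tagged_partial_division_subset)
      then have pNd: "pN tagged_division_of \<Union>(snd ` pN)"
        by (rule tagged_partial_division_of_Union_self)
      define D where "D = snd ` pN"
      have Ddiv: "D division_of \<Union>D" unfolding D_def by (rule division_of_tagged_division[OF pNd])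
      have Dsub: "\<Union>D \<subseteq> {a..b}"
      proof (rule Union_least)
        fix K assume "K \<in> D"
        then obtain x where "(x, K) \<in> p" using split(5) by (auto simp: D_def)
        from pK[OF this] show "K \<subseteq> {a..b}" by auto
      qed
      have DU: "\<Union>D \<subseteq> U"
      proof -
        have *: "K \<subseteq> U" if "(x, K) \<in> pN" for x K
          using fineD[OF fine, of x K] that by (simp add: g_def pN_def)
        show ?thesis
        proof (rule Union_least)
          fix K assume "K \<in> D"
          then obtain x where "(x, K) \<in> pN" by (auto simp: D_def)
          then show "K \<subseteq> U" by (rule *)
        qed
      qed
      have "(\<Sum>K\<in>D. Sup K - Inf K) = (\<Sum>K\<in>D. measure lebesgue K)"
      proof (rule sum.cong[OF refl])
        fix K assume "K \<in> D"
        then obtain x where "(x, K) \<in> p" using split(5) by (auto simp: D_def)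
        from pK[OF this] obtain u v where "K = {u..v}" "u \<le> v" by auto
        then show "Sup K - Inf K = measure lebesgue K" by simp
      qed
      also have "\<dots> = measure lebesgue (\<Union>D)" by (rule content_division[OF Ddiv])
      also have "\<dots> \<le> measure lebesgue U"
        using Um DU Ddiv by (intro measure_mono_fmeasurable) (auto intro: lmeasurable_division fmeasurableD)
      also have "\<dots> < d0" by fact
      finally have "(\<Sum>K\<in>D. \<bar>F (Sup K) - F (Inf K)\<bar>) < e / 2" using d0 Ddiv Dsub by blast
      moreover have "(\<Sum>(x, K)\<in>pN. \<bar>F (Sup K) - F (Inf K)\<bar>) = (\<Sum>K\<in>D. \<bar>F (Sup K) - F (Inf K)\<bar>)"
      proof -
        \<comment> \<open>Several tags may share a degenerate interval that \<open>D\<close> counts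
          once. This is harmless for a function vanishing on degenerate intervals; the empty
          interval gets the value \<open>0\<close> by convention.\<close>
        define h where "h K = (if K = {} then 0 else \<bar>F (Sup K) - F (Inf K)\<bar>)" for K
        have ne: "K \<noteq> {}" if "(x, K) \<in> pN" for x K
        proof -
          have "(x, K) \<in> p" using that split(5) by blast
          from pK[OF this] show ?thesis by force
        qed
        have "(\<Sum>(x, K)\<in>pN. h K) = (\<Sum>K\<in>D. h K)"
          unfolding D_def by (rule sum.over_tagged_division_lemma[OF pNd]) (auto simp: h_def)
        moreover have "(\<Sum>(x, K)\<in>pN. h K) = (\<Sum>(x, K)\<in>pN. \<bar>F (Sup K) - F (Inf K)\<bar>)"
          by (rule sum.cong) (auto simp: h_def dest: ne)
        moreover have "(\<Sum>K\<in>D. h K) = (\<Sum>K\<in>D. \<bar>F (Sup K) - F (Inf K)\<bar>)"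
          by (rule sum.cong) (auto simp: h_def D_def dest: ne)
        ultimately show ?thesis by simp
      qed
      moreover have "\<bar>\<Sum>(x, K)\<in>pN. measure lborel K *\<^sub>R f0 x - (F (Sup K) - F (Inf K))\<bar>
          \<le> (\<Sum>(x, K)\<in>pN. \<bar>F (Sup K) - F (Inf K)\<bar>)"
        by (rule order.trans[OF sum_abs], rule sum_mono) (auto simp: pN_def f0_def)
      ultimately have Nb: "\<bar>\<Sum>(x, K)\<in>pN. measure lborel K *\<^sub>R f0 x - (F (Sup K) - F (Inf K))\<bar> < e / 2" by linarith
      have "(\<Sum>(x, K)\<in>p. measure lborel K *\<^sub>R f0 x) - (F b - F a)
          = (\<Sum>(x, K)\<in>p. measure lborel K *\<^sub>R f0 x - (F (Sup K) - F (Inf K)))"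
        unfolding FF by (simp add: sum_subtractf case_prod_unfold)
      also have "\<dots> = (\<Sum>(x, K)\<in>pN. measure lborel K *\<^sub>R f0 x - (F (Sup K) - F (Inf K)))
          + (\<Sum>(x, K)\<in>pG. measure lborel K *\<^sub>R f0 x - (F (Sup K) - F (Inf K)))"
        unfolding split(1) by (rule sum.union_disjoint) (use split in auto)
      finally show ?thesis using Nb G by simp
    qed
    ultimately show "\<exists>g. gauge g \<and> (\<forall>p. p tagged_division_of cbox a b \<and> g fine p \<longrightarrow>
        norm ((\<Sum>(x, K)\<in>p. measure lborel K *\<^sub>R f0 x) - (F b - F a)) < e)"
      by (intro exI[of _ g] conjI allI impI; (elim conjE)?) (assumption, rule riemann)
  qed
  then have "(f0 has_integral (F b - F a)) {a..b}" by simp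
  then show ?thesis
    by (rule has_integral_spike[OF N, rotated]) (simp add: f0_def)
qed

text \<open>Encoding a primitive by its increments fixes neither a base point nor a sign convention
  for negative times, and makes translation in time immediate.\<close>

definition indef_integral :: "(real \<Rightarrow> 'a::banach) \<Rightarrow> (real \<Rightarrow> 'a) \<Rightarrow> bool" where
  "indef_integral g q \<longleftrightarrow> (\<forall>a b. a \<le> b \<longrightarrow> (g has_integral (q b - q a)) {a..b})"

lemma indef_integralD:
  "indef_integral g q \<Longrightarrow> a \<le> b \<Longrightarrow> (g has_integral (q b - q a)) {a..b}"
  by (simp add: indef_integral_def)

lemma indef_integral_exists:
  fixes g :: "real \<Rightarrow> 'a::banach"
  assumes "\<And>a b. g integrable_on {a..b}"
  shows "\<exists>q. indef_integral g q \<and> q 0 = 0"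
proof -
  define q where "q t = integral {0..t} g - integral {t..0} g" for t
  have q0: "q 0 = 0" by (simp add: q_def)
  have comb: "integral {a..c} g + integral {c..b} g = integral {a..b} g" if "a \<le> c" "c \<le> b" for a b c
    using Henstock_Kurzweil_Integration.integral_combine[OF that assms] .
  have "indef_integral g q" unfolding indef_integral_def
  proof (intro allI impI)
    fix a b :: real assume "a \<le> b"
    have z: "integral {u..v} g = 0" if "v \<le> u" for u v
      using that by (cases "u = v") auto
    consider "0 \<le> a" | "a < 0" "0 \<le> b" | "b < 0" by linarith
    then have "q b - q a = integral {a..b} g"
    proof cases
      case 1
      then have "integral {0..a} g + integral {a..b} g = integral {0..b} g"
        using \<open>a \<le> b\<close> by (intro comb)
      then have "integral {a..b} g = integral {0..b} g - integral {0..a} g"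
        by (simp only: eq_diff_eq add.commute)
      then show ?thesis using 1 \<open>a \<le> b\<close> by (simp add: q_def z[of 0 a] z[of 0 b])
    next
      case 2
      then have "integral {a..0} g + integral {0..b} g = integral {a..b} g" by (intro comb) auto
      then show ?thesis using 2
        by (simp only: q_def z[of a 0] z[of 0 b] z[of 0 a] z[of b 0]) (simp add: z add.commute)
    next
      case 3
      then have "integral {a..b} g + integral {b..0} g = integral {a..0} g"
        using \<open>a \<le> b\<close> by (intro comb) auto
      then have "integral {a..b} g = integral {a..0} g - integral {b..0} g" by (simp only: eq_diff_eq)
      then show ?thesis using 3 \<open>a \<le> b\<close> by (simp add: q_def z[of a 0] z[of b 0])
    qed
    then show "(g has_integral (q b - q a)) {a..b}"
      using integrable_integral[OF assms, of a b] by simp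
  qed
  with q0 show ?thesis by blast
qed

lemma indef_integral_continuous:
  fixes g :: "real \<Rightarrow> 'a::banach"
  assumes "indef_integral g q"
  shows "isCont q t"
proof -
  have int: "(g has_integral (q u - q (t - 1))) {t - 1..u}" if "t - 1 \<le> u" for u
    using assms that by (auto simp: indef_integral_def)
  have "continuous_on {t - 1..t + 1} (\<lambda>u. integral {t - 1..u} g)"
    using int[of "t + 1"] by (intro indefinite_integral_continuous_1) (auto simp: has_integral_integrable)
  then have "continuous_on {t - 1..t + 1} (\<lambda>u. integral {t - 1..u} g + q (t - 1))"
    by (intro continuous_intros)
  then have "continuous_on {t - 1..t + 1} q"
    by (rule continuous_on_eq) (simp add: integral_unique[OF int])
  then show ?thesis by (rule continuous_on_interior) auto
qed

lemma indef_integral_of_derivative: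
  fixes g :: "real \<Rightarrow> 'a::banach"
  assumes "\<And>t. (q has_vector_derivative g t) (at t)"
  shows "indef_integral g q"
  unfolding indef_integral_def
  by (intro allI impI fundamental_theorem_of_calculus has_vector_derivative_at_within[OF assms])

text \<open>
  Although the primitive \<open>q\<close> of \<open>p\<close> need not be differentiable, \<open>q y - \<integral> p y\<close> is.
\<close>

lemma integration_by_parts_derivative:
  fixes p q y y' r A :: "real \<Rightarrow> real"
  assumes q: "indef_integral p q" and r: "indef_integral (\<lambda>t. p t * y t) r"
    and A: "indef_integral (\<lambda>t. \<bar>p t\<bar>) A"
    and y: "\<And>t. (y has_real_derivative y' t) (at t)" and y': "continuous_on UNIV y'"
  shows "((\<lambda>t. q t * y t - r t) has_real_derivative q t * y' t) (at t)"
proof -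
  have "compact (y' ` {t - 1..t + 1})"
    by (intro compact_continuous_image continuous_on_subset[OF y']) auto
  then obtain C where C: "\<And>u. u \<in> {t - 1..t + 1} \<Longrightarrow> \<bar>y' u\<bar> \<le> C" "C > 0"
    using compact_imp_bounded bounded_pos by (metis (no_types, lifting) image_eqI real_norm_def)
  have lip: "\<bar>y u - y s\<bar> \<le> C * \<bar>u - s\<bar>" if "u \<in> {t - 1..t + 1}" "s \<in> {t - 1..t + 1}" for u s
    using field_differentiable_bound[OF _ has_field_derivative_at_within[OF y], of "{t - 1..t + 1}" C u s] that C(1)
    by simp
  \<comment> \<open>Inside the modulus stands the integral of \<open>p * (y - y w)\<close> over
    \<open>[u, v]\<close>, where \<open>y\<close> varies by at most \<open>C * (v - u)\<close>.
    Continuity of \<open>A\<close> later makes the bound \<open>o(v - u)\<close>.\<close>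
  have key: "\<bar>r v - r u - y w * (q v - q u)\<bar> \<le> C * (v - u) * (A v - A u)"
    if "u \<le> v" "u \<in> {t - 1..t + 1}" "v \<in> {t - 1..t + 1}" "w \<in> {u..v}" for u v w
  proof -
    have 1: "((\<lambda>s. p s * y s - y w * p s) has_integral (r v - r u - y w * (q v - q u))) {u..v}"
      using q r \<open>u \<le> v\<close> unfolding indef_integral_def
      by (intro has_integral_diff has_integral_mult_right) auto
    have 2: "((\<lambda>s. C * (v - u) * \<bar>p s\<bar>) has_integral (C * (v - u) * (A v - A u))) {u..v}"
      using A \<open>u \<le> v\<close> unfolding indef_integral_def by (intro has_integral_mult_right) auto
    have "norm (p s * y s - y w * p s) \<le> C * (v - u) * \<bar>p s\<bar>" if "s \<in> {u..v}" for s
    proof -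
      have "\<bar>y s - y w\<bar> \<le> C * \<bar>s - w\<bar>" using that \<open>w \<in> {u..v}\<close> \<open>u \<in> _\<close> \<open>v \<in> _\<close> by (intro lip) auto
      also have "\<dots> \<le> C * (v - u)" using that \<open>w \<in> {u..v}\<close> C(2) by (intro mult_left_mono) auto
      finally have "\<bar>p s\<bar> * \<bar>y s - y w\<bar> \<le> \<bar>p s\<bar> * (C * (v - u))" by (intro mult_left_mono) auto
      then show ?thesis by (simp add: abs_mult[symmetric] algebra_simps)
    qed
    from integral_norm_bound_integral[OF has_integral_integrable[OF 1] has_integral_integrable[OF 2] this]
    show ?thesis by (simp only: integral_unique[OF 1] integral_unique[OF 2] real_norm_def)
  qed
  define H where "H t = q t * y t - r t" for t
  have bound: "\<bar>H u - H t - q t * (y u - y t)\<bar> \<le> C * \<bar>u - t\<bar> * \<bar>A u - A t\<bar>" if "\<bar>u - t\<bar> \<le> 1" for u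
  proof (cases "t \<le> u")
    case True
    have "H u - H t - q t * (y u - y t) = - (r u - r t - y u * (q u - q t))"
      by (simp add: H_def algebra_simps)
    moreover have "\<bar>r u - r t - y u * (q u - q t)\<bar> \<le> C * (u - t) * (A u - A t)"
      using True that by (intro key) auto
    moreover have "C * (u - t) * (A u - A t) \<le> C * (u - t) * \<bar>A u - A t\<bar>"
      using True C(2) by (intro mult_left_mono) auto
    moreover have "\<bar>u - t\<bar> = u - t" using True by simp
    ultimately show ?thesis by (simp only: abs_minus_cancel)
  next
    case False
    have "H u - H t - q t * (y u - y t) = r t - r u - y u * (q t - q u)"
      by (simp add: H_def algebra_simps)
    moreover have "\<bar>r t - r u - y u * (q t - q u)\<bar> \<le> C * (t - u) * (A t - A u)"
      using False that by (intro key) auto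
    moreover have "C * (t - u) * (A t - A u) \<le> C * (t - u) * \<bar>A u - A t\<bar>"
      using False C(2) by (intro mult_left_mono) auto
    moreover have "\<bar>u - t\<bar> = t - u" using False by simp
    ultimately show ?thesis by (simp only:)
  qed
  have "((\<lambda>u. C * \<bar>A u - A t\<bar>) \<longlongrightarrow> C * \<bar>A t - A t\<bar>) (at t)"
    using indef_integral_continuous[OF A, of t] by (intro tendsto_intros) (simp add: isCont_def)
  then have limA: "((\<lambda>u. C * \<bar>A u - A t\<bar>) \<longlongrightarrow> 0) (at t)" by simp
  have "((\<lambda>u. (H u - H t - q t * (y u - y t)) / (u - t)) \<longlongrightarrow> 0) (at t)"
  proof (rule Lim_null_comparison[OF _ limA])
    have "\<forall>\<^sub>F u in at t. \<bar>u - t\<bar> < 1 \<and> u \<noteq> t"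
      unfolding eventually_at by (rule exI[of _ 1]) (auto simp: dist_real_def)
    then show "\<forall>\<^sub>F u in at t. norm ((H u - H t - q t * (y u - y t)) / (u - t)) \<le> C * \<bar>A u - A t\<bar>"
    proof eventually_elim
      case (elim u)
      then show ?case using bound[of u] by (simp add: abs_divide pos_divide_le_eq mult_ac)
    qed
  qed
  moreover have "((\<lambda>u. q t * ((y u - y t) / (u - t))) \<longlongrightarrow> q t * y' t) (at t)"
    using y[of t] by (intro tendsto_intros) (simp add: has_field_derivative_iff)
  ultimately have lim: "((\<lambda>u. (H u - H t - q t * (y u - y t)) / (u - t) + q t * ((y u - y t) / (u - t)))
      \<longlongrightarrow> 0 + q t * y' t) (at t)" by (rule tendsto_add)
  have "(H u - H t - q t * (y u - y t)) / (u - t) + q t * ((y u - y t) / (u - t)) = (H u - H t) / (u - t)" for u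
    unfolding times_divide_eq_right add_divide_distrib[symmetric] by (rule arg_cong[where f = "\<lambda>x. x / (u - t)"]) simp
  with lim have "((\<lambda>u. (H u - H t) / (u - t)) \<longlongrightarrow> q t * y' t) (at t)" by (simp only: add_0)
  then show ?thesis by (simp add: has_field_derivative_iff H_def)
qed

text \<open>This rests on translation invariance of the integral. It serves both for the forcing and
  for the product of \<open>p\<close> with a solution of the linearised equation.\<close>

lemma indef_integral_periodic_shift:
  fixes g :: "real \<Rightarrow> 'a::banach"
  assumes q: "indef_integral g q" and per: "\<And>t. g (t + T) = g t"
  shows "q (t + T) - q t = q T - q 0"
proof -
  have *: "q (b + T) - q (a + T) = q b - q a" if "a \<le> b" for a b
  proof -
    have "(g has_integral (q (b + T) - q (a + T))) {a + T..b + T}"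
      using q that by (simp add: indef_integral_def)
    then have "((\<lambda>t. g (t + T)) has_integral (q (b + T) - q (a + T))) {a..b}"
      using has_integral_affinity'[of g "q (b + T) - q (a + T)" "a + T" "b + T" 1 T] by simp
    moreover have "(g has_integral (q b - q a)) {a..b}"
      using q that by (simp add: indef_integral_def)
    ultimately show ?thesis unfolding per by (rule has_integral_unique)
  qed
  show ?thesis using *[of 0 t] *[of t 0] by (cases "0 \<le> t") (auto simp: algebra_simps)
qed

subsection \<open>Remainder of the linearisation along an orbit\<close>

lemma sign_change_zero:
  fixes f :: "real \<Rightarrow> real"
  assumes "isCont f 0" and sign: "\<And>x. x \<noteq> 0 \<Longrightarrow> x * f x > 0"
  shows "f 0 = 0"
proof (rule antisym)
  have lim: "(f \<longlongrightarrow> f 0) (at_left 0)" "(f \<longlongrightarrow> f 0) (at_right 0)"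
    using assms(1) by (simp_all add: isCont_def filterlim_at_split)
  have "\<forall>\<^sub>F x in at_left 0. f x \<le> 0"
  proof (rule eventually_mono[OF eventually_at_left_real[of "-1"]])
    show "f x \<le> 0" if "x \<in> {- 1<..<0}" for x
      using sign[of x] that by (auto simp: zero_less_mult_iff)
  qed simp
  then show "f 0 \<le> 0" by (rule tendsto_upperbound[OF lim(1)]) simp
  have "\<forall>\<^sub>F x in at_right 0. f x \<ge> 0"
  proof (rule eventually_mono[OF eventually_at_right_real[of _ 1]])
    show "f x \<ge> 0" if "x \<in> {0<..<1}" for x
      using sign[of x] that by (auto simp: zero_less_mult_iff)
  qed simp
  then show "f 0 \<ge> 0" by (rule tendsto_lowerbound[OF lim(2)]) simp
qed

section \<open>Orbits of the free oscillator and their speed\<close>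

locale isochronous_potential =
  fixes V f f2 :: "real \<Rightarrow> real" and L :: real
  assumes V_deriv: "\<And>x. (V has_real_derivative f x) (at x)"
    and f_deriv: "\<And>x. (f has_real_derivative f2 x) (at x)"
    and f2_cont: "continuous_on UNIV f2"
    and f2_bound: "\<And>x. \<bar>f2 x\<bar> \<le> L"
    and f_zero: "f 0 = 0"
    and f_sign: "\<And>x. x \<noteq> 0 \<Longrightarrow> x * f x > 0"
    and periodic: "\<And>x v. classical_solution (\<lambda>t x. - f x) x v \<Longrightarrow> periodic_2pi x"
begin

definition orbit :: "(real \<Rightarrow> real) \<Rightarrow> (real \<Rightarrow> real) \<Rightarrow> bool" where
  "orbit X Y \<longleftrightarrow> classical_solution (\<lambda>t x. - f x) X Y"

lemma L_nonneg: "L \<ge> 0"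
  using f2_bound[of 0] by linarith

lemma f_lipschitz: "\<bar>f x - f y\<bar> \<le> L * \<bar>x - y\<bar>"
  using field_differentiable_bound[of UNIV f f2 L x y] f_deriv f2_bound by simp

lemma orbit_deriv:
  assumes "orbit X Y"
  shows "(X has_real_derivative Y t) (at t)" "(Y has_real_derivative - f (X t)) (at t)"
  using assms by (auto simp: orbit_def classical_solution_def has_real_derivative_iff_has_vector_derivative)

lemma orbit_velocity_deriv2:
  assumes "orbit X Y"
  shows "((\<lambda>t. - f (X t)) has_real_derivative - (f2 (X t) * Y t)) (at t)"
  using DERIV_chain2[OF f_deriv orbit_deriv(1)[OF assms]] by (rule DERIV_minus)

lemma orbit_periodic:
  assumes "orbit X Y"
  shows "X (t + 2 * pi) = X t" "Y (t + 2 * pi) = Y t"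
proof -
  show X: "X (t + 2 * pi) = X t" for t
    using periodic[of X Y] assms by (auto simp: orbit_def periodic_2pi_def)
  have "((\<lambda>t. X (t + 2 * pi)) has_real_derivative Y (t + 2 * pi)) (at t)"
    using orbit_deriv(1)[OF assms, of "t + 2 * pi"] by (simp add: DERIV_shift)
  then have "(X has_real_derivative Y (t + 2 * pi)) (at t)" by (simp only: X)
  then show "Y (t + 2 * pi) = Y t" using orbit_deriv(1)[OF assms] DERIV_unique by blast
qed

text \<open>Rolle's theorem for the periodic velocity gives a zero of the force, which by the sign
  condition sits at the origin. The equilibrium is covered as well.\<close>

lemma orbit_crosses_zero:
  assumes "orbit X Y"
  shows "\<exists>s. 0 < s \<and> s < 2 * pi \<and> X s = 0"
proof -
  have "\<exists>s. 0 < s \<and> s < 2 * pi \<and> Y (2 * pi) - Y 0 = (2 * pi - 0) * - f (X s)"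
    by (rule MVT2) (use orbit_deriv(2)[OF assms] in auto)
  then obtain s where s: "0 < s" "s < 2 * pi" "f (X s) = 0"
    using orbit_periodic(2)[OF assms, of 0] by auto
  then have "X s = 0" using f_sign[of "X s"] by force
  with s show ?thesis by blast
qed

lemma orbit_shift:
  assumes "orbit X Y"
  shows "orbit (\<lambda>t. X (t + s)) (\<lambda>t. Y (t + s))"
  unfolding orbit_def classical_solution_def has_real_derivative_iff_has_vector_derivative[symmetric]
  using orbit_deriv[OF assms, of "_ + s"] by (simp add: DERIV_shift)

text \<open>The maximum of an orbit is a turning point on the positive half-axis.\<close>

lemma orbit_turning_point:
  assumes o: "orbit X Y"
  shows "\<exists>s\<in>{0..2 * pi}. X s \<ge> 0 \<and> Y s = 0"
proof -
  have "continuous_on {0..2 * pi} X"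
    using DERIV_isCont[OF orbit_deriv(1)[OF o]] by (simp add: continuous_at_imp_continuous_on)
  then obtain s where s: "s \<in> {0..2 * pi}" "\<And>t. t \<in> {0..2 * pi} \<Longrightarrow> X t \<le> X s"
    using continuous_attains_sup[of "{0..2 * pi}" X] by auto
  obtain z where z: "0 < z" "z < 2 * pi" "X z = 0" using orbit_crosses_zero[OF o] by blast
  then have "X s \<ge> 0" using s(2)[of z] z by auto
  \<comment> \<open>The maximum over one closed period may lie at an endpoint; being global, it is a
    critical point all the same.\<close>
  have glob: "X t \<le> X s" for t
  proof -
    have shift: "X (t + 2 * pi * real n) = X t" for t n
    proof (induction n)
      case (Suc n)
      have "X (t + 2 * pi * real (Suc n)) = X ((t + 2 * pi * real n) + 2 * pi)" by (simp add: algebra_simps)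
      then show ?case using orbit_periodic(1)[OF o, of "t + 2 * pi * real n"] Suc by simp
    qed simp
    define k where "k = \<lfloor>t / (2 * pi)\<rfloor>"
    have k: "0 \<le> t - 2 * pi * of_int k" "t - 2 * pi * of_int k \<le> 2 * pi"
      using floor_divide_lower[of "2 * pi" t] floor_divide_upper[of "2 * pi" t] by (auto simp: k_def algebra_simps)
    have "X (t - 2 * pi * of_int k) = X t"
    proof (cases "k \<ge> 0")
      case True
      then show ?thesis using shift[of "t - 2 * pi * of_int k" "nat k"] by simp
    next
      case False
      then show ?thesis using shift[of t "nat (- k)"] by simp
    qed
    then show ?thesis using s(2)[of "t - 2 * pi * of_int k"] k by simp
  qed
  have "Y s = 0" by (rule DERIV_local_max[OF orbit_deriv(1)[OF o], of 1]) (use glob in auto)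
  then show ?thesis using s(1) \<open>X s \<ge> 0\<close> by blast
qed

text \<open>Square root of the Gronwall factor for time \<open>2 * pi\<close>, as Gronwall bounds
  squared norms.\<close>

definition \<Lambda> :: real where "\<Lambda> = exp ((2 + L) * pi)"

lemma \<Lambda>_ge_1: "\<Lambda> \<ge> 1"
  unfolding \<Lambda>_def using L_nonneg by simp

definition speed :: "(real \<Rightarrow> real) \<Rightarrow> (real \<Rightarrow> real) \<Rightarrow> real \<Rightarrow> real" where
  "speed X Y t = sqrt ((Y t)\<^sup>2 + (f (X t))\<^sup>2)"

lemma speed_nonneg: "speed X Y t \<ge> 0"
  by (simp add: speed_def)

lemma speed_ge: "\<bar>Y t\<bar> \<le> speed X Y t" "\<bar>f (X t)\<bar> \<le> speed X Y t"
  unfolding speed_def by (simp_all add: real_le_rsqrt)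

text \<open>The phase velocity \<open>(Y, - f X)\<close>, whose length is \<open>speed\<close>,
  solves the linearised equation along its own orbit. Gronwall therefore applies in both directions
  of time, with a constant common to all orbits.\<close>

lemma speed_compare:
  assumes "orbit X Y" "\<bar>t - s\<bar> \<le> 2 * pi"
  shows "speed X Y t \<le> \<Lambda> * speed X Y s"
proof -
  have "(norm (Y t))\<^sup>2 + (norm (- f (X t)))\<^sup>2
      \<le> ((norm (Y s))\<^sup>2 + (norm (- f (X s)))\<^sup>2) * exp ((2 + L) * \<bar>t - s\<bar>)"
  proof (rule gronwall_both[OF _ _ _ L_nonneg])
    show "(Y has_vector_derivative - f (X u)) (at u)" for u
      using orbit_deriv(2)[OF assms(1)] by (simp add: has_real_derivative_iff_has_vector_derivative)
    show "((\<lambda>u. - f (X u)) has_vector_derivative - (f2 (X u) * Y u)) (at u)" for u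
      using orbit_velocity_deriv2[OF assms(1)] by (simp add: has_real_derivative_iff_has_vector_derivative)
    show "norm (- (f2 (X u) * Y u)) \<le> L * norm (Y u)" for u
      using f2_bound by (simp add: abs_mult mult_right_mono)
  qed
  also have "exp ((2 + L) * \<bar>t - s\<bar>) \<le> exp ((2 + L) * (2 * pi))"
    using assms(2) L_nonneg by (simp add: mult_left_mono)
  also have "\<dots> = \<Lambda>\<^sup>2" by (simp add: \<Lambda>_def power2_eq_square flip: exp_add)
  finally have "(Y t)\<^sup>2 + (f (X t))\<^sup>2 \<le> ((Y s)\<^sup>2 + (f (X s))\<^sup>2) * \<Lambda>\<^sup>2"
    by (simp add: mult_left_mono)
  then have "speed X Y t \<le> sqrt (((Y s)\<^sup>2 + (f (X s))\<^sup>2) * \<Lambda>\<^sup>2)"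
    unfolding speed_def by simp
  then show ?thesis using \<Lambda>_ge_1 by (simp add: real_sqrt_mult speed_def mult.commute)
qed

text \<open>The orbit meets \<open>0\<close> and its velocity is controlled by the initial speed.
  Orbits of bounded speed thus share a compact set, which settles the slow case below.\<close>

lemma orbit_amplitude:
  assumes "orbit X Y" "t \<in> {0..2 * pi}"
  shows "\<bar>X t\<bar> \<le> 2 * pi * \<Lambda> * speed X Y 0"
proof -
  obtain s where s: "0 < s" "s < 2 * pi" "X s = 0" using orbit_crosses_zero[OF assms(1)] by blast
  have "\<bar>Y u\<bar> \<le> \<Lambda> * speed X Y 0" if "u \<in> {0..2 * pi}" for u
    using speed_compare[OF assms(1), of u 0] speed_ge(1)[of Y u X] that by auto
  then have "norm (X t - X s) \<le> \<Lambda> * speed X Y 0 * norm (t - s)"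
    using s assms(2)
    by (intro field_differentiable_bound[of "{0..2 * pi}" X Y] has_field_derivative_at_within[OF orbit_deriv(1)[OF assms(1)]]) auto
  also have "\<dots> \<le> \<Lambda> * speed X Y 0 * (2 * pi)"
    using s assms(2) \<Lambda>_ge_1 speed_nonneg[of X Y 0] by (intro mult_left_mono) auto
  finally show ?thesis using \<open>X s = 0\<close> by (simp add: mult_ac)
qed

section \<open>Taylor remainders of the force and of the potential\<close>

definition nonlin :: "real \<Rightarrow> real \<Rightarrow> real" where
  "nonlin x w = f (x + w) - f x - f2 x * w"

lemma nonlin_bound: "\<bar>nonlin x w\<bar> \<le> 2 * L * \<bar>w\<bar>"
proof -
  have "\<bar>f2 x * w\<bar> \<le> L * \<bar>w\<bar>" using f2_bound by (simp add: abs_mult mult_right_mono)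
  then show ?thesis using f_lipschitz[of "x + w" x] unfolding nonlin_def by simp
qed

lemma nonlin_small:
  assumes "\<And>s. \<bar>s\<bar> \<le> \<bar>w\<bar> \<Longrightarrow> \<bar>f2 (x + s) - f2 x\<bar> \<le> e"
  shows "\<bar>nonlin x w\<bar> \<le> e * \<bar>w\<bar>"
proof -
  have "norm ((\<lambda>s. f (x + s) - f2 x * s) w - (\<lambda>s. f (x + s) - f2 x * s) 0) \<le> e * norm (w - 0)"
  proof (rule field_differentiable_bound[where S = "{- \<bar>w\<bar>..\<bar>w\<bar>}" and f' = "\<lambda>s. f2 (x + s) - f2 x"])
    fix s assume "s \<in> {- \<bar>w\<bar>..\<bar>w\<bar>}"
    have "((\<lambda>s. f (x + s)) has_real_derivative f2 (x + s)) (at s)"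
      using f_deriv[of "x + s"] by (simp add: DERIV_shift add.commute[of x])
    then show "((\<lambda>s. f (x + s) - f2 x * s) has_field_derivative f2 (x + s) - f2 x) (at s within {- \<bar>w\<bar>..\<bar>w\<bar>})"
      by (auto intro!: derivative_eq_intros intro: has_field_derivative_at_within)
  qed (use assms in auto)
  then show ?thesis by (simp add: nonlin_def)
qed

text \<open>Along an orbit \<open>X\<close> with deviation \<open>w\<close> its time derivative is
  \<open>nonlin X w * X' + (f (X + w) - f X) * w'\<close>. Hence \<open>nonlin X w * X'\<close> is
  an exact derivative up to a term bounded by
  \<open>L * \<bar>w\<bar> * \<bar>w'\<bar>\<close>.\<close>

definition V_rem :: "real \<Rightarrow> real \<Rightarrow> real" where
  "V_rem x w = V (x + w) - V x - f x * w"

lemma V_rem_bound: "\<bar>V_rem x w\<bar> \<le> L * w\<^sup>2"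
proof -
  have "norm ((\<lambda>s. V (x + s) - f x * s) w - (\<lambda>s. V (x + s) - f x * s) 0) \<le> (L * \<bar>w\<bar>) * norm (w - 0)"
  proof (rule field_differentiable_bound[where S = "{- \<bar>w\<bar>..\<bar>w\<bar>}" and f' = "\<lambda>s. f (x + s) - f x"])
    fix s assume s: "s \<in> {- \<bar>w\<bar>..\<bar>w\<bar>}"
    have "((\<lambda>s. V (x + s)) has_real_derivative f (x + s)) (at s)"
      using V_deriv[of "x + s"] by (simp add: DERIV_shift add.commute[of x])
    then show "((\<lambda>s. V (x + s) - f x * s) has_field_derivative f (x + s) - f x) (at s within {- \<bar>w\<bar>..\<bar>w\<bar>})"
      by (auto intro!: derivative_eq_intros intro: has_field_derivative_at_within)
    have "L * \<bar>s\<bar> \<le> L * \<bar>w\<bar>" using s L_nonneg by (intro mult_left_mono) auto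
    then show "norm (f (x + s) - f x) \<le> L * \<bar>w\<bar>" using f_lipschitz[of "x + s" x] by simp
  qed auto
  then show ?thesis by (simp add: V_rem_def power2_eq_square abs_mult mult.assoc)
qed

text \<open>
  When \<open>Y = X'\<close> is small on a fast orbit, the acceleration is large by the comparison of speeds, so
  \<open>k\<^sup>2 / (Y\<^sup>2 + k\<^sup>2)\<close> is essentially dominated by the derivative of \<open>k Y' arctan (Y / k) / \<rho>\<^sup>2\<close>.
\<close>

lemma slow_time_bound:
  assumes o: "orbit X Y" and \<rho>: "\<rho> = speed X Y 0" "\<rho> > 0" and "k > 0"
  shows "\<exists>J J'. (\<forall>t. (J has_real_derivative J' t) (at t)) \<and>
    (\<forall>t\<in>{0..2 * pi}. k\<^sup>2 / ((Y t)\<^sup>2 + k\<^sup>2) \<le> J' t \<and>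
      J t - J 0 \<le> \<Lambda>\<^sup>2 * (2 * pi * (k / \<rho>)\<^sup>2 + (4 * \<Lambda> + 4 * pi * L * \<Lambda>) * (k / \<rho>)))"
proof -
  define Z Z' where "Z t = - f (X t)" and "Z' t = - (f2 (X t) * Y t)" for t
  have dY: "(Y has_real_derivative Z t) (at t)" for t
    using orbit_deriv(2)[OF o] by (simp add: Z_def)
  have dZ: "(Z has_real_derivative Z' t) (at t)" for t
    using orbit_velocity_deriv2[OF o] by (simp add: Z_def[abs_def] Z'_def)
  \<comment> \<open>Differentiating the arctangent term yields
    \<open>k\<^sup>2 Z\<^sup>2 / (Y\<^sup>2 + k\<^sup>2)\<close> and
    \<open>k Z' arctan (Y / k)\<close>; the last summand of \<open>J\<close> absorbs the latter, as
    \<open>\<bar>Z'\<bar> \<le> L \<Lambda> \<rho>\<close> and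
    \<open>\<bar>arctan\<bar> \<le> 2\<close>.\<close>
  define J where "J t = \<Lambda>\<^sup>2 / \<rho>\<^sup>2 * (k\<^sup>2 * t + k * (Z t * arctan (Y t / k)) + k * (2 * L * \<Lambda> * \<rho>) * t)" for t
  define J' where "J' t = \<Lambda>\<^sup>2 / \<rho>\<^sup>2 * (k\<^sup>2 + k * (Z' t * arctan (Y t / k) + Z t * ((Z t / k) / (1 + (Y t / k)\<^sup>2)))
      + k * (2 * L * \<Lambda> * \<rho>))" for t
  have dA: "((\<lambda>t. arctan (Y t / k)) has_real_derivative (Z t / k) / (1 + (Y t / k)\<^sup>2)) (at t)" for t
    using DERIV_chain2[OF DERIV_arctan DERIV_cdivide[OF dY]] by (simp add: divide_inverse mult.commute)
  have dJ: "(J has_real_derivative J' t) (at t)" for t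
  proof -
    have "((\<lambda>t. c * (k\<^sup>2 * t + k * (Z t * arctan (Y t / k)) + b * t)) has_real_derivative
        c * (k\<^sup>2 + k * (Z' t * arctan (Y t / k) + Z t * ((Z t / k) / (1 + (Y t / k)\<^sup>2))) + b)) (at t)" for c b
      by (rule derivative_eq_intros dA dZ refl)+ simp
    then show ?thesis unfolding J_def[abs_def] J'_def .
  qed
  have sp: "speed X Y t \<le> \<Lambda> * \<rho>" "\<rho> \<le> \<Lambda> * speed X Y t" if "t \<in> {0..2 * pi}" for t
    using speed_compare[OF o, of t 0] speed_compare[OF o, of 0 t] that \<rho>(1) by auto
  have Zb: "\<bar>Z t\<bar> \<le> \<Lambda> * \<rho>" and Yb: "\<bar>Y t\<bar> \<le> \<Lambda> * \<rho>" if "t \<in> {0..2 * pi}" for t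
    using sp[OF that] speed_ge[of Y t X] speed_ge(2)[where X = X and Y = Y and t = t] by (auto simp: Z_def)
  have at2: "\<bar>arctan x\<bar> \<le> 2" for x
    using arctan_bounded[of x] pi_half_less_two by (auto simp: abs_le_iff)
  have prodb: "\<bar>u * arctan x\<bar> \<le> 2 * b" if "\<bar>u\<bar> \<le> b" for u x b
  proof -
    have "\<bar>u * arctan x\<bar> \<le> b * 2"
      unfolding abs_mult using that at2 by (intro mult_mono) auto
    then show ?thesis by simp
  qed
  have c: "\<Lambda>\<^sup>2 / \<rho>\<^sup>2 \<ge> 0" by simp
  have 1: "k\<^sup>2 / ((Y t)\<^sup>2 + k\<^sup>2) \<le> J' t" if t: "t \<in> {0..2 * pi}" for t
  proof -
    have pos: "(Y t)\<^sup>2 + k\<^sup>2 > 0" using \<open>k > 0\<close> by (simp add: add_nonneg_pos)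
    have "\<bar>Z' t\<bar> \<le> L * (\<Lambda> * \<rho>)"
      unfolding Z'_def abs_minus_cancel abs_mult using f2_bound Yb[OF t] L_nonneg by (intro mult_mono) auto
    from prodb[OF this, of "Y t / k"] have "Z' t * arctan (Y t / k) \<ge> - (2 * L * \<Lambda> * \<rho>)"
      by (simp add: abs_le_iff)
    then have "k * (Z' t * arctan (Y t / k)) + k * (2 * L * \<Lambda> * \<rho>) \<ge> 0"
      using \<open>k > 0\<close> by (simp flip: distrib_left)
    moreover have "k * (Z t * ((Z t / k) / (1 + (Y t / k)\<^sup>2))) = k\<^sup>2 * (Z t)\<^sup>2 / ((Y t)\<^sup>2 + k\<^sup>2)"
      using \<open>k > 0\<close> pos by (simp add: field_simps power2_eq_square)
    \<comment> \<open>Completing \<open>Z\<^sup>2\<close> by \<open>Y\<^sup>2\<close> produces the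
      squared speed, which is at least \<open>\<rho>\<^sup>2 / \<Lambda>\<^sup>2\<close>; this is
      the origin of the prefactor of \<open>J\<close>.\<close>
    moreover have "k\<^sup>2 \<ge> k\<^sup>2 * (Y t)\<^sup>2 / ((Y t)\<^sup>2 + k\<^sup>2)"
      using pos by (simp add: divide_le_eq algebra_simps)
    ultimately have "k\<^sup>2 * (Y t)\<^sup>2 / ((Y t)\<^sup>2 + k\<^sup>2) + k\<^sup>2 * (Z t)\<^sup>2 / ((Y t)\<^sup>2 + k\<^sup>2)
        \<le> k\<^sup>2 + k * (Z' t * arctan (Y t / k) + Z t * ((Z t / k) / (1 + (Y t / k)\<^sup>2))) + k * (2 * L * \<Lambda> * \<rho>)"
      by (simp add: distrib_left)
    moreover have "k\<^sup>2 * (Y t)\<^sup>2 / ((Y t)\<^sup>2 + k\<^sup>2) + k\<^sup>2 * (Z t)\<^sup>2 / ((Y t)\<^sup>2 + k\<^sup>2)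
        = (speed X Y t)\<^sup>2 * (k\<^sup>2 / ((Y t)\<^sup>2 + k\<^sup>2))"
      by (simp add: speed_def Z_def distrib_left add_divide_distrib[symmetric] algebra_simps)
    ultimately have "\<Lambda>\<^sup>2 / \<rho>\<^sup>2 * ((speed X Y t)\<^sup>2 * (k\<^sup>2 / ((Y t)\<^sup>2 + k\<^sup>2))) \<le> J' t"
      unfolding J'_def by (intro mult_left_mono c) simp
    moreover have "1 \<le> \<Lambda>\<^sup>2 / \<rho>\<^sup>2 * (speed X Y t)\<^sup>2"
    proof -
      have "\<rho>\<^sup>2 \<le> (\<Lambda> * speed X Y t)\<^sup>2" using sp(2)[OF t] \<rho>(2) by (intro power_mono) auto
      then show ?thesis using \<rho>(2) by (simp add: le_divide_eq power_mult_distrib)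
    qed
    then have "1 * (k\<^sup>2 / ((Y t)\<^sup>2 + k\<^sup>2)) \<le> \<Lambda>\<^sup>2 / \<rho>\<^sup>2 * (speed X Y t)\<^sup>2 * (k\<^sup>2 / ((Y t)\<^sup>2 + k\<^sup>2))"
      using pos by (intro mult_right_mono) auto
    ultimately show ?thesis by (simp only: mult.assoc mult_1)
  qed
  have 2: "J t - J 0 \<le> \<Lambda>\<^sup>2 * (2 * pi * (k / \<rho>)\<^sup>2 + (4 * \<Lambda> + 4 * pi * L * \<Lambda>) * (k / \<rho>))"
    if t: "t \<in> {0..2 * pi}" for t
  proof -
    have "Z t * arctan (Y t / k) - Z 0 * arctan (Y 0 / k) \<le> 4 * (\<Lambda> * \<rho>)"
      using prodb[OF Zb[OF t], of "Y t / k"] prodb[OF Zb[of 0], of "Y 0 / k"] by (simp add: abs_le_iff)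
    then have "k * (Z t * arctan (Y t / k) - Z 0 * arctan (Y 0 / k)) \<le> k * (4 * (\<Lambda> * \<rho>))"
      using \<open>k > 0\<close> by (intro mult_left_mono) auto
    moreover have "k\<^sup>2 * t \<le> k\<^sup>2 * (2 * pi)" using t by (intro mult_left_mono) auto
    moreover have "k * (2 * L * \<Lambda> * \<rho>) * t \<le> k * (2 * L * \<Lambda> * \<rho>) * (2 * pi)"
      using t \<open>k > 0\<close> \<rho> L_nonneg \<Lambda>_ge_1 by (intro mult_left_mono) auto
    ultimately have "\<Lambda>\<^sup>2 / \<rho>\<^sup>2 * (k\<^sup>2 * t + k * (Z t * arctan (Y t / k) - Z 0 * arctan (Y 0 / k)) + k * (2 * L * \<Lambda> * \<rho>) * t)
      \<le> \<Lambda>\<^sup>2 / \<rho>\<^sup>2 * (k\<^sup>2 * (2 * pi) + k * (4 * (\<Lambda> * \<rho>)) + k * (2 * L * \<Lambda> * \<rho>) * (2 * pi))"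
      by (intro mult_left_mono c) linarith
    also have "\<dots> = \<Lambda>\<^sup>2 * (2 * pi * (k / \<rho>)\<^sup>2 + (4 * \<Lambda> + 4 * pi * L * \<Lambda>) * (k / \<rho>))"
      using \<rho>(2) by (simp add: field_simps power2_eq_square)
    finally show ?thesis by (simp add: J_def algebra_simps)
  qed
  show ?thesis using dJ 1 2 by blast
qed

text \<open>With \<open>m = Y / (Y\<^sup>2 + k\<^sup>2)\<close> one has
  \<open>1 = m Y + k\<^sup>2 / (Y\<^sup>2 + k\<^sup>2)\<close>. Against \<open>m Y\<close> the
  remainder is a derivative of \<open>V_rem\<close> up to quadratic terms, which costs
  \<open>\<delta>\<^sup>2 / \<kappa>\<^sup>2\<close>; against the second weight it is only
  \<open>O(\<delta>)\<close>, but by \<open>slow_time_bound\<close> that weight has integral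
  \<open>O(\<kappa>)\<close>. The parameter \<kappa> stays free because it is chosen before
  \<delta>.\<close>

lemma nonlin_integral_fast:
  assumes o: "orbit X Y" and fast: "speed X Y 0 \<ge> 1" and \<kappa>: "0 < \<kappa>" "\<kappa> \<le> 1" and "\<delta> \<ge> 0" "C \<ge> 0"
    and w: "\<And>t. t \<in> {0..2 * pi} \<Longrightarrow> (w has_real_derivative w1 t) (at t)"
    and w_le: "\<And>t. t \<in> {0..2 * pi} \<Longrightarrow> \<bar>w t\<bar> \<le> \<delta>" "\<And>t. t \<in> {0..2 * pi} \<Longrightarrow> \<bar>w1 t\<bar> \<le> \<delta>"
    and y: "\<And>t. t \<in> {0..2 * pi} \<Longrightarrow> (y has_real_derivative y1 t) (at t)"
    and y_le: "\<And>t. t \<in> {0..2 * pi} \<Longrightarrow> \<bar>y t\<bar> \<le> C" "\<And>t. t \<in> {0..2 * pi} \<Longrightarrow> \<bar>y1 t\<bar> \<le> C"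
    and I: "\<And>t. t \<in> {0..2 * pi} \<Longrightarrow> (I has_real_derivative y t * nonlin (X t) (w t)) (at t)"
    and t: "t \<in> {0..2 * pi}"
  shows "\<bar>I t - I 0\<bar> \<le> C * (2 * L * (\<Lambda>\<^sup>2 * (2 * pi + (4 * \<Lambda> + 4 * pi * L * \<Lambda>)))) * \<kappa> * \<delta>
    + C * (L * (2 * pi * (2 + \<Lambda>) + 2)) / \<kappa>\<^sup>2 * \<delta>\<^sup>2"
proof -
  \<comment> \<open>The velocity threshold is proportional to the speed, so the bound on the slow
    time depends on \<kappa> but not on the orbit.\<close>
  define \<rho> k where "\<rho> = speed X Y 0" and "k = \<kappa> * \<rho>"
  have "\<rho> \<ge> 1" and "k > 0" and k_ge: "k \<ge> \<kappa>" using fast \<kappa> by (auto simp: \<rho>_def k_def)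
  have k_ratio: "k / \<rho> = \<kappa>" using \<open>\<rho> \<ge> 1\<close> by (simp add: k_def)
  have "\<rho> > 0" using \<open>\<rho> \<ge> 1\<close> by simp
  from slow_time_bound[OF o \<rho>_def this \<open>k > 0\<close>, unfolded k_ratio]
  obtain J J' where JJ: "\<forall>t. (J has_real_derivative J' t) (at t)"
    "\<forall>t\<in>{0..2 * pi}. k\<^sup>2 / ((Y t)\<^sup>2 + k\<^sup>2) \<le> J' t \<and>
      J t - J 0 \<le> \<Lambda>\<^sup>2 * (2 * pi * \<kappa>\<^sup>2 + (4 * \<Lambda> + 4 * pi * L * \<Lambda>) * \<kappa>)"
    by (elim exE conjE)
  have J: "(J has_real_derivative J' s) (at s)" for s using JJ(1) by blast
  have J': "k\<^sup>2 / ((Y s)\<^sup>2 + k\<^sup>2) \<le> J' s" if "s \<in> {0..2 * pi}" for s using JJ(2) that by blast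
  have Jt: "J t - J 0 \<le> \<Lambda>\<^sup>2 * (2 * pi * \<kappa>\<^sup>2 + (4 * \<Lambda> + 4 * pi * L * \<Lambda>) * \<kappa>)" using JJ(2) t by blast
  define Z where "Z t = - f (X t)" for t
  have dX: "(X has_real_derivative Y t) (at t)" for t by (rule orbit_deriv(1)[OF o])
  have dY: "(Y has_real_derivative Z t) (at t)" for t
    using orbit_deriv(2)[OF o] by (simp add: Z_def)
  have Zb: "\<bar>Z t\<bar> \<le> \<Lambda> * \<rho>" if "t \<in> {0..2 * pi}" for t
    using speed_compare[OF o, of t 0] speed_ge(2)[where X = X and Y = Y and t = t] that by (auto simp: Z_def \<rho>_def)
  have pos: "(Y t)\<^sup>2 + k\<^sup>2 > 0" for t using \<open>k > 0\<close> by (simp add: add_nonneg_pos)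
  define m m' where "m t = Y t / ((Y t)\<^sup>2 + k\<^sup>2)"
    and "m' t = Z t * (k\<^sup>2 - (Y t)\<^sup>2) / ((Y t)\<^sup>2 + k\<^sup>2)\<^sup>2" for t
  have dm: "(m has_real_derivative m' t) (at t)" for t
    unfolding m_def m'_def using pos[of t]
    by (auto intro!: derivative_eq_intros dY simp: field_simps power2_eq_square)
  have m_le: "\<bar>m t\<bar> \<le> 1 / \<kappa>\<^sup>2" for t
  proof -
    have "2 * \<bar>Y t\<bar> * k \<le> (Y t)\<^sup>2 + k\<^sup>2" using sum_squares_bound[of "\<bar>Y t\<bar>" k] by simp
    moreover have "0 \<le> \<bar>Y t\<bar> * k" using \<open>k > 0\<close> by simp
    ultimately have "\<bar>Y t\<bar> * k \<le> (Y t)\<^sup>2 + k\<^sup>2" by linarith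
    then have "\<bar>m t\<bar> \<le> 1 / k" unfolding m_def using pos[of t] \<open>k > 0\<close>
      by (simp add: abs_divide divide_le_eq le_divide_eq)
    also have "\<dots> \<le> 1 / \<kappa>" using k_ge \<kappa> by (simp add: frac_le)
    also have "\<dots> \<le> 1 / \<kappa>\<^sup>2" using \<kappa> by (simp add: power2_eq_square frac_le mult_left_le_one_le)
    finally show ?thesis .
  qed
  \<comment> \<open>The acceleration brings one factor \<rho>, which
    \<open>k\<^sup>2 = \<kappa>\<^sup>2 \<rho>\<^sup>2\<close> outweighs since
    \<open>\<rho> \<ge> 1\<close>.\<close>
  have m'_le: "\<bar>m' t\<bar> \<le> \<Lambda> / \<kappa>\<^sup>2" if "t \<in> {0..2 * pi}" for t
  proof -
    have "\<bar>k\<^sup>2 - (Y t)\<^sup>2\<bar> \<le> (Y t)\<^sup>2 + k\<^sup>2" by (simp add: abs_le_iff)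
    then have "\<bar>Z t\<bar> * \<bar>k\<^sup>2 - (Y t)\<^sup>2\<bar> \<le> (\<Lambda> * \<rho>) * ((Y t)\<^sup>2 + k\<^sup>2)"
      using Zb[OF that] \<Lambda>_ge_1 \<open>\<rho> \<ge> 1\<close> by (intro mult_mono) auto
    then have "\<bar>m' t\<bar> \<le> (\<Lambda> * \<rho>) / ((Y t)\<^sup>2 + k\<^sup>2)"
      unfolding m'_def using pos[of t] by (simp add: abs_mult abs_divide divide_le_eq power2_eq_square[of "(Y t)\<^sup>2 + k\<^sup>2"])
    also have "\<dots> \<le> (\<Lambda> * \<rho>) / k\<^sup>2"
      using \<open>k > 0\<close> \<Lambda>_ge_1 \<open>\<rho> \<ge> 1\<close> by (intro divide_left_mono mult_pos_pos pos) auto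
    also have "\<dots> = \<Lambda> / (\<kappa>\<^sup>2 * \<rho>)" using \<open>\<rho> \<ge> 1\<close> \<kappa> by (simp add: k_def field_simps power2_eq_square)
    also have "\<dots> \<le> \<Lambda> / (\<kappa>\<^sup>2 * 1)"
      using \<open>\<rho> \<ge> 1\<close> \<kappa> \<Lambda>_ge_1 by (intro divide_left_mono mult_left_mono) auto
    finally show ?thesis by simp
  qed
  define B D where "B t = V_rem (X t) (w t)" and "D t = f (X t + w t) - f (X t)" for t
  have dB: "(B has_real_derivative nonlin (X t) (w t) * Y t + D t * w1 t) (at t)" if "t \<in> {0..2 * pi}" for t
    unfolding B_def V_rem_def D_def nonlin_def
    by (auto intro!: derivative_eq_intros DERIV_chain2[OF V_deriv] DERIV_chain2[OF f_deriv] dX w[OF that] simp: algebra_simps)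
  have B_le: "\<bar>B t\<bar> \<le> L * \<delta>\<^sup>2" if "t \<in> {0..2 * pi}" for t
  proof -
    have "(w t)\<^sup>2 \<le> \<delta>\<^sup>2" using power_mono[OF w_le(1)[OF that], of 2] by simp
    then have "L * (w t)\<^sup>2 \<le> L * \<delta>\<^sup>2" using L_nonneg by (intro mult_left_mono)
    then show ?thesis using V_rem_bound[of "X t" "w t"] by (simp add: B_def)
  qed
  have D_le: "\<bar>D t\<bar> \<le> L * \<delta>" if "t \<in> {0..2 * pi}" for t
    using f_lipschitz[of "X t + w t" "X t"] mult_left_mono[OF w_le(1)[OF that] L_nonneg] by (simp add: D_def)
  \<comment> \<open>integration by parts: \<open>nonlin X w\<close> times \<open>Y\<close> is \<open>B' - D w'\<close>, and \<open>1 - m Y\<close> is small in the mean\<close>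
  define h where "h t = I t - y t * m t * B t" for t
  define h' where "h' t = y t * nonlin (X t) (w t) * (k\<^sup>2 / ((Y t)\<^sup>2 + k\<^sup>2))
      - y1 t * m t * B t - y t * m' t * B t - y t * m t * (D t * w1 t)" for t
  have dh: "(h has_real_derivative h' t) (at t)" if "t \<in> {0..2 * pi}" for t
  proof -
    have e: "k\<^sup>2 / ((Y t)\<^sup>2 + k\<^sup>2) = 1 - m t * Y t"
      using pos[of t] \<open>k > 0\<close> by (simp add: m_def power2_eq_square eq_diff_eq add_divide_distrib[symmetric])
    show ?thesis unfolding h_def h'_def e
      by (auto intro!: derivative_eq_intros I[OF that] y[OF that] dm dB[OF that] simp: algebra_simps)
  qed
  define c where "c = C * L * (2 + \<Lambda>) / \<kappa>\<^sup>2 * \<delta>\<^sup>2"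
  have h'_le: "\<bar>h' t\<bar> \<le> (C * (2 * L * \<delta>)) * J' t + c" if T: "t \<in> {0..2 * pi}" for t
  proof -
    have "\<bar>y t * nonlin (X t) (w t) * (k\<^sup>2 / ((Y t)\<^sup>2 + k\<^sup>2))\<bar> \<le> (C * (2 * L * \<delta>)) * J' t"
    proof -
      have "2 * L * \<bar>w t\<bar> \<le> 2 * L * \<delta>" using w_le(1)[OF T] L_nonneg by (intro mult_left_mono) auto
      then have "\<bar>nonlin (X t) (w t)\<bar> \<le> 2 * L * \<delta>" using nonlin_bound[of "X t" "w t"] by linarith
      then show ?thesis unfolding abs_mult using y_le(1)[OF T] J'[OF T] \<open>C \<ge> 0\<close> L_nonneg \<open>\<delta> \<ge> 0\<close> pos[of t]
        by (intro mult_mono) (auto simp: abs_of_nonneg)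
    qed
    moreover have "\<bar>y1 t * m t * B t\<bar> \<le> C * (1 / \<kappa>\<^sup>2) * (L * \<delta>\<^sup>2)"
      unfolding abs_mult using y_le(2)[OF T] m_le B_le[OF T] \<open>C \<ge> 0\<close> by (intro mult_mono) auto
    moreover have "\<bar>y t * m' t * B t\<bar> \<le> C * (\<Lambda> / \<kappa>\<^sup>2) * (L * \<delta>\<^sup>2)"
      unfolding abs_mult using y_le(1)[OF T] m'_le[OF T] B_le[OF T] \<open>C \<ge> 0\<close> \<Lambda>_ge_1 by (intro mult_mono) auto
    moreover have "\<bar>y t * m t * (D t * w1 t)\<bar> \<le> C * (1 / \<kappa>\<^sup>2) * (L * \<delta> * \<delta>)"
      unfolding abs_mult using y_le(1)[OF T] m_le D_le[OF T] w_le(2)[OF T] \<open>C \<ge> 0\<close> \<open>\<delta> \<ge> 0\<close> L_nonneg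
      by (intro mult_mono) auto
    moreover have "C * (1 / \<kappa>\<^sup>2) * (L * \<delta>\<^sup>2) + C * (\<Lambda> / \<kappa>\<^sup>2) * (L * \<delta>\<^sup>2) + C * (1 / \<kappa>\<^sup>2) * (L * \<delta> * \<delta>) = c"
      using \<kappa> by (simp add: c_def field_simps power2_eq_square)
    ultimately show ?thesis unfolding h'_def by linarith
  qed
  have "norm (h t - h 0) \<le> (C * (2 * L * \<delta>)) * J t + c * t - ((C * (2 * L * \<delta>)) * J 0 + c * 0)"
  proof (rule norm_diff_le_of_deriv_le[where h' = h' and k' = "\<lambda>t. (C * (2 * L * \<delta>)) * J' t + c"])
    show "(h has_vector_derivative h' s) (at s)" if "s \<in> {0..t}" for s
      using dh[of s] that t by (simp add: has_real_derivative_iff_has_vector_derivative)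
    show "((\<lambda>t. C * (2 * L * \<delta>) * J t + c * t) has_real_derivative C * (2 * L * \<delta>) * J' s + c) (at s)" for s
      by (auto intro!: derivative_eq_intros J)
    show "norm (h' s) \<le> C * (2 * L * \<delta>) * J' s + c" if "s \<in> {0..t}" for s
      using h'_le[of s] that t by simp
  qed (use t in auto)
  then have 1: "\<bar>h t - h 0\<bar> \<le> (C * (2 * L * \<delta>)) * (J t - J 0) + c * t" by (simp add: algebra_simps)
  have cnn: "c \<ge> 0" unfolding c_def using \<open>C \<ge> 0\<close> L_nonneg \<Lambda>_ge_1 by simp
  have 2: "c * t \<le> c * (2 * pi)" using t cnn by (intro mult_left_mono) auto
  have "\<kappa>\<^sup>2 \<le> \<kappa>" using \<kappa> by (simp add: power2_eq_square mult_left_le_one_le)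
  then have "\<Lambda>\<^sup>2 * (2 * pi * \<kappa>\<^sup>2 + (4 * \<Lambda> + 4 * pi * L * \<Lambda>) * \<kappa>) \<le> \<Lambda>\<^sup>2 * (2 * pi * \<kappa> + (4 * \<Lambda> + 4 * pi * L * \<Lambda>) * \<kappa>)"
    by (intro mult_left_mono add_right_mono) auto
  with Jt have 3: "(C * (2 * L * \<delta>)) * (J t - J 0) \<le> (C * (2 * L * \<delta>)) * (\<Lambda>\<^sup>2 * (2 * pi * \<kappa> + (4 * \<Lambda> + 4 * pi * L * \<Lambda>) * \<kappa>))"
    using \<open>C \<ge> 0\<close> L_nonneg \<open>\<delta> \<ge> 0\<close> by (intro mult_left_mono) auto
  have ymB: "\<bar>y s * m s * B s\<bar> \<le> C * (1 / \<kappa>\<^sup>2) * (L * \<delta>\<^sup>2)" if "s \<in> {0..2 * pi}" for s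
    unfolding abs_mult using y_le(1)[OF that] m_le B_le[OF that] \<open>C \<ge> 0\<close> by (intro mult_mono) auto
  have "\<bar>I t - I 0\<bar> \<le> \<bar>h t - h 0\<bar> + 2 * (C * (1 / \<kappa>\<^sup>2) * (L * \<delta>\<^sup>2))"
    using ymB[OF t] ymB[of 0] by (simp add: h_def)
  also have "\<dots> \<le> (C * (2 * L * \<delta>)) * (\<Lambda>\<^sup>2 * (2 * pi * \<kappa> + (4 * \<Lambda> + 4 * pi * L * \<Lambda>) * \<kappa>)) + c * (2 * pi)
      + 2 * (C * (1 / \<kappa>\<^sup>2) * (L * \<delta>\<^sup>2))" using 1 2 3 by linarith
  also have "\<dots> = C * (2 * L * (\<Lambda>\<^sup>2 * (2 * pi + (4 * \<Lambda> + 4 * pi * L * \<Lambda>)))) * \<kappa> * \<delta>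
    + C * (L * (2 * pi * (2 + \<Lambda>) + 2)) / \<kappa>\<^sup>2 * \<delta>\<^sup>2"
    using \<kappa> by (simp add: c_def field_simps)
  finally show ?thesis .
qed

text \<open>Orbits of speed at most \<open>1\<close> stay in a fixed compact set; on a neighbourhood
  of width \<open>1\<close> of it \<open>f2\<close> is uniformly continuous, so
  \<open>nonlin\<close> is small pointwise. The threshold does not depend on the bound
  \<open>C\<close> for \<open>y\<close>.\<close>

lemma nonlin_integral_slow:
  assumes "e > 0"
  shows "\<exists>\<delta>0>0. \<forall>\<delta> C X Y w y I t. \<delta> \<le> \<delta>0 \<longrightarrow> C \<ge> 0 \<longrightarrow> orbit X Y \<longrightarrow> speed X Y 0 \<le> 1 \<longrightarrow>
    (\<forall>t\<in>{0..2 * pi}. \<bar>w t\<bar> \<le> \<delta> \<and> \<bar>y t\<bar> \<le> C \<and> (I has_real_derivative y t * nonlin (X t) (w t)) (at t)) \<longrightarrow>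
    t \<in> {0..2 * pi} \<longrightarrow> \<bar>I t - I 0\<bar> \<le> C * e * 2 * pi * \<delta>"
proof -
  define R where "R = 2 * pi * \<Lambda>"
  have "uniformly_continuous_on {- R - 1..R + 1} f2"
    by (intro compact_uniformly_continuous continuous_on_subset[OF f2_cont]) auto
  then obtain d where "d > 0" and d: "\<And>x y. \<lbrakk>x \<in> {- R - 1..R + 1}; y \<in> {- R - 1..R + 1}; dist y x < d\<rbrakk> \<Longrightarrow> dist (f2 y) (f2 x) < e"
    using \<open>e > 0\<close> unfolding uniformly_continuous_on_def by metis
  define \<delta>0 where "\<delta>0 = min 1 (d / 2)"
  have "\<bar>I t - I 0\<bar> \<le> C * e * 2 * pi * \<delta>"
    if \<delta>: "\<delta> \<le> \<delta>0" and "C \<ge> 0" and o: "orbit X Y" and slow: "speed X Y 0 \<le> 1"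
    and H: "\<forall>t\<in>{0..2 * pi}. \<bar>w t\<bar> \<le> \<delta> \<and> \<bar>y t\<bar> \<le> C \<and> (I has_real_derivative y t * nonlin (X t) (w t)) (at t)"
    and t: "t \<in> {0..2 * pi}" for \<delta> C X Y w y I t
  proof -
    have "\<delta> \<ge> 0" using H t by force
    have A: "\<bar>nonlin (X s) (w s)\<bar> \<le> e * \<delta>" if s: "s \<in> {0..2 * pi}" for s
    proof -
      have "2 * pi * \<Lambda> * speed X Y 0 \<le> R * 1" unfolding R_def
        using slow \<Lambda>_ge_1 by (intro mult_left_mono) auto
      then have X: "\<bar>X s\<bar> \<le> R" using orbit_amplitude[OF o s] by simp
      have ws: "\<bar>w s\<bar> \<le> \<delta>" using H s by blast
      have "\<bar>nonlin (X s) (w s)\<bar> \<le> e * \<bar>w s\<bar>"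
      proof (rule nonlin_small)
        fix r assume "\<bar>r\<bar> \<le> \<bar>w s\<bar>"
        then have "\<bar>r\<bar> \<le> 1" "\<bar>r\<bar> < d" using ws \<delta> \<open>d > 0\<close> by (auto simp: \<delta>0_def)
        then show "\<bar>f2 (X s + r) - f2 (X s)\<bar> \<le> e"
          using d[of "X s" "X s + r"] X by (simp add: dist_real_def abs_le_iff less_imp_le)
      qed
      also have "\<dots> \<le> e * \<delta>" using ws \<open>e > 0\<close> by (intro mult_left_mono) auto
      finally show ?thesis .
    qed
    have "norm (I t - I 0) \<le> (C * (e * \<delta>)) * norm (t - 0)"
    proof (rule field_differentiable_bound[where S = "{0..2 * pi}" and f' = "\<lambda>t. y t * nonlin (X t) (w t)"])
      show "norm (y s * nonlin (X s) (w s)) \<le> C * (e * \<delta>)" if "s \<in> {0..2 * pi}" for s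
        unfolding real_norm_def abs_mult using A[OF that] H that \<open>C \<ge> 0\<close> by (intro mult_mono) auto
      show "(I has_real_derivative y s * nonlin (X s) (w s)) (at s within {0..2 * pi})" if "s \<in> {0..2 * pi}" for s
        by (rule has_field_derivative_at_within) (use H that in blast)
    qed (use t in auto)
    also have "\<dots> \<le> (C * (e * \<delta>)) * (2 * pi)"
      using t \<open>C \<ge> 0\<close> \<open>e > 0\<close> \<open>\<delta> \<ge> 0\<close> by (intro mult_left_mono) auto
    finally show ?thesis by (simp add: mult_ac)
  qed
  then show ?thesis using \<open>d > 0\<close> by (intro exI[of _ \<delta>0]) (auto simp: \<delta>0_def)
qed

text \<open>
  The bound is uniform over all orbits although \<open>f2\<close> need not be uniformly continuous, so that
  \<open>nonlin\<close> itself need not be uniformly of higher order in \<open>w\<close>.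
\<close>

lemma nonlin_integral_small:
  assumes "\<eta> > 0" "C \<ge> 0"
  shows "\<exists>\<delta>0>0. \<forall>\<delta> X Y w w1 y y1 I t. \<delta> \<le> \<delta>0 \<longrightarrow> orbit X Y \<longrightarrow>
    (\<forall>t\<in>{0..2 * pi}. (w has_real_derivative w1 t) (at t) \<and> \<bar>w t\<bar> \<le> \<delta> \<and> \<bar>w1 t\<bar> \<le> \<delta> \<and>
      (y has_real_derivative y1 t) (at t) \<and> \<bar>y t\<bar> \<le> C \<and> \<bar>y1 t\<bar> \<le> C \<and>
      (I has_real_derivative y t * nonlin (X t) (w t)) (at t)) \<longrightarrow>
    t \<in> {0..2 * pi} \<longrightarrow> \<bar>I t - I 0\<bar> \<le> \<eta> * \<delta>"
proof -
  define M1 M2 where "M1 = C * (2 * L * (\<Lambda>\<^sup>2 * (2 * pi + (4 * \<Lambda> + 4 * pi * L * \<Lambda>))))"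
    and "M2 = C * (L * (2 * pi * (2 + \<Lambda>) + 2))"
  have M: "M1 \<ge> 0" "M2 \<ge> 0"
    unfolding M1_def M2_def using \<open>C \<ge> 0\<close> L_nonneg \<Lambda>_ge_1 by (auto intro!: mult_nonneg_nonneg add_nonneg_nonneg)
  \<comment> \<open>First \<kappa> makes the linear term at most half of
    \<open>\<eta> * \<delta>\<close>; then \<open>\<delta>1\<close>, of order
    \<open>\<kappa>\<^sup>2\<close>, does the same for the quadratic term. The summands
    \<open>1\<close> guard against \<open>M1 = 0\<close> and \<open>M2 = 0\<close>.\<close>
  define \<kappa> where "\<kappa> = min 1 (\<eta> / (2 * (M1 + 1)))"
  have \<kappa>: "0 < \<kappa>" "\<kappa> \<le> 1" using \<open>\<eta> > 0\<close> M by (auto simp: \<kappa>_def)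
  have "(M1 + 1) * \<kappa> \<le> (M1 + 1) * (\<eta> / (2 * (M1 + 1)))"
    using M by (intro mult_left_mono) (auto simp: \<kappa>_def)
  also have "\<dots> = \<eta> / 2"
  proof -
    have "n * (\<eta> / (2 * n)) = \<eta> / 2" if "n > 0" for n :: real using that by simp
    from this[of "M1 + 1"] M show ?thesis by simp
  qed
  finally have "M1 * \<kappa> + \<kappa> \<le> \<eta> / 2" by (simp add: algebra_simps)
  then have k1: "M1 * \<kappa> \<le> \<eta> / 2" using \<kappa> by linarith
  define \<delta>1 where "\<delta>1 = \<eta> * \<kappa>\<^sup>2 / (2 * (M2 + 1))"
  have "\<delta>1 > 0" using \<open>\<eta> > 0\<close> \<kappa> M by (simp add: \<delta>1_def)
  have k2: "M2 / \<kappa>\<^sup>2 * \<delta> \<le> \<eta> / 2" if "0 \<le> \<delta>" "\<delta> \<le> \<delta>1" for \<delta>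
  proof -
    have "M2 / \<kappa>\<^sup>2 * \<delta> \<le> (M2 + 1) / \<kappa>\<^sup>2 * \<delta>1"
      using that M \<kappa> by (intro mult_mono divide_right_mono) auto
    also have "\<dots> = \<eta> / 2"
    proof -
      have "n / k * (\<eta> * k / (2 * n)) = \<eta> / 2" if "n > 0" "k > 0" for n k :: real using that by simp
      from this[of "M2 + 1" "\<kappa>\<^sup>2"] M \<kappa> show ?thesis by (simp add: \<delta>1_def)
    qed
    finally show ?thesis .
  qed
  define e where "e = \<eta> / (2 * pi * (C + 1))"
  have "e > 0" using \<open>\<eta> > 0\<close> \<open>C \<ge> 0\<close> by (simp add: e_def)
  have Ce: "C * e * 2 * pi \<le> \<eta>"
  proof -
    have "C * (\<eta> / (2 * pi * n)) * 2 * pi = \<eta> * (C / n)" if "n > 0" for n :: real using that by simp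
    from this[of "C + 1"] have "C * e * 2 * pi = \<eta> * (C / (C + 1))" using \<open>C \<ge> 0\<close> by (simp add: e_def)
    also have "\<dots> \<le> \<eta> * 1" using \<open>\<eta> > 0\<close> \<open>C \<ge> 0\<close> by (intro mult_left_mono) auto
    finally show ?thesis by simp
  qed
  obtain \<delta>2 where "\<delta>2 > 0" and \<delta>2: "\<forall>\<delta> C X Y w y I t. \<delta> \<le> \<delta>2 \<longrightarrow> C \<ge> 0 \<longrightarrow> orbit X Y \<longrightarrow> speed X Y 0 \<le> 1 \<longrightarrow>
    (\<forall>t\<in>{0..2 * pi}. \<bar>w t\<bar> \<le> \<delta> \<and> \<bar>y t\<bar> \<le> C \<and> (I has_real_derivative y t * nonlin (X t) (w t)) (at t)) \<longrightarrow>
    t \<in> {0..2 * pi} \<longrightarrow> \<bar>I t - I 0\<bar> \<le> C * e * 2 * pi * \<delta>"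
    using nonlin_integral_slow[OF \<open>e > 0\<close>] by (elim exE conjE)
  have "\<bar>I t - I 0\<bar> \<le> \<eta> * \<delta>"
    if "\<delta> \<le> min \<delta>1 \<delta>2" and o: "orbit X Y" and H: "\<forall>t\<in>{0..2 * pi}. (w has_real_derivative w1 t) (at t) \<and> \<bar>w t\<bar> \<le> \<delta> \<and> \<bar>w1 t\<bar> \<le> \<delta> \<and>
      (y has_real_derivative y1 t) (at t) \<and> \<bar>y t\<bar> \<le> C \<and> \<bar>y1 t\<bar> \<le> C \<and>
      (I has_real_derivative y t * nonlin (X t) (w t)) (at t)" and t: "t \<in> {0..2 * pi}"
    for \<delta> X Y w w1 y y1 I t
  proof -
    have "\<delta> \<ge> 0" using H t by force
    show ?thesis
    proof (cases "speed X Y 0 \<le> 1")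
      case True
      have "\<bar>I t - I 0\<bar> \<le> C * e * 2 * pi * \<delta>"
        by (rule \<delta>2[rule_format, of \<delta> C X Y w y I t]) (use that True \<open>C \<ge> 0\<close> in auto)
      also have "\<dots> \<le> \<eta> * \<delta>" using Ce \<open>\<delta> \<ge> 0\<close> by (intro mult_right_mono)
      finally show ?thesis .
    next
      case False
      have "\<bar>I t - I 0\<bar> \<le> M1 * \<kappa> * \<delta> + M2 / \<kappa>\<^sup>2 * \<delta>\<^sup>2"
        unfolding M1_def M2_def
        by (rule nonlin_integral_fast[OF o _ \<kappa> \<open>\<delta> \<ge> 0\<close> \<open>C \<ge> 0\<close>, of w w1 y y1]) (use False H t in auto)
      also have "\<dots> = (M1 * \<kappa> + M2 / \<kappa>\<^sup>2 * \<delta>) * \<delta>" by (simp add: power2_eq_square algebra_simps)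
      also have "\<dots> \<le> (\<eta> / 2 + \<eta> / 2) * \<delta>"
        using k1 k2[of \<delta>] that(1) \<open>\<delta> \<ge> 0\<close> by (intro mult_right_mono add_mono) auto
      finally show ?thesis by simp
    qed
  qed
  note est = this
  have "min \<delta>1 \<delta>2 > 0" using \<open>\<delta>1 > 0\<close> \<open>\<delta>2 > 0\<close> by simp
  then show ?thesis by (intro exI[of _ "min \<delta>1 \<delta>2"] conjI allI impI) (assumption, rule est)
qed

text \<open>The factor \<open>3\<close> is the square root of \<open>1 + 1 + 7\<close>: two initial
  terms, and \<open>2 * pi \<le> 7\<close> for the forcing.\<close>

lemma forced_deviation_bound:
  assumes "\<beta> \<ge> 0"
    and w: "\<And>t. t \<in> {0..2 * pi} \<Longrightarrow> (w has_real_derivative a t + b t) (at t)"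
    and a: "\<And>t. t \<in> {0..2 * pi} \<Longrightarrow> (a has_real_derivative - (f (X t + w t) - f (X t))) (at t)"
    and b: "\<And>t. t \<in> {0..2 * pi} \<Longrightarrow> \<bar>b t\<bar> \<le> \<beta>"
    and init: "\<bar>w 0\<bar> \<le> \<beta>" "\<bar>a 0\<bar> \<le> \<beta>" and t: "t \<in> {0..2 * pi}"
  shows "\<bar>w t\<bar> \<le> 3 * \<Lambda> * \<beta>" "\<bar>a t\<bar> \<le> 3 * \<Lambda> * \<beta>"
proof -
  have "(norm (w t))\<^sup>2 + (norm (a t))\<^sup>2
    \<le> ((norm (w 0))\<^sup>2 + (norm (a 0))\<^sup>2 + \<beta>\<^sup>2 * (t - 0)) * exp ((2 + L) * (t - 0))"
  proof (rule gronwall_forward[where b = b and d = "\<lambda>t. - (f (X t + w t) - f (X t))"])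
    show "norm (- (f (X u + w u) - f (X u))) \<le> L * norm (w u)" for u
      using f_lipschitz[of "X u + w u" "X u"] by simp
  qed (use assms L_nonneg in \<open>auto simp: has_real_derivative_iff_has_vector_derivative\<close>)
  also have "\<dots> \<le> (\<beta>\<^sup>2 + \<beta>\<^sup>2 + \<beta>\<^sup>2 * 7) * exp ((2 + L) * (2 * pi))"
  proof (rule mult_mono)
    have "(norm (w 0))\<^sup>2 \<le> \<beta>\<^sup>2" "(norm (a 0))\<^sup>2 \<le> \<beta>\<^sup>2"
      using power_mono[OF init(1), of 2] power_mono[OF init(2), of 2] by auto
    moreover have "\<beta>\<^sup>2 * (t - 0) \<le> \<beta>\<^sup>2 * 7" using t pi_less_4 pi_approx by (intro mult_left_mono) auto
    ultimately show "(norm (w 0))\<^sup>2 + (norm (a 0))\<^sup>2 + \<beta>\<^sup>2 * (t - 0) \<le> \<beta>\<^sup>2 + \<beta>\<^sup>2 + \<beta>\<^sup>2 * 7" by linarith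
  qed (use t L_nonneg in auto)
  also have "exp ((2 + L) * (2 * pi)) = \<Lambda>\<^sup>2" by (simp add: \<Lambda>_def power2_eq_square flip: exp_add)
  also have "(\<beta>\<^sup>2 + \<beta>\<^sup>2 + \<beta>\<^sup>2 * 7) * \<Lambda>\<^sup>2 = (3 * \<Lambda> * \<beta>)\<^sup>2" by (simp add: power2_eq_square)
  finally have *: "\<bar>w t\<bar>\<^sup>2 + \<bar>a t\<bar>\<^sup>2 \<le> (3 * \<Lambda> * \<beta>)\<^sup>2" by simp
  have nn: "3 * \<Lambda> * \<beta> \<ge> 0" using \<open>\<beta> \<ge> 0\<close> \<Lambda>_ge_1 by simp
  have "\<bar>w t\<bar>\<^sup>2 \<le> (3 * \<Lambda> * \<beta>)\<^sup>2" "\<bar>a t\<bar>\<^sup>2 \<le> (3 * \<Lambda> * \<beta>)\<^sup>2" using * by (smt (verit) zero_le_power2)+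
  then show "\<bar>w t\<bar> \<le> 3 * \<Lambda> * \<beta>" "\<bar>a t\<bar> \<le> 3 * \<Lambda> * \<beta>" using nn power2_le_imp_le by blast+
qed

definition linearised :: "(real \<Rightarrow> real) \<Rightarrow> (real \<Rightarrow> real) \<Rightarrow> (real \<Rightarrow> real) \<Rightarrow> bool" where
  "linearised X y y1 \<longleftrightarrow> (\<forall>t. (y has_real_derivative y1 t) (at t) \<and> (y1 has_real_derivative - (f2 (X t) * y t)) (at t))"

text \<open>
  \<open>w = x - X\<close> is the deviation of a forced solution from an orbit, and \<open>a = w' - b\<close>, where \<open>b\<close> is a
  primitive of the forcing; in this form no derivative of \<open>b\<close> is needed.
\<close>

lemma wronskian_estimate:
  assumes "\<eta> > 0"
  shows "\<exists>\<beta>0>0. \<forall>\<beta> X Y w a b y y1 Q t. 0 \<le> \<beta> \<longrightarrow> \<beta> \<le> \<beta>0 \<longrightarrow> orbit X Y \<longrightarrow> linearised X y y1 \<longrightarrow>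
    (\<forall>t\<in>{0..2 * pi}. (w has_real_derivative a t + b t) (at t) \<and>
      (a has_real_derivative - (f (X t + w t) - f (X t))) (at t) \<and> \<bar>b t\<bar> \<le> \<beta> \<and>
      \<bar>y t\<bar> \<le> 2 * \<Lambda> \<and> \<bar>y1 t\<bar> \<le> 2 * \<Lambda> \<and> (Q has_real_derivative y1 t * b t) (at t)) \<longrightarrow>
    \<bar>w 0\<bar> \<le> \<beta> \<longrightarrow> \<bar>a 0\<bar> \<le> \<beta> \<longrightarrow> t \<in> {0..2 * pi} \<longrightarrow>
    \<bar>y t * a t - y1 t * w t - (y 0 * a 0 - y1 0 * w 0) + (Q t - Q 0)\<bar> \<le> \<eta> * \<beta>"
proof -
  \<comment> \<open>\<open>3 * \<Lambda> * \<beta>\<close> bounds \<open>w\<close> and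
    \<open>a\<close>; one more \<beta> leads from \<open>a\<close> to
    \<open>w' = a + b\<close>.\<close>
  define c where "c = 3 * \<Lambda> + 1"
  have "c > 0" using \<Lambda>_ge_1 by (simp add: c_def)
  have "\<eta> / c > 0" "2 * \<Lambda> \<ge> 0" using \<open>\<eta> > 0\<close> \<open>c > 0\<close> \<Lambda>_ge_1 by auto
  from nonlin_integral_small[OF this]
  obtain \<delta>0 where "\<delta>0 > 0" and \<delta>0: "\<forall>\<delta> X Y w w1 y y1 I t. \<delta> \<le> \<delta>0 \<longrightarrow> orbit X Y \<longrightarrow>
    (\<forall>t\<in>{0..2 * pi}. (w has_real_derivative w1 t) (at t) \<and> \<bar>w t\<bar> \<le> \<delta> \<and> \<bar>w1 t\<bar> \<le> \<delta> \<and>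
      (y has_real_derivative y1 t) (at t) \<and> \<bar>y t\<bar> \<le> 2 * \<Lambda> \<and> \<bar>y1 t\<bar> \<le> 2 * \<Lambda> \<and>
      (I has_real_derivative y t * nonlin (X t) (w t)) (at t)) \<longrightarrow>
    t \<in> {0..2 * pi} \<longrightarrow> \<bar>I t - I 0\<bar> \<le> \<eta> / c * \<delta>" by (elim exE conjE)
  have "\<bar>y t * a t - y1 t * w t - (y 0 * a 0 - y1 0 * w 0) + (Q t - Q 0)\<bar> \<le> \<eta> * \<beta>"
    if "0 \<le> \<beta>" "\<beta> \<le> \<delta>0 / c" and o: "orbit X Y" and lin: "linearised X y y1"
    and H: "\<forall>t\<in>{0..2 * pi}. (w has_real_derivative a t + b t) (at t) \<and>
      (a has_real_derivative - (f (X t + w t) - f (X t))) (at t) \<and> \<bar>b t\<bar> \<le> \<beta> \<and>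
      \<bar>y t\<bar> \<le> 2 * \<Lambda> \<and> \<bar>y1 t\<bar> \<le> 2 * \<Lambda> \<and> (Q has_real_derivative y1 t * b t) (at t)"
    and init: "\<bar>w 0\<bar> \<le> \<beta>" "\<bar>a 0\<bar> \<le> \<beta>" and t: "t \<in> {0..2 * pi}" for \<beta> X Y w a b y y1 Q t
  proof -
    \<comment> \<open>The Wronskian \<open>y a - y1 w\<close> has derivative
      \<open>- y * nonlin X w - y1 * b\<close>; adding \<open>Q\<close> removes the forcing.\<close>
    define I where "I t = - (y t * a t - y1 t * w t) - Q t" for t
    have dI: "(I has_real_derivative y s * nonlin (X s) (w s)) (at s)" if "s \<in> {0..2 * pi}" for s
    proof -
      have d: "(w has_real_derivative a s + b s) (at s)" "(a has_real_derivative - (f (X s + w s) - f (X s))) (at s)"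
        "(Q has_real_derivative y1 s * b s) (at s)" using H that by auto
      have l: "(y has_real_derivative y1 s) (at s)" "(y1 has_real_derivative - (f2 (X s) * y s)) (at s)"
        using lin by (auto simp: linearised_def)
      show ?thesis unfolding I_def nonlin_def
        by (rule DERIV_cong[OF DERIV_diff[OF DERIV_minus[OF DERIV_diff[OF DERIV_mult[OF l(1) d(2)]
                  DERIV_mult[OF l(2) d(1)]]] d(3)]]) (simp add: algebra_simps)
    qed
    have wa: "\<bar>w s\<bar> \<le> 3 * \<Lambda> * \<beta>" "\<bar>a s\<bar> \<le> 3 * \<Lambda> * \<beta>" if "s \<in> {0..2 * pi}" for s
      using forced_deviation_bound[of \<beta> w a b X s] H init that \<open>0 \<le> \<beta>\<close> by auto
    have "\<bar>I t - I 0\<bar> \<le> \<eta> / c * (c * \<beta>)"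
    proof (rule \<delta>0[rule_format, of "c * \<beta>" X Y w "\<lambda>s. a s + b s" y y1 I])
      show "c * \<beta> \<le> \<delta>0" using that(2) \<open>c > 0\<close> by (simp add: le_divide_eq mult.commute)
      fix s assume s: "s \<in> {0..2 * pi}"
      have "\<bar>b s\<bar> \<le> \<beta>" using H s by blast
      then have "\<bar>w s\<bar> \<le> c * \<beta>" "\<bar>a s + b s\<bar> \<le> c * \<beta>" using wa[OF s] \<open>0 \<le> \<beta>\<close> by (auto simp: c_def algebra_simps)
      then show "(w has_real_derivative a s + b s) (at s) \<and> \<bar>w s\<bar> \<le> c * \<beta> \<and> \<bar>a s + b s\<bar> \<le> c * \<beta> \<and>
        (y has_real_derivative y1 s) (at s) \<and> \<bar>y s\<bar> \<le> 2 * \<Lambda> \<and> \<bar>y1 s\<bar> \<le> 2 * \<Lambda> \<and>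
        (I has_real_derivative y s * nonlin (X s) (w s)) (at s)"
        using H s dI[OF s] lin by (auto simp: linearised_def)
    qed (use o t in auto)
    moreover have "y t * a t - y1 t * w t - (y 0 * a 0 - y1 0 * w 0) + (Q t - Q 0) = - (I t - I 0)"
      by (simp add: I_def)
    moreover have "\<eta> / c * (c * \<beta>) = \<eta> * \<beta>" using \<open>c > 0\<close> by simp
    ultimately show ?thesis by (simp only: abs_minus_cancel)
  qed
  note est = this
  have "\<delta>0 / c > 0" using \<open>\<delta>0 > 0\<close> \<open>c > 0\<close> by simp
  then show ?thesis by (intro exI[of _ "\<delta>0 / c"] conjI allI impI) (assumption, rule est)
qed

subsection \<open>The linearised flow\<close>

lemma orbit_exists: "\<exists>X Y. orbit X Y \<and> X 0 = a \<and> Y 0 = b"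
  unfolding orbit_def
proof (rule classical_solution_exists)
  have "continuous_on UNIV f"
    using DERIV_isCont[OF f_deriv] by (simp add: continuous_at_imp_continuous_on)
  then have "continuous_on UNIV (\<lambda>p::real \<times> real. f (snd p))"
    by (rule continuous_on_compose2[OF _ continuous_on_snd[OF continuous_on_id]]) simp
  then show "continuous_on UNIV (\<lambda>(t::real, x). - f x)"
    unfolding case_prod_unfold by (rule continuous_on_minus)
  show "norm (- f x - - f y) \<le> L * norm (x - y)" for x y
    using f_lipschitz[of y x] by (simp add: abs_minus_commute)
qed (simp add: f_zero)

lemma orbit_unique:
  assumes "orbit X Y" "orbit X' Y'" "X s = X' s" "Y s = Y' s"
  shows "X = X' \<and> Y = Y'"
proof (rule classical_solution_unique[where F = "\<lambda>t x. - f x" and L = L])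
  show "norm (- f x - - f y) \<le> L * norm (x - y)" for x y
    using f_lipschitz[of y x] by (simp add: abs_minus_commute)
qed (use assms L_nonneg in \<open>auto simp: orbit_def\<close>)

definition clinearised :: "(real \<Rightarrow> real) \<Rightarrow> (real \<Rightarrow> complex) \<Rightarrow> (real \<Rightarrow> complex) \<Rightarrow> bool" where
  "clinearised X y y1 \<longleftrightarrow> classical_solution (\<lambda>t y. - (complex_of_real (f2 (X t)) * y)) y y1"

lemma f2_mult_lipschitz:
  "norm (- (complex_of_real (f2 x) * y) - - (complex_of_real (f2 x) * z)) \<le> L * norm (y - z)"
proof -
  have "- (complex_of_real (f2 x) * y) - - (complex_of_real (f2 x) * z) = - (complex_of_real (f2 x) * (y - z))"
    by (simp add: algebra_simps)
  then show ?thesis using f2_bound[of x] by (simp add: norm_mult mult_right_mono)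
qed

lemma clinearised_exists:
  assumes "orbit X Y"
  shows "\<exists>y y1. clinearised X y y1 \<and> y 0 = a \<and> y1 0 = b"
  unfolding clinearised_def
proof (rule classical_solution_exists[OF _ f2_mult_lipschitz])
  have "continuous_on UNIV X"
    using DERIV_isCont[OF orbit_deriv(1)[OF assms]] by (simp add: continuous_at_imp_continuous_on)
  then have "continuous_on UNIV (\<lambda>t. f2 (X t))"
    by (rule continuous_on_compose2[OF f2_cont]) auto
  then have "continuous_on UNIV (\<lambda>p::real \<times> complex. f2 (X (fst p)))"
    by (rule continuous_on_compose2[OF _ continuous_on_fst[OF continuous_on_id]]) simp
  then show "continuous_on UNIV (\<lambda>(t, y). - (complex_of_real (f2 (X t)) * y))"
    unfolding case_prod_unfold by (intro continuous_intros)
qed simp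

lemma clinearised_unique:
  assumes "clinearised X y y1" "clinearised X z z1" "y s = z s" "y1 s = z1 s"
  shows "y = z \<and> y1 = z1"
  by (rule classical_solution_unique[OF assms(1,2)[unfolded clinearised_def] assms(3,4) f2_mult_lipschitz L_nonneg])

lemma clinearised_deriv:
  assumes "clinearised X y y1"
  shows "(y has_vector_derivative y1 t) (at t)"
    "(y1 has_vector_derivative - (complex_of_real (f2 (X t)) * y t)) (at t)"
  using assms by (auto simp: clinearised_def classical_solution_def)

lemma clinearised_Re_Im:
  assumes "clinearised X y y1"
  shows "linearised X (\<lambda>t. Re (y t)) (\<lambda>t. Re (y1 t))" "linearised X (\<lambda>t. Im (y t)) (\<lambda>t. Im (y1 t))"
  unfolding linearised_def has_real_derivative_iff_has_vector_derivative
  using bounded_linear.has_vector_derivative[OF bounded_linear_Re clinearised_deriv(1)[OF assms]]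
    bounded_linear.has_vector_derivative[OF bounded_linear_Re clinearised_deriv(2)[OF assms]]
    bounded_linear.has_vector_derivative[OF bounded_linear_Im clinearised_deriv(1)[OF assms]]
    bounded_linear.has_vector_derivative[OF bounded_linear_Im clinearised_deriv(2)[OF assms]]
  by simp_all

text \<open>The phase plane is identified with the complex plane by
  \<open>z = x + \<i> x'\<close>.\<close>

definition flow :: "complex \<Rightarrow> (real \<Rightarrow> real) \<times> (real \<Rightarrow> real)" where
  "flow z = (SOME p. orbit (fst p) (snd p) \<and> fst p 0 = Re z \<and> snd p 0 = Im z)"

abbreviation "X z \<equiv> fst (flow z)"
abbreviation "Y z \<equiv> snd (flow z)"

lemma flow: "orbit (X z) (Y z)" "X z 0 = Re z" "Y z 0 = Im z"
proof -
  have "\<exists>p. orbit (fst p) (snd p) \<and> fst p 0 = Re z \<and> snd p 0 = Im z"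
    using orbit_exists[of "Re z" "Im z"] by auto
  from someI_ex[OF this] show "orbit (X z) (Y z)" "X z 0 = Re z" "Y z 0 = Im z"
    by (auto simp: flow_def)
qed

text \<open>One complex solution packs a fundamental system: its real part starts from
  \<open>(1, 0)\<close>, its imaginary part from \<open>(0, 1)\<close>. The base orbit starts at any
  \<open>z\<close>, not only at a turning point.\<close>

definition lin :: "complex \<Rightarrow> (real \<Rightarrow> complex) \<times> (real \<Rightarrow> complex)" where
  "lin z = (SOME p. clinearised (X z) (fst p) (snd p) \<and> fst p 0 = 1 \<and> snd p 0 = \<i>)"

abbreviation "psi z \<equiv> fst (lin z)"
abbreviation "psi1 z \<equiv> snd (lin z)"

lemma lin: "clinearised (X z) (psi z) (psi1 z)" "psi z 0 = 1" "psi1 z 0 = \<i>"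
proof -
  have "\<exists>p. clinearised (X z) (fst p) (snd p) \<and> fst p 0 = 1 \<and> snd p 0 = \<i>"
    using clinearised_exists[OF flow(1)[of z], of 1 \<i>] by auto
  from someI_ex[OF this] show "clinearised (X z) (psi z) (psi1 z)" "psi z 0 = 1" "psi1 z 0 = \<i>"
    by (auto simp: lin_def)
qed

lemma psi_bound:
  assumes "\<bar>t\<bar> \<le> 2 * pi"
  shows "norm (psi z t) \<le> 2 * \<Lambda>" "norm (psi1 z t) \<le> 2 * \<Lambda>"
proof -
  have "(norm (psi z t))\<^sup>2 + (norm (psi1 z t))\<^sup>2
      \<le> ((norm (psi z 0))\<^sup>2 + (norm (psi1 z 0))\<^sup>2) * exp ((2 + L) * \<bar>t - 0\<bar>)"
  proof (rule gronwall_both[where d = "\<lambda>t. - (complex_of_real (f2 (X z t)) * psi z t)"])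
    show "norm (- (complex_of_real (f2 (X z r)) * psi z r)) \<le> L * norm (psi z r)" for r
      using f2_bound by (simp add: norm_mult mult_right_mono)
  qed (rule clinearised_deriv[OF lin(1)] L_nonneg)+
  also have "\<dots> \<le> 2 * exp ((2 + L) * (2 * pi))"
    using assms L_nonneg by (simp add: lin mult_left_mono)
  also have "\<dots> = 2 * \<Lambda>\<^sup>2" by (simp add: \<Lambda>_def power2_eq_square flip: exp_add)
  also have "\<dots> \<le> (2 * \<Lambda>)\<^sup>2" by (simp add: power2_eq_square)
  finally have *: "(norm (psi z t))\<^sup>2 + (norm (psi1 z t))\<^sup>2 \<le> (2 * \<Lambda>)\<^sup>2" .
  have "(norm (psi z t))\<^sup>2 \<le> (2 * \<Lambda>)\<^sup>2" "(norm (psi1 z t))\<^sup>2 \<le> (2 * \<Lambda>)\<^sup>2"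
    using * by (smt (verit) zero_le_power2)+
  then show "norm (psi z t) \<le> 2 * \<Lambda>" "norm (psi1 z t) \<le> 2 * \<Lambda>"
    using \<Lambda>_ge_1 power2_le_imp_le[of _ "2 * \<Lambda>"] by auto
qed

abbreviation "u z t \<equiv> Re (psi z t)"
abbreviation "u1 z t \<equiv> Re (psi1 z t)"
abbreviation "v z t \<equiv> Im (psi z t)"
abbreviation "v1 z t \<equiv> Im (psi1 z t)"

lemma uv_bound:
  assumes "\<bar>t\<bar> \<le> 2 * pi"
  shows "\<bar>u z t\<bar> \<le> 2 * \<Lambda>" "\<bar>u1 z t\<bar> \<le> 2 * \<Lambda>" "\<bar>v z t\<bar> \<le> 2 * \<Lambda>" "\<bar>v1 z t\<bar> \<le> 2 * \<Lambda>"
  using psi_bound[OF assms, of z] abs_Re_le_cmod[of "psi z t"] abs_Re_le_cmod[of "psi1 z t"]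
    abs_Im_le_cmod[of "psi z t"] abs_Im_le_cmod[of "psi1 z t"] by linarith+

text \<open>The real and imaginary parts of \<open>psi z\<close> are treated at once with one
  threshold for all \<open>z\<close>; their initial data turn the two Wronskians at time
  \<open>0\<close> into \<open>a 0\<close> and \<open>- w 0\<close>.\<close>

lemma wronskian_estimate_psi:
  assumes "\<eta> > 0"
  shows "\<exists>\<beta>0>0. \<forall>\<beta> z w a b Q1 Q2 t. 0 \<le> \<beta> \<longrightarrow> \<beta> \<le> \<beta>0 \<longrightarrow>
    (\<forall>t\<in>{0..2 * pi}. (w has_real_derivative a t + b t) (at t) \<and>
      (a has_real_derivative - (f (X z t + w t) - f (X z t))) (at t) \<and> \<bar>b t\<bar> \<le> \<beta> \<and>
      (Q1 has_real_derivative u1 z t * b t) (at t) \<and> (Q2 has_real_derivative v1 z t * b t) (at t)) \<longrightarrow>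
    \<bar>w 0\<bar> \<le> \<beta> \<longrightarrow> \<bar>a 0\<bar> \<le> \<beta> \<longrightarrow> t \<in> {0..2 * pi} \<longrightarrow>
    \<bar>u z t * a t - u1 z t * w t - a 0 + (Q1 t - Q1 0)\<bar> \<le> \<eta> * \<beta> \<and>
    \<bar>v z t * a t - v1 z t * w t + w 0 + (Q2 t - Q2 0)\<bar> \<le> \<eta> * \<beta>"
proof -
  obtain \<beta>0 where "\<beta>0 > 0" and \<beta>0: "\<forall>\<beta> X Y w a b y y1 Q t. 0 \<le> \<beta> \<longrightarrow> \<beta> \<le> \<beta>0 \<longrightarrow> orbit X Y \<longrightarrow> linearised X y y1 \<longrightarrow>
    (\<forall>t\<in>{0..2 * pi}. (w has_real_derivative a t + b t) (at t) \<and>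
      (a has_real_derivative - (f (X t + w t) - f (X t))) (at t) \<and> \<bar>b t\<bar> \<le> \<beta> \<and>
      \<bar>y t\<bar> \<le> 2 * \<Lambda> \<and> \<bar>y1 t\<bar> \<le> 2 * \<Lambda> \<and> (Q has_real_derivative y1 t * b t) (at t)) \<longrightarrow>
    \<bar>w 0\<bar> \<le> \<beta> \<longrightarrow> \<bar>a 0\<bar> \<le> \<beta> \<longrightarrow> t \<in> {0..2 * pi} \<longrightarrow>
    \<bar>y t * a t - y1 t * w t - (y 0 * a 0 - y1 0 * w 0) + (Q t - Q 0)\<bar> \<le> \<eta> * \<beta>"
    using wronskian_estimate[OF assms] by (elim exE conjE)
  have est: "\<bar>u z t * a t - u1 z t * w t - a 0 + (Q1 t - Q1 0)\<bar> \<le> \<eta> * \<beta> \<and>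
    \<bar>v z t * a t - v1 z t * w t + w 0 + (Q2 t - Q2 0)\<bar> \<le> \<eta> * \<beta>"
    if b: "0 \<le> \<beta>" "\<beta> \<le> \<beta>0" and H: "\<forall>t\<in>{0..2 * pi}. (w has_real_derivative a t + b t) (at t) \<and>
      (a has_real_derivative - (f (X z t + w t) - f (X z t))) (at t) \<and> \<bar>b t\<bar> \<le> \<beta> \<and>
      (Q1 has_real_derivative u1 z t * b t) (at t) \<and> (Q2 has_real_derivative v1 z t * b t) (at t)"
    and init: "\<bar>w 0\<bar> \<le> \<beta>" "\<bar>a 0\<bar> \<le> \<beta>" and t: "t \<in> {0..2 * pi}" for \<beta> z w a b Q1 Q2 t
  proof
    have "\<bar>u z t * a t - u1 z t * w t - (u z 0 * a 0 - u1 z 0 * w 0) + (Q1 t - Q1 0)\<bar> \<le> \<eta> * \<beta>"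
      by (rule \<beta>0[rule_format, of \<beta> "X z" "Y z" "u z" "u1 z" w a b Q1 t])
        (use b H init t flow(1) clinearised_Re_Im[OF lin(1)] uv_bound in auto)
    then show "\<bar>u z t * a t - u1 z t * w t - a 0 + (Q1 t - Q1 0)\<bar> \<le> \<eta> * \<beta>" by (simp add: lin)
    have "\<bar>v z t * a t - v1 z t * w t - (v z 0 * a 0 - v1 z 0 * w 0) + (Q2 t - Q2 0)\<bar> \<le> \<eta> * \<beta>"
      by (rule \<beta>0[rule_format, of \<beta> "X z" "Y z" "v z" "v1 z" w a b Q2 t])
        (use b H init t flow(1) clinearised_Re_Im[OF lin(1)] uv_bound in auto)
    then show "\<bar>v z t * a t - v1 z t * w t + w 0 + (Q2 t - Q2 0)\<bar> \<le> \<eta> * \<beta>" by (simp add: lin)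
  qed
  show ?thesis by (intro exI[of _ \<beta>0] conjI[OF \<open>\<beta>0 > 0\<close>] allI impI) (rule est)
qed

text \<open>Without forcing, the deviation is the difference of two free orbits with initial value
  \<open>h\<close>.\<close>

lemma free_wronskian_estimate:
  assumes "\<eta> > 0"
  shows "\<exists>\<beta>0>0. \<forall>\<beta> z h t. 0 \<le> \<beta> \<longrightarrow> \<beta> \<le> \<beta>0 \<longrightarrow> norm h \<le> \<beta> \<longrightarrow> t \<in> {0..2 * pi} \<longrightarrow>
    \<bar>u z t * (Y (z + h) t - Y z t) - u1 z t * (X (z + h) t - X z t) - Im h\<bar> \<le> \<eta> * \<beta> \<and>
    \<bar>v z t * (Y (z + h) t - Y z t) - v1 z t * (X (z + h) t - X z t) + Re h\<bar> \<le> \<eta> * \<beta>"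
proof -
  obtain \<beta>0 where "\<beta>0 > 0" and \<beta>0: "\<forall>\<beta> z w a b Q1 Q2 t. 0 \<le> \<beta> \<longrightarrow> \<beta> \<le> \<beta>0 \<longrightarrow>
    (\<forall>t\<in>{0..2 * pi}. (w has_real_derivative a t + b t) (at t) \<and>
      (a has_real_derivative - (f (X z t + w t) - f (X z t))) (at t) \<and> \<bar>b t\<bar> \<le> \<beta> \<and>
      (Q1 has_real_derivative u1 z t * b t) (at t) \<and> (Q2 has_real_derivative v1 z t * b t) (at t)) \<longrightarrow>
    \<bar>w 0\<bar> \<le> \<beta> \<longrightarrow> \<bar>a 0\<bar> \<le> \<beta> \<longrightarrow> t \<in> {0..2 * pi} \<longrightarrow>
    \<bar>u z t * a t - u1 z t * w t - a 0 + (Q1 t - Q1 0)\<bar> \<le> \<eta> * \<beta> \<and>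
    \<bar>v z t * a t - v1 z t * w t + w 0 + (Q2 t - Q2 0)\<bar> \<le> \<eta> * \<beta>"
    using wronskian_estimate_psi[OF assms] by (elim exE conjE)
  have est: "\<bar>u z t * (Y (z + h) t - Y z t) - u1 z t * (X (z + h) t - X z t) - Im h\<bar> \<le> \<eta> * \<beta> \<and>
    \<bar>v z t * (Y (z + h) t - Y z t) - v1 z t * (X (z + h) t - X z t) + Re h\<bar> \<le> \<eta> * \<beta>"
    if "0 \<le> \<beta>" "\<beta> \<le> \<beta>0" "norm h \<le> \<beta>" "t \<in> {0..2 * pi}" for \<beta> z h t
  proof -
    define w a where "w = (\<lambda>t. X (z + h) t - X z t)" and "a = (\<lambda>t. Y (z + h) t - Y z t)"
    have "\<bar>u z t * a t - u1 z t * w t - a 0 + ((\<lambda>_. 0) t - (\<lambda>_. 0) 0)\<bar> \<le> \<eta> * \<beta> \<and>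
      \<bar>v z t * a t - v1 z t * w t + w 0 + ((\<lambda>_. 0) t - (\<lambda>_. 0) 0)\<bar> \<le> \<eta> * \<beta>"
    proof (rule \<beta>0[rule_format, of \<beta> w a "\<lambda>_. 0" z "\<lambda>_. 0" "\<lambda>_. 0"])
      have init: "w 0 = Re h" "a 0 = Im h" by (simp_all add: w_def a_def flow)
      then show "\<bar>w 0\<bar> \<le> \<beta>" "\<bar>a 0\<bar> \<le> \<beta>"
        using that(3) abs_Re_le_cmod[of h] abs_Im_le_cmod[of h] by linarith+
      fix s
      have "(w has_real_derivative a s) (at s)"
        unfolding w_def a_def by (intro DERIV_diff orbit_deriv(1)[OF flow(1)])
      moreover have "(a has_real_derivative - f (X (z + h) s) - - f (X z s)) (at s)"
        unfolding a_def by (intro DERIV_diff orbit_deriv(2)[OF flow(1)])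
      ultimately show "(w has_real_derivative a s + 0) (at s) \<and>
        (a has_real_derivative - (f (X z s + w s) - f (X z s))) (at s) \<and> \<bar>0\<bar> \<le> \<beta> \<and>
        ((\<lambda>_. 0) has_real_derivative u1 z s * 0) (at s) \<and> ((\<lambda>_. 0) has_real_derivative v1 z s * 0) (at s)"
        using that by (simp add: w_def)
    qed (use that in auto)
    then show ?thesis by (simp add: w_def a_def flow)
  qed
  show ?thesis by (intro exI[of _ \<beta>0] conjI[OF \<open>\<beta>0 > 0\<close>] allI impI) (rule est)
qed

text \<open>Since all orbits close up after time \<open>2\<pi>\<close>, the monodromy of the linearisation is trivial.\<close>

lemma psi_2pi: "psi z (2 * pi) = 1" "psi1 z (2 * pi) = \<i>"
proof -
  \<comment> \<open>At time \<open>2 * pi\<close> the deviation is again \<open>h\<close>, so both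
    sides can be divided by the length of \<open>h\<close>. As \<eta> is arbitrary, the two unit
    vectors then determine the monodromy matrix.\<close>
  have *: "\<bar>u z (2 * pi) * s - u1 z (2 * pi) * r - s\<bar> \<le> \<eta> \<and> \<bar>v z (2 * pi) * s - v1 z (2 * pi) * r + r\<bar> \<le> \<eta>"
    if "\<eta> > 0" "norm (Complex r s) = 1" for \<eta> r s
  proof -
    obtain \<beta>0 where "\<beta>0 > 0" and \<beta>0: "\<forall>\<beta> z h t. 0 \<le> \<beta> \<longrightarrow> \<beta> \<le> \<beta>0 \<longrightarrow> norm h \<le> \<beta> \<longrightarrow> t \<in> {0..2 * pi} \<longrightarrow>
      \<bar>u z t * (Y (z + h) t - Y z t) - u1 z t * (X (z + h) t - X z t) - Im h\<bar> \<le> \<eta> * \<beta> \<and>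
      \<bar>v z t * (Y (z + h) t - Y z t) - v1 z t * (X (z + h) t - X z t) + Re h\<bar> \<le> \<eta> * \<beta>"
      using free_wronskian_estimate[OF \<open>\<eta> > 0\<close>] by (elim exE conjE)
    define h where "h = \<beta>0 *\<^sub>R Complex r s"
    have h: "Re h = \<beta>0 * r" "Im h = \<beta>0 * s" "norm h = \<beta>0" using that \<open>\<beta>0 > 0\<close> by (auto simp: h_def)
    have per: "X z' (2 * pi) = Re z'" "Y z' (2 * pi) = Im z'" for z'
      using orbit_periodic[OF flow(1), of z' 0] by (simp_all add: flow)
    have "\<bar>u z (2 * pi) * (\<beta>0 * s) - u1 z (2 * pi) * (\<beta>0 * r) - \<beta>0 * s\<bar> \<le> \<eta> * \<beta>0 \<and>
      \<bar>v z (2 * pi) * (\<beta>0 * s) - v1 z (2 * pi) * (\<beta>0 * r) + \<beta>0 * r\<bar> \<le> \<eta> * \<beta>0"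
      using \<beta>0[rule_format, of \<beta>0 h "2 * pi" z] \<open>\<beta>0 > 0\<close> by (simp add: h per)
    moreover have "u z (2 * pi) * (\<beta>0 * s) - u1 z (2 * pi) * (\<beta>0 * r) - \<beta>0 * s = \<beta>0 * (u z (2 * pi) * s - u1 z (2 * pi) * r - s)"
      "v z (2 * pi) * (\<beta>0 * s) - v1 z (2 * pi) * (\<beta>0 * r) + \<beta>0 * r = \<beta>0 * (v z (2 * pi) * s - v1 z (2 * pi) * r + r)"
      by (simp_all add: algebra_simps)
    ultimately show ?thesis using \<open>\<beta>0 > 0\<close> by (simp add: abs_mult mult.commute[of \<eta>])
  qed
  have null: "s = 0" if "\<And>\<eta>. \<eta> > 0 \<Longrightarrow> \<bar>s\<bar> \<le> \<eta>" for s :: real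
    using field_le_epsilon[of "\<bar>s\<bar>" 0] that by auto
  have "u z (2 * pi) - 1 = 0" "v z (2 * pi) = 0"
    using *[of _ 0 1] by (auto intro!: null simp: cmod_def simp del: right_minus_eq)
  moreover have "u1 z (2 * pi) = 0" "v1 z (2 * pi) - 1 = 0"
    using *[of _ 1 0] by (auto intro!: null simp: cmod_def abs_minus_commute simp del: right_minus_eq)
  ultimately show "psi z (2 * pi) = 1" "psi1 z (2 * pi) = \<i>" by (simp_all add: complex_eq_iff)
qed

lemma psi_periodic: "psi z (t + 2 * pi) = psi z t" "psi1 z (t + 2 * pi) = psi1 z t"
proof -
  have sh: "((\<lambda>t. g (t + 2 * pi)) has_vector_derivative g' (t + 2 * pi)) (at t)"
    if "\<And>t. (g has_vector_derivative g' t) (at t)" for g g' :: "real \<Rightarrow> complex" and t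
  proof -
    have "((\<lambda>t. t + 2 * pi) has_vector_derivative 1) (at t)" by (auto intro!: derivative_eq_intros)
    from vector_diff_chain_at[OF this that] show ?thesis by (simp add: o_def)
  qed
  have "clinearised (X z) (\<lambda>t. psi z (t + 2 * pi)) (\<lambda>t. psi1 z (t + 2 * pi))"
    unfolding clinearised_def classical_solution_def
    using sh[OF clinearised_deriv(1)[OF lin(1)], of z] sh[OF clinearised_deriv(2)[OF lin(1)], of z]
    by (simp add: orbit_periodic[OF flow(1)])
  from clinearised_unique[OF this lin(1), of 0]
  have "(\<lambda>t. psi z (t + 2 * pi)) = psi z \<and> (\<lambda>t. psi1 z (t + 2 * pi)) = psi1 z"
    by (simp add: psi_2pi lin)
  then show "psi z (t + 2 * pi) = psi z t" "psi1 z (t + 2 * pi) = psi1 z t" by (auto dest: fun_cong)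
qed

lemma wronskian: "u z t * v1 z t - u1 z t * v z t = 1"
proof -
  have l: "linearised (X z) (u z) (u1 z)" "linearised (X z) (v z) (v1 z)"
    using clinearised_Re_Im[OF lin(1)] by auto
  have "((\<lambda>t. u z t * v1 z t - u1 z t * v z t) has_real_derivative 0) (at s)" for s
  proof -
    have d: "(u z has_real_derivative u1 z s) (at s)" "(u1 z has_real_derivative - (f2 (X z s) * u z s)) (at s)"
      "(v z has_real_derivative v1 z s) (at s)" "(v1 z has_real_derivative - (f2 (X z s) * v z s)) (at s)"
      using l by (auto simp: linearised_def)
    show ?thesis
      by (rule DERIV_cong[OF DERIV_diff[OF DERIV_mult[OF d(1,4)] DERIV_mult[OF d(2,3)]]]) (simp add: algebra_simps)
  qed
  then have "(\<lambda>t. u z t * v1 z t - u1 z t * v z t) t = (\<lambda>t. u z t * v1 z t - u1 z t * v z t) 0"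
    by (intro DERIV_isconst_all) blast
  then show ?thesis by (simp add: lin)
qed

text \<open>The two Wronskian relations are linear equations for the deviations of position and
  velocity, with determinant \<open>1\<close>. Cramer's rule multiplies each of the two errors by at
  most \<open>2 * \<Lambda>\<close>, whence \<open>\<eta> / (4 * \<Lambda>)\<close>.\<close>

lemma flow_linearisation:
  assumes "\<eta> > 0"
  shows "\<exists>\<beta>0>0. \<forall>\<beta> z h t. 0 \<le> \<beta> \<longrightarrow> \<beta> \<le> \<beta>0 \<longrightarrow> norm h \<le> \<beta> \<longrightarrow> t \<in> {0..2 * pi} \<longrightarrow>
    \<bar>X (z + h) t - X z t - (Re h * u z t + Im h * v z t)\<bar> \<le> \<eta> * \<beta>"
proof -
  define \<eta>' where "\<eta>' = \<eta> / (4 * \<Lambda>)"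
  have "\<eta>' > 0" using assms \<Lambda>_ge_1 by (simp add: \<eta>'_def)
  obtain \<beta>0 where "\<beta>0 > 0" and \<beta>0: "\<forall>\<beta> z h t. 0 \<le> \<beta> \<longrightarrow> \<beta> \<le> \<beta>0 \<longrightarrow> norm h \<le> \<beta> \<longrightarrow> t \<in> {0..2 * pi} \<longrightarrow>
    \<bar>u z t * (Y (z + h) t - Y z t) - u1 z t * (X (z + h) t - X z t) - Im h\<bar> \<le> \<eta>' * \<beta> \<and>
    \<bar>v z t * (Y (z + h) t - Y z t) - v1 z t * (X (z + h) t - X z t) + Re h\<bar> \<le> \<eta>' * \<beta>"
    using free_wronskian_estimate[OF \<open>\<eta>' > 0\<close>] by (elim exE conjE)
  have est: "\<bar>X (z + h) t - X z t - (Re h * u z t + Im h * v z t)\<bar> \<le> \<eta> * \<beta>"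
    if H: "0 \<le> \<beta>" "\<beta> \<le> \<beta>0" "norm h \<le> \<beta>" "t \<in> {0..2 * pi}" for \<beta> z h t
  proof -
    define w a where "w = X (z + h) t - X z t" and "a = Y (z + h) t - Y z t"
    define e1 e2 where "e1 = u z t * a - u1 z t * w - Im h" and "e2 = v z t * a - v1 z t * w + Re h"
    have e: "\<bar>e1\<bar> \<le> \<eta>' * \<beta>" "\<bar>e2\<bar> \<le> \<eta>' * \<beta>"
      using \<beta>0[rule_format, OF H, of z] by (auto simp: e1_def e2_def w_def a_def)
    have "w * (u z t * v1 z t - u1 z t * v z t) = (Re h * u z t + Im h * v z t) + (v z t * e1 - u z t * e2)"
      by (simp add: e1_def e2_def algebra_simps)
    then have "w - (Re h * u z t + Im h * v z t) = v z t * e1 - u z t * e2" by (simp add: wronskian)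
    moreover have "\<bar>v z t * e1\<bar> \<le> 2 * \<Lambda> * (\<eta>' * \<beta>)" "\<bar>u z t * e2\<bar> \<le> 2 * \<Lambda> * (\<eta>' * \<beta>)"
      unfolding abs_mult using e uv_bound[of t z] H(4) \<Lambda>_ge_1 by (auto intro!: mult_mono)
    moreover have "2 * \<Lambda> * (\<eta>' * \<beta>) + 2 * \<Lambda> * (\<eta>' * \<beta>) = \<eta> * \<beta>"
      using \<Lambda>_ge_1 by (simp add: \<eta>'_def)
    ultimately show ?thesis unfolding w_def by linarith
  qed
  show ?thesis by (intro exI[of _ \<beta>0] conjI[OF \<open>\<beta>0 > 0\<close>] allI impI) (rule est)
qed

text \<open>Compare the linearisations of the flow at \<open>z\<close> and \<open>z'\<close>.\<close>

lemma psi_unif_continuous: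
  assumes "\<eta> > 0"
  shows "\<exists>\<beta>0>0. \<forall>z z' t. norm (z' - z) \<le> \<beta>0 \<longrightarrow> t \<in> {0..2 * pi} \<longrightarrow> norm (psi z' t - psi z t) \<le> \<eta>"
proof -
  define \<eta>' where "\<eta>' = \<eta> / 10"
  have "\<eta>' > 0" using assms by (simp add: \<eta>'_def)
  obtain \<beta>0 where "\<beta>0 > 0" and \<beta>0: "\<forall>\<beta> z h t. 0 \<le> \<beta> \<longrightarrow> \<beta> \<le> \<beta>0 \<longrightarrow> norm h \<le> \<beta> \<longrightarrow> t \<in> {0..2 * pi} \<longrightarrow>
    \<bar>X (z + h) t - X z t - (Re h * u z t + Im h * v z t)\<bar> \<le> \<eta>' * \<beta>"
    using flow_linearisation[OF \<open>\<eta>' > 0\<close>] by (elim exE conjE)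
  \<comment> \<open>Half the radius, because the sum of \<open>z' - z\<close> and a further
    displacement must be admissible too.\<close>
  define \<beta> where "\<beta> = \<beta>0 / 2"
  have "\<beta> > 0" "2 * \<beta> = \<beta>0" using \<open>\<beta>0 > 0\<close> by (auto simp: \<beta>_def)
  have est: "norm (psi z' t - psi z t) \<le> \<eta>" if zz: "norm (z' - z) \<le> \<beta>" and t: "t \<in> {0..2 * pi}" for z z' t
  proof -
    \<comment> \<open>The displacement from \<open>z\<close> to \<open>z' + h\<close> is linearised
      at \<open>z\<close> directly and by way of \<open>z'\<close>, with errors
      \<open>2 + 1 + 1 \<le> 5\<close>. Vectors \<open>h\<close> of exact length \<beta> on the axes
      allow division by \<beta>, and \<open>\<eta>' = \<eta> / 10\<close> leaves
      \<open>\<eta> / 2\<close> per coordinate.\<close>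
    have key: "\<bar>Re h * (u z' t - u z t) + Im h * (v z' t - v z t)\<bar> \<le> 5 * \<eta>' * \<beta>" if "norm h = \<beta>" for h
    proof -
      define g where "g = z' - z"
      have "norm (g + h) \<le> 2 * \<beta>" using norm_triangle_ineq[of g h] zz that by (simp add: g_def)
      then have 1: "\<bar>X (z' + h) t - X z t - (Re (g + h) * u z t + Im (g + h) * v z t)\<bar> \<le> \<eta>' * (2 * \<beta>)"
        using \<beta>0[rule_format, of "2 * \<beta>" "g + h" t z] \<open>\<beta> > 0\<close> \<open>2 * \<beta> = \<beta>0\<close> t by (simp add: g_def)
      have 2: "\<bar>X z' t - X z t - (Re g * u z t + Im g * v z t)\<bar> \<le> \<eta>' * \<beta>"
        using \<beta>0[rule_format, of \<beta> g t z] \<open>\<beta> > 0\<close> \<open>2 * \<beta> = \<beta>0\<close> t zz by (simp add: g_def)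
      have 3: "\<bar>X (z' + h) t - X z' t - (Re h * u z' t + Im h * v z' t)\<bar> \<le> \<eta>' * \<beta>"
        using \<beta>0[rule_format, of \<beta> h t z'] \<open>\<beta> > 0\<close> \<open>2 * \<beta> = \<beta>0\<close> t that by simp
      have "Re h * (u z' t - u z t) + Im h * (v z' t - v z t) =
        (X (z' + h) t - X z t - (Re (g + h) * u z t + Im (g + h) * v z t))
        - (X z' t - X z t - (Re g * u z t + Im g * v z t))
        - (X (z' + h) t - X z' t - (Re h * u z' t + Im h * v z' t))"
        by (simp add: algebra_simps)
      moreover have "0 \<le> \<eta>' * \<beta>" using \<open>\<eta>' > 0\<close> \<open>\<beta> > 0\<close> by simp
      ultimately show ?thesis using 1 2 3 by linarith
    qed
    have "\<beta> * \<bar>u z' t - u z t\<bar> \<le> \<beta> * (5 * \<eta>')" "\<beta> * \<bar>v z' t - v z t\<bar> \<le> \<beta> * (5 * \<eta>')"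
      using key[of "Complex \<beta> 0"] key[of "Complex 0 \<beta>"] \<open>\<beta> > 0\<close>
      by (simp_all add: cmod_def abs_mult mult_ac)
    then have "\<bar>u z' t - u z t\<bar> \<le> 5 * \<eta>'" "\<bar>v z' t - v z t\<bar> \<le> 5 * \<eta>'" using \<open>\<beta> > 0\<close> by simp_all
    then show ?thesis using cmod_le[of "psi z' t - psi z t"] by (simp add: \<eta>'_def)
  qed
  show ?thesis by (intro exI[of _ \<beta>] conjI[OF \<open>\<beta> > 0\<close>] allI impI) (rule est)
qed

text \<open>Uniqueness makes the definite description in \<open>\<phi>\<close> denote the orbit
  selected by \<open>flow\<close>.\<close>

lemma the_orbit: "(THE x. \<exists>v. orbit x v \<and> x 0 = r \<and> v 0 = 0) = X (complex_of_real r)"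
proof (rule the_equality)
  show "\<exists>v. orbit (X (complex_of_real r)) v \<and> X (complex_of_real r) 0 = r \<and> v 0 = 0"
    using flow[of "complex_of_real r"] by auto
  fix x assume "\<exists>v. orbit x v \<and> x 0 = r \<and> v 0 = 0"
  then obtain v where "orbit x v" "x 0 = r" "v 0 = 0" by blast
  then show "x = X (complex_of_real r)"
    using orbit_unique[of x v "X (complex_of_real r)" "Y (complex_of_real r)" 0] flow[of "complex_of_real r"] by auto
qed

lemma the_clinearised: "(THE y. \<exists>v. clinearised (X z) y v \<and> y 0 = 1 \<and> v 0 = \<i>) = psi z"
proof (rule the_equality)
  show "\<exists>v. clinearised (X z) (psi z) v \<and> psi z 0 = 1 \<and> v 0 = \<i>"
    using lin[of z] by auto
  fix y assume "\<exists>v. clinearised (X z) y v \<and> y 0 = 1 \<and> v 0 = \<i>"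
  then obtain v where "clinearised (X z) y v" "y 0 = 1" "v 0 = \<i>" by blast
  then show "y = psi z" using clinearised_unique[of "X z" y v "psi z" "psi1 z" 0] lin[of z] by auto
qed

end

subsection \<open>First-order expansion of the Poincare map\<close>

locale forced_isochronous = isochronous_potential +
  fixes p :: "real \<Rightarrow> real"
  assumes p_int: "\<And>a b. p absolutely_integrable_on {a..b}"
    and p_per: "\<And>t. p (t + 2 * pi) = p t"
begin

section \<open>The Melnikov integral: size and modulus of continuity\<close>

lemma p_mult_absolutely_integrable:
  fixes y :: "real \<Rightarrow> 'a::euclidean_space"
  assumes "continuous_on UNIV y"
  shows "(\<lambda>t. p t *\<^sub>R y t) absolutely_integrable_on {a..b}"
proof -
  have cont: "continuous_on {a..b} y" using continuous_on_subset[OF assms] by simp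
  have bil: "bilinear (\<lambda>(y::'a) (c::real). c *\<^sub>R y)"
    by (auto simp: bilinear_def intro!: linearI scaleR_add_left scaleR_add_right)
  have meas: "y \<in> borel_measurable (lebesgue_on {a..b})"
    by (rule continuous_imp_measurable_on_sets_lebesgue[OF cont]) simp
  have "bounded (y ` {a..b})"
    by (intro compact_imp_bounded compact_continuous_image cont) simp
  from absolutely_integrable_bounded_measurable_product[OF bil meas _ this p_int] show ?thesis by simp
qed

lemma psi_continuous: "continuous_on UNIV (psi z)" "continuous_on UNIV (psi1 z)"
  by (rule continuous_on_vector_derivative_UNIV, rule clinearised_deriv[OF lin(1)])+

text \<open>The Melnikov integral of the forcing along the free orbit of \<open>z\<close>; for real
  \<open>z = r \<ge> 0\<close> it is \<open>2 * pi\<close> times the value of \<open>\<Phi>\<close>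
  at \<open>(0, r)\<close>. Multiplied by \<i> it is the leading displacement per period.\<close>

definition melnikov :: "complex \<Rightarrow> complex" where
  "melnikov z = integral {0..2 * pi} (\<lambda>t. p t *\<^sub>R psi z t)"

lemma melnikov_has_integral: "((\<lambda>t. p t *\<^sub>R psi z t) has_integral melnikov z) {0..2 * pi}"
  unfolding melnikov_def
  by (intro integrable_integral set_lebesgue_integral_eq_integral(1) p_mult_absolutely_integrable psi_continuous)

lemma melnikov_Re_Im:
  "((\<lambda>t. p t * u z t) has_integral Re (melnikov z)) {0..2 * pi}"
  "((\<lambda>t. p t * v z t) has_integral Im (melnikov z)) {0..2 * pi}"
  using has_integral_linear[OF melnikov_has_integral bounded_linear_Re]
    has_integral_linear[OF melnikov_has_integral bounded_linear_Im] by (simp_all add: o_def)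

definition p_norm :: real where "p_norm = integral {0..2 * pi} (\<lambda>t. \<bar>p t\<bar>)"

lemma p_norm_bound:
  fixes y :: "real \<Rightarrow> 'a::euclidean_space"
  assumes int: "((\<lambda>t. p t *\<^sub>R y t) has_integral I) {0..2 * pi}"
    and le: "\<And>t. t \<in> {0..2 * pi} \<Longrightarrow> norm (y t) \<le> B"
  shows "norm I \<le> p_norm * B"
proof -
  have "(\<lambda>t. \<bar>p t\<bar>) integrable_on {0..2 * pi}"
    using p_int[of 0 "2 * pi"] by (simp add: absolutely_integrable_on_def)
  then have "((\<lambda>t. \<bar>p t\<bar> * B) has_integral p_norm * B) {0..2 * pi}"
    unfolding p_norm_def by (intro has_integral_mult_left integrable_integral)
  moreover have "norm (p t *\<^sub>R y t) \<le> \<bar>p t\<bar> * B" if "t \<in> {0..2 * pi}" for t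
    using le[OF that] by (simp add: mult_left_mono)
  ultimately show ?thesis
    using integral_norm_bound_integral[of "\<lambda>t. p t *\<^sub>R y t" "{0..2 * pi}" "\<lambda>t. \<bar>p t\<bar> * B"] int
    by (simp add: has_integral_iff p_norm_def)
qed

lemma p_norm_nonneg: "p_norm \<ge> 0"
  unfolding p_norm_def by (rule integral_nonneg) (use p_int[of 0 "2 * pi"] in \<open>auto simp: absolutely_integrable_on_def\<close>)

lemma melnikov_bound: "norm (melnikov z) \<le> p_norm * (2 * \<Lambda>)"
  by (rule p_norm_bound[OF melnikov_has_integral]) (auto intro: psi_bound)

lemma melnikov_unif_continuous:
  assumes "\<eta> > 0"
  shows "\<exists>\<beta>0>0. \<forall>z z'. norm (z' - z) \<le> \<beta>0 \<longrightarrow> norm (melnikov z' - melnikov z) \<le> \<eta>"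
proof -
  have "\<eta> / (p_norm + 1) > 0" using assms p_norm_nonneg by simp
  from psi_unif_continuous[OF this] obtain \<beta>0 where "\<beta>0 > 0" and \<beta>0: "\<forall>z z' t. norm (z' - z) \<le> \<beta>0 \<longrightarrow>
      t \<in> {0..2 * pi} \<longrightarrow> norm (psi z' t - psi z t) \<le> \<eta> / (p_norm + 1)" by (elim exE conjE)
  have "norm (melnikov z' - melnikov z) \<le> \<eta>" if "norm (z' - z) \<le> \<beta>0" for z z'
  proof -
    have "((\<lambda>t. p t *\<^sub>R (psi z' t - psi z t)) has_integral (melnikov z' - melnikov z)) {0..2 * pi}"
      using has_integral_diff[OF melnikov_has_integral melnikov_has_integral] by (simp add: scaleR_diff_right)
    then have "norm (melnikov z' - melnikov z) \<le> p_norm * (\<eta> / (p_norm + 1))"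
      by (rule p_norm_bound) (use \<beta>0 that in blast)
    also have "\<dots> = \<eta> * (p_norm / (p_norm + 1))" by simp
    also have "\<dots> \<le> \<eta> * 1" using assms p_norm_nonneg by (intro mult_left_mono) auto
    finally show ?thesis by simp
  qed
  then show ?thesis using \<open>\<beta>0 > 0\<close> by blast
qed

text \<open>
  For a solution \<open>x\<close> of the forced equation, \<open>a = x' - \<epsilon> q\<close> is differentiable everywhere, unlike \<open>x'\<close>.
\<close>

lemma poincare_step:
  assumes q: "indef_integral p q" "q 0 = 0" and "\<eta> > 0"
  shows "\<exists>\<epsilon>0>0. \<forall>\<epsilon> x a. \<bar>\<epsilon>\<bar> \<le> \<epsilon>0 \<longrightarrow>
    (\<forall>t. (x has_real_derivative a t + \<epsilon> * q t) (at t) \<and> (a has_real_derivative - f (x t)) (at t)) \<longrightarrow>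
    norm (Complex (x (2 * pi)) (a (2 * pi) + \<epsilon> * q (2 * pi)) - Complex (x 0) (a 0)
      - \<epsilon> *\<^sub>R (\<i> * melnikov (Complex (x 0) (a 0)))) \<le> \<eta> * \<bar>\<epsilon>\<bar>"
proof -
  have "compact (q ` {0..2 * pi})"
    using indef_integral_continuous[OF q(1)] by (intro compact_continuous_image continuous_at_imp_continuous_on) auto
  then obtain B where "B > 0" and B: "\<And>t. t \<in> {0..2 * pi} \<Longrightarrow> \<bar>q t\<bar> \<le> B"
    using compact_imp_bounded bounded_pos by (metis (no_types, lifting) image_eqI real_norm_def)
  obtain A where A: "indef_integral (\<lambda>t. \<bar>p t\<bar>) A"
    using indef_integral_exists[of "\<lambda>t. \<bar>p t\<bar>"] p_int by (auto simp: absolutely_integrable_on_def)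
  \<comment> \<open>With \<open>\<beta> = B * \<bar>\<epsilon>\<bar>\<close> this leaves
    \<open>\<eta> * \<bar>\<epsilon>\<bar> / 2\<close> for each coordinate.\<close>
  have "\<eta> / (2 * B) > 0" using \<open>\<eta> > 0\<close> \<open>B > 0\<close> by simp
  from wronskian_estimate_psi[OF this] obtain \<beta>0 where "\<beta>0 > 0" and \<beta>0: "\<forall>\<beta> z w a b Q1 Q2 t. 0 \<le> \<beta> \<longrightarrow> \<beta> \<le> \<beta>0 \<longrightarrow>
    (\<forall>t\<in>{0..2 * pi}. (w has_real_derivative a t + b t) (at t) \<and>
      (a has_real_derivative - (f (X z t + w t) - f (X z t))) (at t) \<and> \<bar>b t\<bar> \<le> \<beta> \<and>
      (Q1 has_real_derivative u1 z t * b t) (at t) \<and> (Q2 has_real_derivative v1 z t * b t) (at t)) \<longrightarrow>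
    \<bar>w 0\<bar> \<le> \<beta> \<longrightarrow> \<bar>a 0\<bar> \<le> \<beta> \<longrightarrow> t \<in> {0..2 * pi} \<longrightarrow>
    \<bar>u z t * a t - u1 z t * w t - a 0 + (Q1 t - Q1 0)\<bar> \<le> \<eta> / (2 * B) * \<beta> \<and>
    \<bar>v z t * a t - v1 z t * w t + w 0 + (Q2 t - Q2 0)\<bar> \<le> \<eta> / (2 * B) * \<beta>" by (elim exE conjE)
  have est: "norm (Complex (x (2 * pi)) (a (2 * pi) + \<epsilon> * q (2 * pi)) - Complex (x 0) (a 0)
      - \<epsilon> *\<^sub>R (\<i> * melnikov (Complex (x 0) (a 0)))) \<le> \<eta> * \<bar>\<epsilon>\<bar>"
    if \<epsilon>: "\<bar>\<epsilon>\<bar> \<le> \<beta>0 / B"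
    and sol: "\<forall>t. (x has_real_derivative a t + \<epsilon> * q t) (at t) \<and> (a has_real_derivative - f (x t)) (at t)"
    for \<epsilon> x a
  proof -
    define z where "z = Complex (x 0) (a 0)"
    define w a' where "w = (\<lambda>t. x t - X z t)" and "a' = (\<lambda>t. a t - Y z t)"
    have int: "\<exists>r. indef_integral (\<lambda>t. p t * y t) r" if "continuous_on UNIV y" for y
      using indef_integral_exists[of "\<lambda>t. p t * y t"] p_mult_absolutely_integrable[OF that]
      by (auto simp: set_lebesgue_integral_eq_integral(1))
    obtain r1 where r1: "indef_integral (\<lambda>t. p t * u z t) r1"
      using int[OF continuous_on_Re[OF psi_continuous(1)]] by blast
    obtain r2 where r2: "indef_integral (\<lambda>t. p t * v z t) r2"
      using int[OF continuous_on_Im[OF psi_continuous(1)]] by blast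
    \<comment> \<open>Integration by parts writes primitives of \<open>u1\<close> and
      \<open>v1\<close> times \<open>\<epsilon> * q\<close> through the integrals of
      \<open>p * u\<close> and \<open>p * v\<close>, that is, through the Melnikov integral.\<close>
    define Q1 Q2 where "Q1 = (\<lambda>t. \<epsilon> * (q t * u z t - r1 t))" and "Q2 = (\<lambda>t. \<epsilon> * (q t * v z t - r2 t))"
    have lins: "linearised (X z) (u z) (u1 z)" "linearised (X z) (v z) (v1 z)"
      using clinearised_Re_Im[OF lin(1)] by auto
    have dQ1: "(Q1 has_real_derivative u1 z t * (\<epsilon> * q t)) (at t)" for t
    proof -
      have "((\<lambda>t. q t * u z t - r1 t) has_real_derivative q t * u1 z t) (at t)"
        using lins(1) by (intro integration_by_parts_derivative[OF q(1) r1 A] continuous_on_Re psi_continuous(2))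
          (simp add: linearised_def)
      from DERIV_cmult[OF this, of \<epsilon>] show ?thesis by (simp add: Q1_def mult_ac)
    qed
    have dQ2: "(Q2 has_real_derivative v1 z t * (\<epsilon> * q t)) (at t)" for t
    proof -
      have "((\<lambda>t. q t * v z t - r2 t) has_real_derivative q t * v1 z t) (at t)"
        using lins(2) by (intro integration_by_parts_derivative[OF q(1) r2 A] continuous_on_Im psi_continuous(2))
          (simp add: linearised_def)
      from DERIV_cmult[OF this, of \<epsilon>] show ?thesis by (simp add: Q2_def mult_ac)
    qed
    have "\<bar>u z (2 * pi) * a' (2 * pi) - u1 z (2 * pi) * w (2 * pi) - a' 0 + (Q1 (2 * pi) - Q1 0)\<bar> \<le> \<eta> / (2 * B) * (B * \<bar>\<epsilon>\<bar>) \<and>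
      \<bar>v z (2 * pi) * a' (2 * pi) - v1 z (2 * pi) * w (2 * pi) + w 0 + (Q2 (2 * pi) - Q2 0)\<bar> \<le> \<eta> / (2 * B) * (B * \<bar>\<epsilon>\<bar>)"
    proof (rule \<beta>0[rule_format, where b = "\<lambda>t. \<epsilon> * q t"])
      show "0 \<le> B * \<bar>\<epsilon>\<bar>" "B * \<bar>\<epsilon>\<bar> \<le> \<beta>0" using \<epsilon> \<open>B > 0\<close> by (auto simp: le_divide_eq mult.commute)
      show "\<bar>w 0\<bar> \<le> B * \<bar>\<epsilon>\<bar>" "\<bar>a' 0\<bar> \<le> B * \<bar>\<epsilon>\<bar>"
        using \<open>B > 0\<close> by (auto simp: w_def a'_def flow z_def)
      fix t assume t: "t \<in> {0..2 * pi}"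
      have "(w has_real_derivative (a t + \<epsilon> * q t) - Y z t) (at t)"
        unfolding w_def using sol by (intro DERIV_diff orbit_deriv(1)[OF flow(1)]) auto
      moreover have "(a' has_real_derivative - f (x t) - - f (X z t)) (at t)"
        unfolding a'_def using sol by (intro DERIV_diff orbit_deriv(2)[OF flow(1)]) auto
      moreover have "\<bar>\<epsilon> * q t\<bar> \<le> B * \<bar>\<epsilon>\<bar>"
        using mult_left_mono[OF B[OF t], of "\<bar>\<epsilon>\<bar>"] by (simp add: abs_mult mult.commute)
      ultimately show "(w has_real_derivative a' t + \<epsilon> * q t) (at t) \<and>
        (a' has_real_derivative - (f (X z t + w t) - f (X z t))) (at t) \<and> \<bar>\<epsilon> * q t\<bar> \<le> B * \<bar>\<epsilon>\<bar> \<and>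
        (Q1 has_real_derivative u1 z t * (\<epsilon> * q t)) (at t) \<and> (Q2 has_real_derivative v1 z t * (\<epsilon> * q t)) (at t)"
        using dQ1 dQ2 by (simp add: w_def a'_def algebra_simps)
    qed auto
    moreover have "a' 0 = 0" "w 0 = 0" by (auto simp: w_def a'_def flow z_def)
    moreover have "r1 (2 * pi) - r1 0 = Re (melnikov z)" "r2 (2 * pi) - r2 0 = Im (melnikov z)"
      using has_integral_unique[OF indef_integralD[OF r1] melnikov_Re_Im(1)]
        has_integral_unique[OF indef_integralD[OF r2] melnikov_Re_Im(2)] by simp_all
    \<comment> \<open>The boundary terms are explicit since \<open>psi z\<close> equals
      \<open>1\<close> at both ends and \<open>q 0 = 0\<close>.\<close>
    then have "Q1 (2 * pi) - Q1 0 = \<epsilon> * (q (2 * pi) - Re (melnikov z))" "Q2 (2 * pi) - Q2 0 = - (\<epsilon> * Im (melnikov z))"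
      by (simp_all add: Q1_def Q2_def psi_2pi lin q(2) flip: right_diff_distrib) (simp_all add: algebra_simps)
    moreover have "\<eta> / (2 * B) * (B * \<bar>\<epsilon>\<bar>) = \<eta> * \<bar>\<epsilon>\<bar> / 2" using \<open>B > 0\<close> by simp
    ultimately have "\<bar>a' (2 * pi) + \<epsilon> * (q (2 * pi) - Re (melnikov z))\<bar> \<le> \<eta> * \<bar>\<epsilon>\<bar> / 2 \<and>
      \<bar>- (w (2 * pi) + \<epsilon> * Im (melnikov z))\<bar> \<le> \<eta> * \<bar>\<epsilon>\<bar> / 2"
      using \<open>B > 0\<close> by (simp add: psi_2pi)
    then have e: "\<bar>a' (2 * pi) + \<epsilon> * (q (2 * pi) - Re (melnikov z))\<bar> \<le> \<eta> * \<bar>\<epsilon>\<bar> / 2"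
      "\<bar>w (2 * pi) + \<epsilon> * Im (melnikov z)\<bar> \<le> \<eta> * \<bar>\<epsilon>\<bar> / 2"
      unfolding abs_minus_cancel by blast+
    have per: "X z (2 * pi) = Re z" "Y z (2 * pi) = Im z"
      using orbit_periodic[OF flow(1), of z 0] by (simp_all add: flow)
    \<comment> \<open>The term \<open>\<epsilon> * q (2 * pi)\<close> is the difference between the
      velocity and \<open>a\<close> after one period; the factor \<i> assigns \<open>- Im\<close> of
      the integral to the position and \<open>Re\<close> to the velocity.\<close>
    let ?d = "Complex (x (2 * pi)) (a (2 * pi) + \<epsilon> * q (2 * pi)) - z - \<epsilon> *\<^sub>R (\<i> * melnikov z)"
    have "Re ?d = w (2 * pi) + \<epsilon> * Im (melnikov z)" "Im ?d = a' (2 * pi) + \<epsilon> * (q (2 * pi) - Re (melnikov z))"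
      unfolding w_def a'_def per by (simp_all add: algebra_simps)
    then show ?thesis using cmod_le[of ?d] e unfolding z_def by linarith
  qed
  have "\<beta>0 / B > 0" using \<open>\<beta>0 > 0\<close> \<open>B > 0\<close> by simp
  then show ?thesis by (intro exI[of _ "\<beta>0 / B"] conjI allI impI) (assumption, rule est)
qed

text \<open>Let \<open>s\<close> be the time of a turning point. The solution \<open>psi r\<close>
  delayed by \<open>s\<close> solves the linearised equation along the orbit of \<open>z\<close>, so
  it is a combination of \<open>u\<close> and \<open>v\<close>. Its coefficients are the values of
  \<open>psi r\<close> and \<open>psi1 r\<close> at \<open>- s\<close>, each of modulus at most
  \<open>2 * \<Lambda>\<close>, and an upper bound on them gives the lower bound for the
  integral.\<close>

lemma melnikov_lower_bound:
  assumes low: "\<And>\<theta> r. r \<ge> 0 \<Longrightarrow> c \<le> norm (integral {0..2 * pi} (\<lambda>t. p (t - \<theta>) *\<^sub>R psi (of_real r) t))"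
  shows "c \<le> 4 * \<Lambda> * norm (melnikov z)"
proof -
  obtain s where s: "s \<in> {0..2 * pi}" "X z s \<ge> 0" "Y z s = 0"
    using orbit_turning_point[OF flow(1)[of z]] by blast
  define r where "r = complex_of_real (X z s)"
  have "(\<lambda>t. X z (t + s)) = X r"
    using orbit_unique[OF orbit_shift[OF flow(1), of z s] flow(1)[of r], of 0] s by (simp add: r_def flow)
  then have Xs: "X z (t + s) = X r t" for t by (rule fun_cong)
  define y y1 where "y t = psi r (t - s)" and "y1 t = psi1 r (t - s)" for t
  have y: "clinearised (X z) y y1"
  proof -
    have sh: "((\<lambda>t. g (t - s)) has_vector_derivative g' (t - s)) (at t)"
      if "\<And>t. (g has_vector_derivative g' t) (at t)" for g g' :: "real \<Rightarrow> complex" and t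
    proof -
      have "((\<lambda>t. t - s) has_vector_derivative 1) (at t)" by (auto intro!: derivative_eq_intros)
      from vector_diff_chain_at[OF this that] show ?thesis by (simp add: o_def)
    qed
    show ?thesis unfolding clinearised_def classical_solution_def y_def y1_def
      using sh[OF clinearised_deriv(1)[OF lin(1)], of r] sh[OF clinearised_deriv(2)[OF lin(1)], of r]
      by (simp flip: Xs)
  qed
  have comb: "clinearised (X z) (\<lambda>t. u z t *\<^sub>R y 0 + v z t *\<^sub>R y1 0) (\<lambda>t. u1 z t *\<^sub>R y 0 + v1 z t *\<^sub>R y1 0)"
  proof -
    have l: "linearised (X z) (u z) (u1 z)" "linearised (X z) (v z) (v1 z)"
      using clinearised_Re_Im[OF lin(1)] by auto
    have d: "((\<lambda>t. g t *\<^sub>R b) has_vector_derivative g' *\<^sub>R b) (at t)"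
      if "(g has_real_derivative g') (at t)" for g g' t and b :: complex
      using has_vector_derivative_scaleR[OF that has_vector_derivative_const] by simp
    show ?thesis unfolding clinearised_def classical_solution_def
    proof (intro allI conjI)
      fix t
      have l1: "(u z has_real_derivative u1 z t) (at t)" "(u1 z has_real_derivative - (f2 (X z t) * u z t)) (at t)"
       "(v z has_real_derivative v1 z t) (at t)" "(v1 z has_real_derivative - (f2 (X z t) * v z t)) (at t)"
        using l by (auto simp: linearised_def)
      show "((\<lambda>t. u z t *\<^sub>R y 0 + v z t *\<^sub>R y1 0) has_vector_derivative u1 z t *\<^sub>R y 0 + v1 z t *\<^sub>R y1 0) (at t)"
        by (intro has_vector_derivative_add d l1)
      have "((\<lambda>t. u1 z t *\<^sub>R y 0 + v1 z t *\<^sub>R y1 0) has_vector_derivative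
          (- (f2 (X z t) * u z t)) *\<^sub>R y 0 + (- (f2 (X z t) * v z t)) *\<^sub>R y1 0) (at t)"
        by (intro has_vector_derivative_add d l1)
      then show "((\<lambda>t. u1 z t *\<^sub>R y 0 + v1 z t *\<^sub>R y1 0) has_vector_derivative
          - (complex_of_real (f2 (X z t)) * (u z t *\<^sub>R y 0 + v z t *\<^sub>R y1 0))) (at t)"
        by (simp add: scaleR_conv_of_real algebra_simps)
    qed
  qed
  have "y = (\<lambda>t. u z t *\<^sub>R y 0 + v z t *\<^sub>R y1 0)"
    using clinearised_unique[OF y comb, of 0] by (simp add: lin)
  then have "y t = u z t *\<^sub>R y 0 + v z t *\<^sub>R y1 0" for t by (rule fun_cong)
  from arg_cong[where f = "scaleR (p _)", OF this]
  have y_eq: "p t *\<^sub>R y t = (p t * u z t) *\<^sub>R y 0 + (p t * v z t) *\<^sub>R y1 0" for t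
    unfolding scaleR_right_distrib scaleR_scaleR .
  have scal: "((\<lambda>t. g t *\<^sub>R b) has_integral (I *\<^sub>R b)) S" if "(g has_integral I) S" for g I S and b :: complex
    using has_integral_linear[OF that bounded_linear_scaleR_left] by (simp add: o_def)
  have I1: "((\<lambda>t. p t *\<^sub>R y t) has_integral (Re (melnikov z) *\<^sub>R y 0 + Im (melnikov z) *\<^sub>R y1 0)) {0..2 * pi}"
    unfolding y_eq by (intro has_integral_add scal melnikov_Re_Im)
  have ycont: "continuous_on UNIV y" by (rule continuous_on_vector_derivative_UNIV, rule clinearised_deriv(1)[OF y])
  obtain q where q: "indef_integral (\<lambda>t. p t *\<^sub>R y t) q"
    using indef_integral_exists[of "\<lambda>t. p t *\<^sub>R y t"] p_mult_absolutely_integrable[OF ycont]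
    by (auto simp: set_lebesgue_integral_eq_integral(1))
  have per: "p (t + 2 * pi) *\<^sub>R y (t + 2 * pi) = p t *\<^sub>R y t" for t
  proof -
    have "y (t + 2 * pi) = psi r ((t - s) + 2 * pi)" by (simp add: y_def algebra_simps)
    then show ?thesis by (simp only: psi_periodic(1) p_per y_def)
  qed
  \<comment> \<open>By periodicity of the integrand the window \<open>[s, s + 2 pi]\<close> may
    replace \<open>[0, 2 pi]\<close>; the shift then appears as the angle
    \<open>- s\<close>.\<close>
  have "((\<lambda>t. p t *\<^sub>R y t) has_integral (q (s + 2 * pi) - q s)) {s..s + 2 * pi}"
    by (rule indef_integralD[OF q]) simp
  from has_integral_affinity'[of "\<lambda>t. p t *\<^sub>R y t" "q (s + 2 * pi) - q s" s "s + 2 * pi" 1 s] this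
  have "((\<lambda>t. p (t + s) *\<^sub>R y (t + s)) has_integral (q (s + 2 * pi) - q s)) {0..2 * pi}" by simp
  also have "q (s + 2 * pi) - q s = q (2 * pi) - q 0" by (rule indef_integral_periodic_shift[OF q per])
  also have "q (2 * pi) - q 0 = Re (melnikov z) *\<^sub>R y 0 + Im (melnikov z) *\<^sub>R y1 0"
    using has_integral_unique[OF indef_integralD[OF q] I1] by simp
  finally have "integral {0..2 * pi} (\<lambda>t. p (t - - s) *\<^sub>R psi r t) = Re (melnikov z) *\<^sub>R y 0 + Im (melnikov z) *\<^sub>R y1 0"
    by (simp add: y_def integral_unique)
  with low[of "X z s" "- s"] s have "c \<le> norm (Re (melnikov z) *\<^sub>R y 0 + Im (melnikov z) *\<^sub>R y1 0)"
    by (simp add: r_def)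
  also have "\<dots> \<le> \<bar>Re (melnikov z)\<bar> * norm (y 0) + \<bar>Im (melnikov z)\<bar> * norm (y1 0)"
    using norm_triangle_ineq[of "Re (melnikov z) *\<^sub>R y 0" "Im (melnikov z) *\<^sub>R y1 0"] by simp
  also have "\<dots> \<le> norm (melnikov z) * (2 * \<Lambda>) + norm (melnikov z) * (2 * \<Lambda>)"
    using psi_bound[of "- s" r] s(1)
    by (intro add_mono mult_mono abs_Re_le_cmod abs_Im_le_cmod) (auto simp: y_def y1_def)
  finally show ?thesis by (simp add: algebra_simps)
qed

lemma melnikov_continuous: "continuous_on UNIV melnikov"
  unfolding continuous_on_iff
proof (intro ballI allI impI)
  fix z :: complex and e :: real assume "e > 0"
  then obtain \<beta>0 where "\<beta>0 > 0" and \<beta>0: "\<forall>z z'. norm (z' - z) \<le> \<beta>0 \<longrightarrow> norm (melnikov z' - melnikov z) \<le> e / 2"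
    using melnikov_unif_continuous[of "e / 2"] by auto
  have "dist (melnikov z') (melnikov z) < e" if "dist z' z < \<beta>0" for z'
  proof -
    have "norm (melnikov z' - melnikov z) \<le> e / 2" using \<beta>0 that by (simp add: dist_norm)
    then show ?thesis using \<open>e > 0\<close> by (simp add: dist_norm)
  qed
  then show "\<exists>d>0. \<forall>z'\<in>UNIV. dist z' z < d \<longrightarrow> dist (melnikov z') (melnikov z) < e"
    using \<open>\<beta>0 > 0\<close> by blast
qed

text \<open>An absolutely continuous velocity is the integral of its derivative almost everywhere,
  so \<open>y\<close> and \<open>\<epsilon> q - r\<close> have equal increments, with
  \<open>r\<close> a primitive of the continuous function \<open>f (x t)\<close>. Thus
  \<open>y - \<epsilon> q\<close> is a constant minus \<open>r\<close>, which is differentiable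
  everywhere.\<close>

lemma caratheodory_reduction:
  assumes q: "indef_integral p q"
    and sol: "caratheodory_solution (\<lambda>t x. \<epsilon> * p t - f x) x y"
  shows "((\<lambda>t. y t - \<epsilon> * q t) has_real_derivative - f (x t)) (at t)"
proof -
  have dx: "(x has_real_derivative y t) (at t)" for t
    using sol by (simp add: caratheodory_solution_def)
  have ac: "abs_continuous_on_interval a b y" for a b
    using sol by (simp add: caratheodory_solution_def)
  have "AE t in lebesgue. (y has_real_derivative \<epsilon> * p t - f (x t)) (at t)"
    using sol by (simp add: caratheodory_solution_def)
  from AE_E3[OF this] obtain N where N: "\<forall>t. t \<in> space lebesgue - N \<longrightarrow> (y has_real_derivative \<epsilon> * p t - f (x t)) (at t)"
    "N \<in> null_sets lebesgue" by metis
  have neg: "negligible N" using N(2) by (simp add: negligible_iff_null_sets)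
  have "continuous_on UNIV (\<lambda>t. f (x t))"
    using DERIV_isCont[OF DERIV_chain2[OF f_deriv dx]] by (simp add: continuous_at_imp_continuous_on)
  from continuous_antiderivative[OF this]
  obtain r where "r 0 = 0 \<and> (\<forall>t. (r has_vector_derivative f (x t)) (at t))" ..
  then have r: "(r has_vector_derivative f (x t)) (at t)" for t by blast
  note ri = indef_integral_of_derivative[of r "\<lambda>t. f (x t)", OF r]
  have incr: "y b - y a = \<epsilon> * (q b - q a) - (r b - r a)" if "a \<le> b" for a b
  proof -
    have 1: "((\<lambda>t. \<epsilon> * p t - f (x t)) has_integral (y b - y a)) {a..b}"
      by (rule abs_continuous_fundamental_theorem[OF that ac neg]) (use N(1) in auto)
    have 2: "((\<lambda>t. \<epsilon> * p t - f (x t)) has_integral (\<epsilon> * (q b - q a) - (r b - r a))) {a..b}"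
      by (intro has_integral_diff has_integral_mult_right indef_integralD[OF q that] indef_integralD[OF ri that])
    show ?thesis by (rule has_integral_unique[OF 1 2])
  qed
  define c where "c = y 0 - \<epsilon> * q 0 + r 0"
  have "y t - \<epsilon> * q t = c - r t" for t
  proof (cases "0 \<le> t")
    case True
    from incr[OF this] show ?thesis by (simp add: c_def right_diff_distrib)
  next
    case False
    then have "t \<le> 0" by simp
    from incr[OF this] show ?thesis by (simp add: c_def right_diff_distrib)
  qed
  moreover have "((\<lambda>t. c - r t) has_real_derivative 0 - f (x t)) (at t)"
    using r[of t] by (intro DERIV_diff DERIV_const) (simp add: has_real_derivative_iff_has_vector_derivative)
  ultimately show ?thesis by simp
qed

text \<open>The step field \<open>\<epsilon> \<i> melnikov\<close>, its bounds and its oscillation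
  scale with \<open>\<bar>\<epsilon>\<bar>\<close>, whereas the radius \<open>d\<close> does not.
  Smallness of \<epsilon> therefore serves two purposes: the error of the expansion, and steps
  shorter than \<open>d\<close>.\<close>

lemma small_forcing_resonant:
  assumes "c > 0" and low: "\<And>z. c \<le> norm (melnikov z)"
  shows "\<exists>\<epsilon>0>0. \<forall>\<epsilon> x v. 0 < \<bar>\<epsilon>\<bar> \<longrightarrow> \<bar>\<epsilon>\<bar> \<le> \<epsilon>0 \<longrightarrow>
    caratheodory_solution (\<lambda>t x. \<epsilon> * p t - f x) x v \<longrightarrow> unbounded_solution x v"
proof -
  obtain q where q: "indef_integral p q" "q 0 = 0"
    using indef_integral_exists[of p] p_int by (auto simp: set_lebesgue_integral_eq_integral(1))
  have "c / 16 > 0" "c / 8 > 0" using \<open>c > 0\<close> by auto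
  from poincare_step[OF q this(1)] obtain \<epsilon>1 where "\<epsilon>1 > 0" and \<epsilon>1: "\<forall>\<epsilon> x a. \<bar>\<epsilon>\<bar> \<le> \<epsilon>1 \<longrightarrow>
    (\<forall>t. (x has_real_derivative a t + \<epsilon> * q t) (at t) \<and> (a has_real_derivative - f (x t)) (at t)) \<longrightarrow>
    norm (Complex (x (2 * pi)) (a (2 * pi) + \<epsilon> * q (2 * pi)) - Complex (x 0) (a 0)
      - \<epsilon> *\<^sub>R (\<i> * melnikov (Complex (x 0) (a 0)))) \<le> c / 16 * \<bar>\<epsilon>\<bar>" by (elim exE conjE)
  from melnikov_unif_continuous[OF \<open>c / 8 > 0\<close>] obtain d where "d > 0" and
    d: "\<forall>z z'. norm (z' - z) \<le> d \<longrightarrow> norm (melnikov z' - melnikov z) \<le> c / 8" by (elim exE conjE)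
  define M where "M = p_norm * (2 * \<Lambda>)"
  have "M \<ge> 0" using p_norm_nonneg \<Lambda>_ge_1 by (simp add: M_def)
  define \<epsilon>0 where "\<epsilon>0 = min \<epsilon>1 (d / (M + c))"
  have "\<epsilon>0 > 0" using \<open>\<epsilon>1 > 0\<close> \<open>d > 0\<close> \<open>M \<ge> 0\<close> \<open>c > 0\<close> by (simp add: \<epsilon>0_def)
  have main: "unbounded_solution x v"
    if \<epsilon>: "0 < \<bar>\<epsilon>\<bar>" "\<bar>\<epsilon>\<bar> \<le> \<epsilon>0" and sol: "caratheodory_solution (\<lambda>t x. \<epsilon> * p t - f x) x v" for \<epsilon> x v
  proof -
    have dx: "(x has_real_derivative v t) (at t)" for t using sol by (simp add: caratheodory_solution_def)
    define z where "z n = Complex (x (2 * pi * real n)) (v (2 * pi * real n))" for n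
    define G where "G w = \<epsilon> *\<^sub>R (\<i> * melnikov w)" for w
    have nG: "norm (G w) = \<bar>\<epsilon>\<bar> * norm (melnikov w)" for w by (simp add: G_def norm_mult)
    have "\<not> bounded (range z)"
    proof (rule near_field_orbit_unbounded[of G "\<bar>\<epsilon>\<bar> * c" "\<bar>\<epsilon>\<bar> * M" d])
      show "continuous_on UNIV G" unfolding G_def by (intro continuous_intros melnikov_continuous)
      show "\<bar>\<epsilon>\<bar> * c \<le> norm (G w)" for w unfolding nG by (intro mult_left_mono low) auto
      show "norm (G w) \<le> \<bar>\<epsilon>\<bar> * M" for w unfolding nG M_def by (intro mult_left_mono melnikov_bound) auto
      have "\<bar>\<epsilon>\<bar> \<le> d / (M + c)" using \<epsilon> by (simp add: \<epsilon>0_def)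
      then show "\<bar>\<epsilon>\<bar> * M + \<bar>\<epsilon>\<bar> * c \<le> d" using \<open>M \<ge> 0\<close> \<open>c > 0\<close> by (simp add: le_divide_eq distrib_left)
      show "norm (G w' - G w) \<le> \<bar>\<epsilon>\<bar> * c / 8" if "norm (w' - w) \<le> d" for w w'
      proof -
        have "G w' - G w = \<epsilon> *\<^sub>R (\<i> * (melnikov w' - melnikov w))"
          by (simp add: G_def scaleR_conv_of_real algebra_simps)
        then have "norm (G w' - G w) = \<bar>\<epsilon>\<bar> * norm (melnikov w' - melnikov w)" by (simp add: norm_mult)
        also have "\<dots> \<le> \<bar>\<epsilon>\<bar> * (c / 8)" using d that by (intro mult_left_mono) auto
        finally show ?thesis by simp
      qed
      show "norm (z (Suc n) - z n - G (z n)) \<le> \<bar>\<epsilon>\<bar> * c / 16" for n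
      proof -
        define T where "T = 2 * pi * real n"
        \<comment> \<open>Subtracting \<open>\<epsilon> * q t\<close> instead of
          \<open>\<epsilon> * q (t + T)\<close> makes \<open>an 0\<close> the true velocity at time
          \<open>T\<close>; the two versions differ by a constant since \<open>p\<close> is
          periodic.\<close>
        define xn an where "xn t = x (t + T)" and "an t = v (t + T) - \<epsilon> * q t" for t
        have pT: "p (t + T) = p t" for t
        proof -
          have "p (t + 2 * pi * real k) = p t" for k
          proof (induction k)
            case (Suc k)
            have "p (t + 2 * pi * real (Suc k)) = p ((t + 2 * pi * real k) + 2 * pi)" by (simp add: algebra_simps)
            then show ?case using p_per[of "t + 2 * pi * real k"] Suc by simp
          qed simp
          then show ?thesis by (simp add: T_def)
        qed
        have qT: "q (t + T) = q t + (q T - q 0)" for t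
          using indef_integral_periodic_shift[OF q(1) pT, of t] by simp
        have "(xn has_real_derivative an t + \<epsilon> * q t) (at t)" for t
          using dx[of "t + T"] by (simp add: xn_def[abs_def] DERIV_shift an_def)
        moreover have "(an has_real_derivative - f (xn t)) (at t)" for t
        proof -
          have "((\<lambda>t. v (t + T) - \<epsilon> * q (t + T)) has_real_derivative - f (x (t + T))) (at t)"
            using caratheodory_reduction[OF q(1) sol, of "t + T"] by (simp add: DERIV_shift)
          from DERIV_add[OF this DERIV_const[of "\<epsilon> * (q T - q 0)"]]
          have "((\<lambda>t. v (t + T) - \<epsilon> * q (t + T) + \<epsilon> * (q T - q 0)) has_real_derivative - f (xn t)) (at t)"
            by (simp add: xn_def)
          moreover have "an = (\<lambda>t. v (t + T) - \<epsilon> * q (t + T) + \<epsilon> * (q T - q 0))"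
            unfolding an_def[abs_def] qT by (rule ext) algebra
          ultimately show ?thesis by (simp only:)
        qed
        ultimately have sol_n: "\<forall>t. (xn has_real_derivative an t + \<epsilon> * q t) (at t) \<and> (an has_real_derivative - f (xn t)) (at t)"
          by blast
        have "\<bar>\<epsilon>\<bar> \<le> \<epsilon>1" using \<epsilon> by (simp add: \<epsilon>0_def)
        from mp[OF mp[OF spec[OF spec[OF spec[OF \<epsilon>1, of \<epsilon>], of xn], of an] this] sol_n]
        have "norm (Complex (xn (2 * pi)) (an (2 * pi) + \<epsilon> * q (2 * pi)) - Complex (xn 0) (an 0)
          - \<epsilon> *\<^sub>R (\<i> * melnikov (Complex (xn 0) (an 0)))) \<le> c / 16 * \<bar>\<epsilon>\<bar>" .
        moreover have "Complex (xn 0) (an 0) = z n" by (simp add: xn_def an_def z_def T_def q(2))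
        moreover have "Complex (xn (2 * pi)) (an (2 * pi) + \<epsilon> * q (2 * pi)) = z (Suc n)"
          by (simp add: xn_def an_def z_def T_def algebra_simps)
        moreover have "c / 16 * \<bar>\<epsilon>\<bar> = \<bar>\<epsilon>\<bar> * c / 16" by simp
        ultimately show ?thesis by (simp only: G_def)
      qed
    qed (use \<epsilon> \<open>c > 0\<close> in auto)
    \<comment> \<open>The times \<open>2 * pi * real (m n)\<close> obtained here need not increase;
      growth of the state is all that is asked.\<close>
    have "\<exists>m. real n < norm (z m)" for n
    proof (rule ccontr)
      assume "\<not> (\<exists>m. real n < norm (z m))"
      then have "\<forall>w\<in>range z. norm w \<le> real n" by (auto simp: not_less)
      then have "bounded (range z)" unfolding bounded_iff by blast
      with \<open>\<not> bounded (range z)\<close> show False ..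
    qed
    then obtain m where m: "\<And>n. real n < norm (z (m n))" by metis
    show ?thesis unfolding unbounded_solution_def
    proof (intro exI)
      show "filterlim (\<lambda>n. \<bar>x (2 * pi * real (m n))\<bar> + \<bar>v (2 * pi * real (m n))\<bar>) at_top sequentially"
      proof (rule filterlim_at_top_mono[OF filterlim_real_sequentially], rule always_eventually, rule allI)
        fix n
        show "real n \<le> \<bar>x (2 * pi * real (m n))\<bar> + \<bar>v (2 * pi * real (m n))\<bar>"
          using m[of n] cmod_le[of "z (m n)"] by (simp add: z_def)
      qed
    qed
  qed
  show ?thesis by (intro exI[of _ \<epsilon>0] conjI[OF \<open>\<epsilon>0 > 0\<close>] allI impI) (rule main)
qed

end

section \<open>Identification with the given data and conclusion\<close>

theorem theorem1:
  fixes V p :: "real \<Rightarrow> real"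
  assumes "C2_real V"
    and "V 0 = 0"
    and "\<And>x. x \<noteq> 0 \<Longrightarrow> x * deriv V x > 0"
    and "all_solutions_periodic V"
    and "bounded (range (deriv (deriv V)))"
    and "L1_torus p"
    and "(INF z\<in>cylinder. norm (\<Phi> V p z)) > 0"
  shows "\<exists>\<epsilon>\<^sub>0>0. \<forall>\<epsilon>. 0 < \<bar>\<epsilon>\<bar> \<and> \<bar>\<epsilon>\<bar> < \<epsilon>\<^sub>0 \<longrightarrow> resonant V (\<lambda>t. \<epsilon> * p t)"
proof -
  obtain L where L: "\<And>x. \<bar>deriv (deriv V) x\<bar> \<le> L"
    using assms(5) unfolding bounded_iff by auto
  have dV: "(V has_real_derivative deriv V x) (at x)" for x
    using assms(1) by (simp add: C2_real_def differentiable_on_def DERIV_deriv_iff_real_differentiable)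
  have ddV: "(deriv V has_real_derivative deriv (deriv V) x) (at x)" for x
    using assms(1) by (simp add: C2_real_def differentiable_on_def DERIV_deriv_iff_real_differentiable)
  interpret forced_isochronous V "deriv V" "deriv (deriv V)" L p
  proof
    show "continuous_on UNIV (deriv (deriv V))" using assms(1) by (simp add: C2_real_def)
    show "deriv V 0 = 0" by (rule sign_change_zero[OF DERIV_isCont[OF ddV] assms(3)])
    show "periodic_2pi x" if "classical_solution (\<lambda>t x. - deriv V x) x v" for x v
      using assms(4) that unfolding all_solutions_periodic_def by blast
    show "p absolutely_integrable_on {a..b}" for a b using assms(6) by (simp add: L1_torus_def)
    show "p (t + 2 * pi) = p t" for t using assms(6) by (simp add: L1_torus_def periodic_2pi_def)
  qed (use dV ddV L assms(3) in auto)
  have phi: "\<phi> V t r = X (complex_of_real r) t" for t r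
    unfolding \<phi>_def the_orbit[unfolded orbit_def] ..
  have psi: "\<psi> V t r = psi (complex_of_real r) t" for t r
    unfolding \<psi>_def phi the_clinearised[unfolded clinearised_def] ..
  define c0 where "c0 = (INF z\<in>cylinder. norm (\<Phi> V p z))"
  have "c0 > 0" using assms(7) by (simp add: c0_def)
  have c0_le: "c0 \<le> norm (\<Phi> V p (\<theta>, r))" if "r \<ge> 0" for \<theta> r
    unfolding c0_def by (rule cINF_lower) (use that in \<open>auto simp: cylinder_def intro: bdd_belowI[of _ 0]\<close>)
  have "2 * pi * c0 \<le> norm (integral {0..2 * pi} (\<lambda>t. p (t - \<theta>) *\<^sub>R psi (of_real r) t))" if "r \<ge> 0" for \<theta> r
  proof -
    let ?g = "\<lambda>t. complex_of_real (p (t - \<theta>)) * \<psi> V t r"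
    have \<Phi>: "\<Phi> V p (\<theta>, r) = complex_of_real (1 / (2 * pi)) * (LINT t:{0..2 * pi}|lebesgue. ?g t)"
      by (simp add: \<Phi>_def)
    \<comment> \<open>A non-integrable function has Lebesgue integral \<open>0\<close> by
      convention, which the positive infimum excludes. Integrability then identifies the Lebesgue
      integral with the gauge integral.\<close>
    have "set_integrable lebesgue {0..2 * pi} ?g"
    proof (rule ccontr)
      assume "\<not> set_integrable lebesgue {0..2 * pi} ?g"
      then have "\<Phi> V p (\<theta>, r) = 0"
        unfolding \<Phi> set_lebesgue_integral_def set_integrable_def by (simp add: not_integrable_integral_eq)
      then show False using c0_le[OF that, of \<theta>] \<open>c0 > 0\<close> by simp
    qed
    then have "\<Phi> V p (\<theta>, r) = complex_of_real (1 / (2 * pi)) * integral {0..2 * pi} (\<lambda>t. p (t - \<theta>) *\<^sub>R psi (of_real r) t)"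
      unfolding \<Phi> by (simp add: set_lebesgue_integral_eq_integral(2) psi scaleR_conv_of_real)
    then have "norm (\<Phi> V p (\<theta>, r)) = 1 / (2 * pi) * norm (integral {0..2 * pi} (\<lambda>t. p (t - \<theta>) *\<^sub>R psi (of_real r) t))"
      by (simp add: norm_mult norm_divide)
    then have "2 * pi * norm (\<Phi> V p (\<theta>, r)) = norm (integral {0..2 * pi} (\<lambda>t. p (t - \<theta>) *\<^sub>R psi (of_real r) t))"
      by simp
    moreover have "2 * pi * c0 \<le> 2 * pi * norm (\<Phi> V p (\<theta>, r))"
      using c0_le[OF that, of \<theta>] by (intro mult_left_mono) auto
    ultimately show ?thesis by (simp only:)
  qed
  note low = melnikov_lower_bound[OF this]
  have "2 * pi * c0 / (4 * \<Lambda>) \<le> norm (melnikov z)" for z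
    using low[of z] \<Lambda>_ge_1 by (simp add: divide_le_eq mult_ac)
  moreover have "2 * pi * c0 / (4 * \<Lambda>) > 0" using \<open>c0 > 0\<close> \<Lambda>_ge_1 by simp
  ultimately obtain \<epsilon>0 where "\<epsilon>0 > 0" and \<epsilon>0: "\<forall>\<epsilon> x v. 0 < \<bar>\<epsilon>\<bar> \<longrightarrow> \<bar>\<epsilon>\<bar> \<le> \<epsilon>0 \<longrightarrow>
    caratheodory_solution (\<lambda>t x. \<epsilon> * p t - deriv V x) x v \<longrightarrow> unbounded_solution x v"
    using small_forcing_resonant by blast
  show ?thesis unfolding resonant_def
  proof (intro exI[of _ \<epsilon>0] conjI allI impI)
    fix \<epsilon> x v
    assume "0 < \<bar>\<epsilon>\<bar> \<and> \<bar>\<epsilon>\<bar> < \<epsilon>0" "caratheodory_solution (\<lambda>t x. \<epsilon> * p t - deriv V x) x v"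
    then show "unbounded_solution x v" by (intro \<epsilon>0[rule_format, of \<epsilon>]) auto
  qed (rule \<open>\<epsilon>0 > 0\<close>)
qed

end
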